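(* Let $k,m\ge 2$ be integers. The monoid $\mathcal{POI}_{k\times m}$ is defined by the monoid presentation $\langle A\cup B\cup X\mid R\cup W\cup R'\rangle$ on $3k$ generators and $\frac12\left(9k^2+(2m+7)k-4\right)$ relations, where $A=\{a_1,\dots,a_k\}$, $B=\{b_1,\dots,b_k\}$, $X=\{x_0,\dots,x_{k-1}\}$ and $R$, $W$, $R'$ are the sets of relations listed in the context; that is, $\mathcal{POI}_{k\times m}\cong (A\cup B\cup X)^*/\rho$, where $\rho$ is the smallest congruence on the free monoid $(A\cup B\cup X)^*$ containing $R\cup W\cup R'$.
   Context: Maps are written on the right and composed from left to right. Let $n=km$, $\Omega_n=\{1,\dots,n\}$ and $I_i=\{(i-1)m+1,\dots,im\}$ for $1\le i\le k$. For $x\in\Omega_n$ let $i_x$ denote the index with $x\in I_{i_x}$. $\mathcal{POI}_{k\times m}$ is the monoid, under composition, of all injective partial maps $\alpha$ from $\Omega_n$ to $\Omega_n$ (the empty map included) such that: (stability) for all $x\in\mathrm{Dom}(\alpha)$, $I_{i_x}\subseteq\mathrm{Dom}(\alpha)$ and $I_{i_x}\alpha=I_{i_{x\alpha}}$; (order preservation) for all $x,y\in\mathrm{Dom}(\alpha)$, $i_x\le i_y$ implies $i_{x\alpha}\le i_{y\alpha}$. In the lists, a chain $u=v=w$ stands for the two relations $u=v$ and $v=w$. $R$ consists of: $a_i^2=1$, $b_i^m=1$, $(b_ia_i)^{m-1}=1$, $(a_ib_i^{m-1}a_ib_i)^3=1$ for $1\le i\le k$; $(a_ib_i^{m-j}a_ib_i^j)^2=1$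 for $2\le j\le m-2$, $1\le i\le k$; $a_ia_j=a_ja_i$ and $b_ib_j=b_jb_i$ for $1\le i<j\le k$; $a_ib_j=b_ja_i$ for $1\le i,j\le k$, $i\ne j$. $W$ consists of: $x_ix_0=x_0x_{i+1}$, $1\le i\le k-2$; $x_jx_i=x_ix_j$, $2\le i+1<j\le k-1$; $x_0^2x_1=x_0^2=x_{k-1}x_0^2$; $x_{i+1}x_ix_{i+1}=x_{i+1}x_i=x_ix_{i+1}x_i$, $1\le i\le k-2$; $x_ix_{i+1}\cdots x_{k-1}x_0x_1\cdots x_{i-1}x_i=x_i$, $0\le i\le k-1$; $x_{i+1}\cdots x_{k-1}x_0x_1\cdots x_{i-1}x_i^2=x_i^2$, $1\le i\le k-1$. $R'$ consists of: $a_1x_0=x_0$, $b_1x_0=x_0$; $x_0a_i=a_{i+1}x_0$, $x_0b_i=b_{i+1}x_0$, $1\le i\le k-1$; $x_ia_{k-i}=x_i$, $x_ib_{k-i}=x_i$, $0\le i\le k-1$; $a_ix_{k-i+1}=x_{k-i+1}$, $b_ix_{k-i+1}=x_{k-i+1}$, $2\le i\le k$; $x_ia_{k-i+1}=a_{k-i}x_i$, $x_ib_{k-i+1}=b_{k-i}x_i$, $1\le i\le k-1$; $x_ia_j=a_jx_i$, $x_ib_j=b_jx_i$, $1\le i\le k-1$, $1\le j\le k$, $j\notin\{k-i,k-i+1\}$.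
   Formalization: The printed number of relations is proved for m ≥ 3; for m = 2 it is false (k = m = 2 has 29 relations, not 27, as the family 2 ≤ j ≤ m−2 is empty rather than of size m−3 = −1), and the corrected count, the printed formula plus k, is proved instead. *)

theory Defs
  imports Complex_Main "HOL-Algebra.Group"
begin

section \<open>The monoid of partial injections\<close>

definition Omega :: "nat \<Rightarrow> nat set" where
  "Omega n = {1..n}"

definition block :: "nat \<Rightarrow> nat \<Rightarrow> nat set" where
  "block m i = {(i - 1) * m + 1..i * m}"

definition block_index :: "nat \<Rightarrow> nat \<Rightarrow> nat \<Rightarrow> nat" where
  "block_index k m x = (THE i. i \<in> {1..k} \<and> x \<in> block m i)"

text \<open>A partial map is undefined at \<open>x\<close> iff its value there is \<open>None\<close>; the image of \<open>x\<close> in the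
  domain is \<open>the (\<alpha> x)\<close>.\<close>

definition POI_carrier :: "nat \<Rightarrow> nat \<Rightarrow> (nat \<rightharpoonup> nat) set" where
  "POI_carrier k m = {\<alpha>.
     dom \<alpha> \<subseteq> Omega (k * m) \<and> ran \<alpha> \<subseteq> Omega (k * m) \<and> inj_on \<alpha> (dom \<alpha>) \<and>
     (\<forall>x \<in> dom \<alpha>. block m (block_index k m x) \<subseteq> dom \<alpha> \<and>
        (\<lambda>y. the (\<alpha> y)) ` block m (block_index k m x) = block m (block_index k m (the (\<alpha> x)))) \<and>
     (\<forall>x \<in> dom \<alpha>. \<forall>y \<in> dom \<alpha>. block_index k m x \<le> block_index k m y \<longrightarrow>
        block_index k m (the (\<alpha> x)) \<le> block_index k m (the (\<alpha> y)))}"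

text \<open>Maps act on the right, so the product \<open>\<alpha>\<beta>\<close> means first \<open>\<alpha>\<close>, then \<open>\<beta>\<close>, whereas
  \<open>f \<circ>\<^sub>m g\<close> applies \<open>g\<close> first. The identity has domain \<open>Omega (k * m)\<close>.\<close>

definition POI :: "nat \<Rightarrow> nat \<Rightarrow> (nat \<rightharpoonup> nat) monoid" where
  "POI k m = \<lparr>carrier = POI_carrier k m, mult = (\<lambda>\<alpha> \<beta>. \<beta> \<circ>\<^sub>m \<alpha>), one = Some |` Omega (k * m)\<rparr>"

section \<open>Monoid presentations\<close>

text \<open>The free monoid on \<open>S\<close> is \<open>lists S\<close> under concatenation; a relation \<open>u = v\<close> is the pair
  \<open>(u, v)\<close>.\<close>

definition monoid_congruence :: "'a set \<Rightarrow> ('a list \<times> 'a list) set \<Rightarrow> bool" where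
  "monoid_congruence S r \<longleftrightarrow>
     equiv (lists S) r \<and> (\<forall>(u, v) \<in> r. \<forall>(u', v') \<in> r. (u @ u', v @ v') \<in> r)"

definition generated_congruence ::
    "'a set \<Rightarrow> ('a list \<times> 'a list) set \<Rightarrow> ('a list \<times> 'a list) set" where
  "generated_congruence S R = \<Inter> {r. monoid_congruence S r \<and> R \<subseteq> r}"

definition presented_monoid :: "'a set \<Rightarrow> ('a list \<times> 'a list) set \<Rightarrow> 'a list set monoid" where
  "presented_monoid S R = (let \<rho> = generated_congruence S R in
     \<lparr>carrier = lists S // \<rho>,
      mult = (\<lambda>U V. \<Union>u \<in> U. \<Union>v \<in> V. \<rho> `` {u @ v}),
      one = \<rho> `` {[]}\<rparr>)"

lemma monoid_congruence_lists_times_lists: "monoid_congruence S (lists S \<times> lists S)"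
  by (auto simp: monoid_congruence_def equiv_def refl_on_def sym_def trans_def)

lemma monoid_congruence_generated:
  assumes "R \<subseteq> lists S \<times> lists S"
  shows "monoid_congruence S (generated_congruence S R)"
proof -
  let ?\<C> = "{r. monoid_congruence S r \<and> R \<subseteq> r}"
  have re: "refl_on (lists S) r" and sy: "sym r" and tr: "trans r" if "r \<in> ?\<C>" for r
    using that by (simp_all add: monoid_congruence_def equiv_def)
  have app: "(u @ u', v @ v') \<in> r" if "r \<in> ?\<C>" "(u, v) \<in> r" "(u', v') \<in> r" for r u v u' v'
    using that unfolding monoid_congruence_def by blast
  have "lists S \<times> lists S \<in> ?\<C>"
    using assms monoid_congruence_lists_times_lists by auto
  then have "\<Inter> ?\<C> \<subseteq> lists S \<times> lists S"
    by (rule Inter_lower)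
  moreover have "refl_on (lists S) (\<Inter> ?\<C>)"
    by (intro refl_onI InterI) (rule refl_onD[OF re])
  moreover have "sym (\<Inter> ?\<C>)"
    by (intro symI InterI) (rule symD[OF sy], assumption, erule InterD)
  moreover have "trans (\<Inter> ?\<C>)"
    by (intro transI InterI) (rule transD[OF tr], assumption, erule InterD, assumption, erule InterD)
  ultimately have "equiv (lists S) (\<Inter> ?\<C>)"
    by (simp add: equiv_def)
  moreover have "(u @ u', v @ v') \<in> \<Inter> ?\<C>" if "(u, v) \<in> \<Inter> ?\<C>" "(u', v') \<in> \<Inter> ?\<C>" for u v u' v'
    by (rule InterI) (rule app, assumption, rule InterD[OF that(1)], assumption,
        rule InterD[OF that(2)])
  ultimately show ?thesis
    unfolding monoid_congruence_def generated_congruence_def by auto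
qed

section \<open>The generators and relations\<close>

datatype gen = ga nat | gb nat | gx nat

definition generators :: "nat \<Rightarrow> gen set" where
  "generators k = ga ` {1..k} \<union> gb ` {1..k} \<union> gx ` {0..k - 1}"

definition wpow :: "'a list \<Rightarrow> nat \<Rightarrow> 'a list" (infixr \<open>\<up>\<close> 80) where
  "w \<up> e = concat (replicate e w)"

definition rels_R :: "nat \<Rightarrow> nat \<Rightarrow> (gen list \<times> gen list) set" where
  "rels_R k m =
     {([ga i] \<up> 2, []) | i. 1 \<le> i \<and> i \<le> k} \<union>
     {([gb i] \<up> m, []) | i. 1 \<le> i \<and> i \<le> k} \<union>
     {([gb i, ga i] \<up> (m - 1), []) | i. 1 \<le> i \<and> i \<le> k} \<union>
     {(([ga i] @ [gb i] \<up> (m - 1) @ [ga i] @ [gb i]) \<up> 3, []) | i. 1 \<le> i \<and> i \<le> k} \<union>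
     {(([ga i] @ [gb i] \<up> (m - j) @ [ga i] @ [gb i] \<up> j) \<up> 2, []) | i j.
        2 \<le> j \<and> j \<le> m - 2 \<and> 1 \<le> i \<and> i \<le> k} \<union>
     {([ga i, ga j], [ga j, ga i]) | i j. 1 \<le> i \<and> i < j \<and> j \<le> k} \<union>
     {([gb i, gb j], [gb j, gb i]) | i j. 1 \<le> i \<and> i < j \<and> j \<le> k} \<union>
     {([ga i, gb j], [gb j, ga i]) | i j. 1 \<le> i \<and> i \<le> k \<and> 1 \<le> j \<and> j \<le> k \<and> i \<noteq> j}"

text \<open>\<open>cyc k i\<close> is the word \<open>x\<^sub>i x\<^sub>i\<^sub>+\<^sub>1 \<dots> x\<^sub>k\<^sub>-\<^sub>1 x\<^sub>0 x\<^sub>1 \<dots> x\<^sub>i\<^sub>-\<^sub>1\<close>, and \<open>cyc' k i\<close> is the same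
  word without its first letter.\<close>

definition cyc :: "nat \<Rightarrow> nat \<Rightarrow> gen list" where
  "cyc k i = map gx [i..<k] @ map gx [0..<i]"

definition cyc' :: "nat \<Rightarrow> nat \<Rightarrow> gen list" where
  "cyc' k i = map gx [i + 1..<k] @ map gx [0..<i]"

definition rels_W :: "nat \<Rightarrow> (gen list \<times> gen list) set" where
  "rels_W k =
     {([gx i, gx 0], [gx 0, gx (i + 1)]) | i. 1 \<le> i \<and> i \<le> k - 2} \<union>
     {([gx j, gx i], [gx i, gx j]) | i j. 2 \<le> i + 1 \<and> i + 1 < j \<and> j \<le> k - 1} \<union>
     {([gx 0, gx 0, gx 1], [gx 0, gx 0])} \<union>
     {([gx 0, gx 0], [gx (k - 1), gx 0, gx 0])} \<union>
     {([gx (i + 1), gx i, gx (i + 1)], [gx (i + 1), gx i]) | i. 1 \<le> i \<and> i \<le> k - 2} \<union>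
     {([gx (i + 1), gx i], [gx i, gx (i + 1), gx i]) | i. 1 \<le> i \<and> i \<le> k - 2} \<union>
     {(cyc k i @ [gx i], [gx i]) | i. 0 \<le> i \<and> i \<le> k - 1} \<union>
     {(cyc' k i @ [gx i, gx i], [gx i, gx i]) | i. 1 \<le> i \<and> i \<le> k - 1}"

definition rels_R' :: "nat \<Rightarrow> (gen list \<times> gen list) set" where
  "rels_R' k =
     (\<Union>g \<in> {ga, gb}.
        {([g 1, gx 0], [gx 0])} \<union>
        {([gx 0, g i], [g (i + 1), gx 0]) | i. 1 \<le> i \<and> i \<le> k - 1} \<union>
        {([gx i, g (k - i)], [gx i]) | i. 0 \<le> i \<and> i \<le> k - 1} \<union>
        {([g i, gx (k - i + 1)], [gx (k - i + 1)]) | i. 2 \<le> i \<and> i \<le> k} \<union>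
        {([gx i, g (k - i + 1)], [g (k - i), gx i]) | i. 1 \<le> i \<and> i \<le> k - 1} \<union>
        {([gx i, g j], [g j, gx i]) | i j.
           1 \<le> i \<and> i \<le> k - 1 \<and> 1 \<le> j \<and> j \<le> k \<and> j \<notin> {k - i, k - i + 1}})"

definition relations :: "nat \<Rightarrow> nat \<Rightarrow> (gen list \<times> gen list) set" where
  "relations k m = rels_R k m \<union> rels_W k \<union> rels_R' k"

lemma set_wpow: "set (w \<up> e) = (if e = 0 then {} else set w)"
  by (simp add: wpow_def)

lemma relations_are_words:
  assumes "2 \<le> k" and "(u, v) \<in> relations k m"
  shows "u \<in> lists (generators k)" and "v \<in> lists (generators k)"
proof -
  have "set u \<subseteq> generators k \<and> set v \<subseteq> generators k" if "(u, v) \<in> rels_R k m"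
    using that unfolding rels_R_def
    by (elim UnE CollectE exE conjE; simp add: set_wpow generators_def image_iff)
  moreover have "set u \<subseteq> generators k \<and> set v \<subseteq> generators k" if "(u, v) \<in> rels_W k"
    using that assms(1) unfolding rels_W_def cyc_def cyc'_def
    by (elim UnE CollectE exE conjE; auto simp add: generators_def image_iff)
  moreover have "set u \<subseteq> generators k \<and> set v \<subseteq> generators k" if "(u, v) \<in> rels_R' k"
    using that assms(1) unfolding rels_R'_def
    by (elim UN_E UnE CollectE exE conjE insertE emptyE; auto simp: generators_def image_iff)
  ultimately have "set u \<subseteq> generators k \<and> set v \<subseteq> generators k"
    using assms(2) unfolding relations_def by blast
  then show "u \<in> lists (generators k)" and "v \<in> lists (generators k)"
    by auto
qed

end

(* The monoid is a wreath product of S_m with the monoid POI_k of order-preserving partial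
   injections of the k blocks, and a word is brought to a normal form accordingly. By R' the letters
   a_i, b_i can be moved to the left of all x-letters; this leaves g w with g a product of k words
   g_i in a_i, b_i and w a word in the x_i.

   By W the word E_i = x_i x_{i+1} ... x_{i-1} (indices modulo k) is an idempotent, the identity with
   one block removed. These idempotents commute and shift along the x_i, so that w equals
   (product of the E_i for blocks outside A) w, where A is the set of blocks on which w is defined,
   and on A every letter of w acts injectively. With fixed words P_B from {1..|B|} to B one has
   P_B x = P_{B x}, and P_A has a left inverse Q_A relative to A; hence w = Q_A P_A w = Q_A P_{A w}
   depends only on the domain and the image of w.

   The component g_i is absorbed by w if i is not in A, and is otherwise determined by its
   permutation, since R gives the Coxeter relations for s_j = b^(m-j) a b^j, and b = s_{m-2} ... s_0.

   Equations in the presented monoid are computed in its regular representation, whose elements form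
   a type of class monoid_mult. *)

theory Submission
  imports Defs
begin

section \<open>Rank-lowering idempotents\<close>

text \<open>Two kinds of equations must be kept apart: those forced by the relations, which are
  derived in an arbitrary monoid, and those between partial maps, which are checked pointwise. The
  bridge is that the relations hold for the maps, so a derived equation is also one between maps
  (\<open>separates\<close>, \<open>sep\<close>). Words can therefore be rewritten freely and the
  map of the result read off afterwards; no rewriting step needs its own proof that it keeps the
  map.

  The delicate point for the x-letters is a pair of neighbouring removed blocks. The inverse
  \<open>d j\<close> of \<open>u j\<close> is a long word, and W has no relation equating the
  squares of the two, although both are the identity without the blocks \<open>j\<close> and
  \<open>j + 1\<close>. Their equality combines the relations for x_0^2, the braid-like relations
  and the last family of W; the shift of \<open>e j\<close> along \<open>u j\<close> and the
  commutation of all the idempotents depend on it.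

  That every element of the monoid is induced by a word is a separate argument: the block map is
  factored through an initial segment, and two increasing maps with the same domain and image are
  equal.\<close>

definition desc :: "(nat \<Rightarrow> 'a::monoid_mult) \<Rightarrow> nat \<Rightarrow> nat \<Rightarrow> 'a" where
  "desc u a b = prod_list (map u (rev [a..<b]))"

lemma desc_empty [simp]: "b \<le> a \<Longrightarrow> desc u a b = 1"
  by (simp add: desc_def)

lemma desc_Suc: "a \<le> b \<Longrightarrow> desc u a (Suc b) = u b * desc u a b"
  by (simp add: desc_def)

lemma desc_Suc_right: "a < b \<Longrightarrow> desc u a b = desc u (Suc a) b * u a"
  by (simp add: desc_def upt_conv_Cons)

lemma desc_split: "a \<le> c \<Longrightarrow> c \<le> b \<Longrightarrow> desc u a b = desc u c b * desc u a c"
  using upt_add_eq_append[of a c "b - c"] by (simp add: desc_def)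

lemma desc_comm:
  assumes "\<And>i. a \<le> i \<Longrightarrow> i < b \<Longrightarrow> u i * y = y * u i"
  shows "desc u a b * y = y * desc u a b"
  using assms
proof (induction b)
  case (Suc b)
  show ?case
  proof (cases "a \<le> b")
    case True
    have "desc u a (Suc b) * y = u b * (desc u a b * y)"
      using True by (simp add: desc_Suc mult.assoc)
    also have "\<dots> = (u b * y) * desc u a b"
      using Suc by (simp add: mult.assoc)
    also have "\<dots> = y * desc u a (Suc b)"
      using Suc.prems[of b] True by (simp add: desc_Suc mult.assoc)
    finally show ?thesis .
  qed simp
qed simp

text \<open>The product contains \<open>u (l + 1) * u l\<close> in the middle. Its upper part
  commutes with \<open>u l\<close> and its lower part with \<open>u (l + 1)\<close>, so a single
  braid move lowers the index of the passing letter.\<close>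

lemma desc_braid:
  fixes u :: "nat \<Rightarrow> 'a::monoid_mult"
  assumes "a \<le> l" "l + 1 < b" and braid: "u (l + 1) * u l * u (l + 1) = u l * u (l + 1) * u l"
    and above: "\<And>i. l + 2 \<le> i \<Longrightarrow> i < b \<Longrightarrow> u i * u l = u l * u i"
    and below: "\<And>i. a \<le> i \<Longrightarrow> i < l \<Longrightarrow> u i * u (l + 1) = u (l + 1) * u i"
  shows "desc u a b * u (l + 1) = u l * desc u a b"
proof -
  have eq: "desc u a b = desc u (l + 2) b * (u (l + 1) * u l * desc u a l)"
    using assms(1,2) desc_split[of a "l + 2" b u] by (simp add: desc_Suc mult.assoc)
  have c1: "desc u (l + 2) b * u l = u l * desc u (l + 2) b"
    using above by (intro desc_comm) auto
  have c2: "desc u a l * u (l + 1) = u (l + 1) * desc u a l"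
    using below by (intro desc_comm) auto
  have "desc u a b * u (l + 1) = desc u (l + 2) b * (u (l + 1) * u l * u (l + 1)) * desc u a l"
    using c2 by (simp add: eq mult.assoc)
  also have "\<dots> = (desc u (l + 2) b * u l) * (u (l + 1) * u l) * desc u a l"
    by (simp only: braid) (simp only: mult.assoc)
  also have "\<dots> = u l * desc u a b"
    by (simp only: c1 eq mult.assoc)
  finally show ?thesis .
qed

text \<open>Here \<open>u j\<close> is the generator \<open>x\<^sub>k\<^sub>-\<^sub>j\<close>, which moves block \<open>j\<close> to \<open>j + 1\<close> and drops the old block
  \<open>j + 1\<close>, and \<open>x\<close> is \<open>x\<^sub>0\<close>, which moves every block down by one and drops block 1.\<close>

locale poi_relations =
  fixes k :: nat and u :: "nat \<Rightarrow> 'a::monoid_mult" and x :: 'a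
  assumes k: "2 \<le> k"
    and u_x: "\<And>j. 2 \<le> j \<Longrightarrow> j < k \<Longrightarrow> u j * x = x * u (j - 1)"
    and u_far: "\<And>i j. 1 \<le> i \<Longrightarrow> i + 2 \<le> j \<Longrightarrow> j < k \<Longrightarrow> u i * u j = u j * u i"
    and xxu: "x * x * u (k - 1) = x * x"
    and uxx: "u 1 * x * x = x * x"
    and u_braid1: "\<And>j. 1 \<le> j \<Longrightarrow> j + 1 < k \<Longrightarrow> u j * u (j + 1) * u j = u j * u (j + 1)"
    and u_braid2: "\<And>j. 1 \<le> j \<Longrightarrow> j + 1 < k \<Longrightarrow> u (j + 1) * u j * u (j + 1) = u j * u (j + 1)"
    and e1_x0: "x * desc u 1 k * x = x"
    and eu0: "\<And>j. 1 \<le> j \<Longrightarrow> j < k \<Longrightarrow> desc u 1 (j + 1) * x * desc u (j + 1) k * u j = u j"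
    and duu0: "\<And>j. 1 \<le> j \<Longrightarrow> j < k \<Longrightarrow> desc u 1 j * x * desc u (j + 1) k * u j * u j = u j * u j"
begin

section \<open>The idempotents \<open>e j\<close> and their commutation rules\<close>

abbreviation D where "D \<equiv> desc u"

text \<open>\<open>e j\<close> is the identity with block \<open>j\<close> removed, and \<open>d j\<close> is the inverse of \<open>u j\<close>.\<close>

definition e :: "nat \<Rightarrow> 'a" where "e j = D 1 j * x * D j k"

definition d :: "nat \<Rightarrow> 'a" where "d j = D 1 j * x * D (j + 1) k"

lemma u_far': "1 \<le> i \<Longrightarrow> 1 \<le> j \<Longrightarrow> i < k \<Longrightarrow> j < k \<Longrightarrow> i + 2 \<le> j \<or> j + 2 \<le> i \<Longrightarrow> u i * u j = u j * u i"
  using u_far[of i j] u_far[of j i] by auto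

lemma e_eq_d_u: "1 \<le> j \<Longrightarrow> j < k \<Longrightarrow> e j = d j * u j"
  by (simp add: e_def d_def desc_Suc_right[of j k] mult.assoc)

lemma e_eq_u_d: "1 \<le> j \<Longrightarrow> e (j + 1) = u j * d j"
  by (simp add: e_def d_def desc_Suc mult.assoc)

lemma e_u_succ: "1 \<le> j \<Longrightarrow> j < k \<Longrightarrow> e (j + 1) * u j = u j"
  using eu0 by (simp add: e_def)

lemma e1_x: "e 1 * x = x"
  using e1_x0 by (simp add: e_def)

lemma u_e: "1 \<le> j \<Longrightarrow> j < k \<Longrightarrow> u j * e j = u j"
  using e_u_succ[of j] e_eq_u_d[of j] e_eq_d_u[of j] by (simp add: mult.assoc)

lemma x_ek: "x * e k = x"
  using e1_x0 by (simp add: e_def mult.assoc)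

lemma desc_x: "1 \<le> a \<Longrightarrow> b < k \<Longrightarrow> D (Suc a) (Suc b) * x = x * D a b"
proof (induction b)
  case (Suc b)
  show ?case
  proof (cases "a \<le> b")
    case True
    have "D (Suc a) (Suc (Suc b)) * x = u (Suc b) * (D (Suc a) (Suc b) * x)"
      using True by (simp add: desc_Suc mult.assoc)
    also have "\<dots> = (u (Suc b) * x) * D a b"
      using Suc by (simp add: mult.assoc)
    also have "\<dots> = x * D a (Suc b)"
      using u_x[of "Suc b"] Suc.prems True by (simp add: desc_Suc mult.assoc)
    finally show ?thesis .
  qed simp
qed simp

text \<open>Moving the first \<open>x\<close> through \<open>D 1 j\<close> exposes
  \<open>x * x\<close>. The two relations for x_0^2 then trade the top letter
  \<open>u (k - 1)\<close> of \<open>D j k\<close> for a letter \<open>u 1\<close> on the left,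
  which is exactly the letter that \<open>D 2 (j + 1)\<close> lacks.\<close>

lemma x_e: assumes "1 \<le> j" "j < k" shows "x * e j = e (j + 1) * x"
proof -
  obtain n where n: "k = Suc n" using k by (cases k) auto
  have "x * e j = (x * D 1 j) * x * D j k"
    by (simp add: e_def mult.assoc)
  also have "x * D 1 j = D 2 (j + 1) * x"
    using desc_x[of 1 j] assms by (simp add: numeral_2_eq_2)
  also have "\<dots> * x * D j k = D 2 (j + 1) * (x * x * D j k)"
    by (simp add: mult.assoc)
  also have "x * x * D j k = (x * x * u (k - 1)) * D j n"
    using assms by (simp add: n desc_Suc mult.assoc)
  also have "\<dots> = (u 1 * x * x) * D j n"
    by (simp only: xxu uxx)
  also have "\<dots> = u 1 * x * (x * D j n)"
    by (simp add: mult.assoc)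
  also have "\<dots> = u 1 * x * (D (j + 1) k * x)"
    using desc_x[of j n] assms n by simp
  also have "D 2 (j + 1) * \<dots> = D 1 (j + 1) * x * D (j + 1) k * x"
  proof -
    have "D 1 (j + 1) = D 2 (j + 1) * u 1"
      using desc_Suc_right[of 1 "j + 1" u] assms by (simp add: numeral_2_eq_2)
    then show ?thesis by (simp only: mult.assoc)
  qed
  finally show ?thesis
    by (simp add: e_def)
qed

lemma desc_comm_u:
  assumes "1 \<le> a" "b \<le> k" "1 \<le> j" "j < k" "b < j \<or> j + 1 < a"
  shows "D a b * u j = u j * D a b"
  using assms by (intro desc_comm u_far') auto

lemma desc_u:
  assumes "1 \<le> a" "a \<le> l" "l + 1 < b" "b \<le> k"
  shows "D a b * u (l + 1) = u l * D a b"
  using assms u_braid1[of l] u_braid2[of l]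
  by (intro desc_braid u_far') (auto simp: mult.assoc)

text \<open>If \<open>i < j\<close>, the letter passes \<open>D i k\<close> with its index lowered
  and \<open>x\<close> with its index raised again. If \<open>j + 1 < i\<close>, it is
  \<open>x\<close> that raises the index first and \<open>D 1 i\<close> that lowers it.\<close>

lemma e_u_far:
  assumes "1 \<le> i" "i \<le> k" "1 \<le> j" "j < k" "i \<noteq> j" "i \<noteq> j + 1"
  shows "e i * u j = u j * e i"
proof (cases "i < j")
  case True
  have 1: "D i k * u j = u (j - 1) * D i k"
    using desc_u[of i "j - 1" k] assms True by simp
  have 2: "x * u (j - 1) = u j * x"
    using u_x[of j] assms True by simp
  have 3: "D 1 i * u j = u j * D 1 i"
    using assms True by (intro desc_comm_u) auto
  have "e i * u j = D 1 i * x * (D i k * u j)" by (simp add: e_def mult.assoc)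
  also have "\<dots> = D 1 i * (x * u (j - 1)) * D i k" by (simp add: 1 mult.assoc)
  also have "\<dots> = (D 1 i * u j) * x * D i k" by (simp only: 2 mult.assoc)
  also have "\<dots> = u j * e i" by (simp only: 3 e_def mult.assoc)
  finally show ?thesis .
next
  case False
  then have "j + 1 < i" using assms by simp
  have 1: "D i k * u j = u j * D i k"
    using assms \<open>j + 1 < i\<close> by (intro desc_comm_u) auto
  have 2: "x * u j = u (j + 1) * x"
    using u_x[of "j + 1"] assms \<open>j + 1 < i\<close> by simp
  have 3: "D 1 i * u (j + 1) = u j * D 1 i"
    using assms \<open>j + 1 < i\<close> by (intro desc_u) auto
  have "e i * u j = D 1 i * x * (D i k * u j)" by (simp add: e_def mult.assoc)
  also have "\<dots> = D 1 i * (x * u j) * D i k" by (simp add: 1 mult.assoc)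
  also have "\<dots> = (D 1 i * u (j + 1)) * x * D i k" by (simp only: 2 mult.assoc)
  also have "\<dots> = u j * e i" by (simp only: 3 e_def mult.assoc)
  finally show ?thesis .
qed

text \<open>The first letter of \<open>D 1 j * x\<close> is \<open>u (j - 1)\<close>, or
  \<open>x\<close> if \<open>j = 1\<close>, and the cyclic relations say that \<open>e j\<close>
  fixes this letter. Idempotency follows since \<open>e j\<close> itself begins with this
  word.\<close>

lemma e_x_absorb: "1 \<le> j \<Longrightarrow> j \<le> k \<Longrightarrow> e j * (D 1 j * x) = D 1 j * x"
proof (cases "j = 1")
  case False
  assume "1 \<le> j" "j \<le> k"
  then obtain i where "j = Suc i" by (cases j) auto
  with False \<open>j \<le> k\<close> have i: "j = i + 1" "1 \<le> i" "i < k" by simp_all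
  have "e j * (D 1 j * x) = (e (i + 1) * u i) * D 1 i * x"
    using i by (simp add: desc_Suc mult.assoc)
  also have "\<dots> = D 1 j * x"
    using i e_u_succ[of i] by (simp add: desc_Suc)
  finally show ?thesis .
qed (use e1_x in simp)

lemma e_idem: "1 \<le> j \<Longrightarrow> j \<le> k \<Longrightarrow> e j * e j = e j"
  using arg_cong[OF e_x_absorb[of j], of "\<lambda>y. y * D j k"] by (simp add: e_def mult.assoc)

text \<open>Rearranged, \<open>d j * d j\<close> ends in \<open>u j * u (j + 1)\<close>, which
  absorbs \<open>u j\<close> by a braid-like relation. For \<open>j = k - 1\<close> there is no
  \<open>u (j + 1)\<close>; then the square ends in \<open>x * x\<close>, which absorbs
  \<open>u (k - 1)\<close>.\<close>

lemma d_d_u: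
  assumes j: "1 \<le> j" "j < k"
  shows "d j * d j * u j = d j * d j"
proof -
  have comm: "D (j + 1) k * D 1 j = D 1 j * D (j + 1) k"
    using j by (intro desc_comm sym[OF desc_comm_u]) auto
  obtain n where n: "k = Suc n" using k by (cases k) auto
  have sh: "D (j + 1) k * x = x * D j n"
    using desc_x[of j n] j n by simp
  have "d j * d j = D 1 j * x * (D (j + 1) k * D 1 j) * x * D (j + 1) k"
    by (simp add: d_def mult.assoc)
  also have "\<dots> = D 1 j * x * D 1 j * (D (j + 1) k * x) * D (j + 1) k"
    by (simp only: comm) (simp only: mult.assoc)
  also have "\<dots> = D 1 j * x * D 1 j * x * (D j n * D (j + 1) k)"
    by (simp only: sh mult.assoc)
  finally have dd: "d j * d j = D 1 j * x * D 1 j * x * (D j n * D (j + 1) k)" .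
  show ?thesis
  proof (cases "j = n")
    case True
    have sh': "x * D 1 j = D 2 (j + 1) * x"
      using desc_x[of 1 j] j by (simp add: numeral_2_eq_2)
    have 1: "D j n = 1" "D (j + 1) k = 1" and jk: "j = k - 1"
      using True n by auto
    have "d j * d j = D 1 j * (x * D 1 j) * x"
      by (simp only: dd 1 mult.assoc mult_1_right)
    also have "\<dots> = D 1 j * D 2 (j + 1) * (x * x)"
      by (simp only: sh' mult.assoc)
    finally have dd': "d j * d j = D 1 j * D 2 (j + 1) * (x * x)" .
    have "x * x * u j = x * x"
      using xxu jk by simp
    then show ?thesis
      unfolding dd' by (simp add: mult.assoc)
  next
    case False
    with j n have jn: "j + 1 < k" by simp
    have c: "D (j + 2) k * u j = u j * D (j + 2) k"
      using j by (intro desc_comm_u) auto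
    have "D j n * D (j + 1) k = D (j + 1) n * (u j * D (j + 2) k) * u (j + 1)"
    proof -
      have "D j n = D (j + 1) n * u j" "D (j + 1) k = D (j + 2) k * u (j + 1)"
        using desc_Suc_right[of j n] desc_Suc_right[of "j + 1" k] jn n by simp_all
      then show ?thesis by (simp only: mult.assoc)
    qed
    also have "\<dots> = D (j + 1) n * D (j + 2) k * (u j * u (j + 1))"
      by (simp only: c[symmetric] mult.assoc)
    finally have eq: "D j n * D (j + 1) k = D (j + 1) n * D (j + 2) k * (u j * u (j + 1))" .
    show ?thesis
      using u_braid1[of j] jn j unfolding dd eq by (simp add: mult.assoc)
  qed
qed

text \<open>All the facts about pairs of neighbouring idempotents rest on this identity: \<open>d j * d j\<close>
  absorbs \<open>u j\<close> on the right and \<open>u j * u j\<close> absorbs \<open>d j\<close> on the left.\<close>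

lemma uu_eq_dd:
  assumes j: "1 \<le> j" "j < k"
  shows "u j * u j = d j * d j"
proof -
  have z: "d j * (u j * u j) = u j * u j"
    using duu0[OF j] by (simp add: d_def mult.assoc)
  have "u j * u j = d j * d j * u j * u j"
    using z by (simp add: mult.assoc)
  then show ?thesis
    using d_d_u[OF j] by simp
qed

text \<open>Being equal to \<open>d j * d j\<close>, the square of \<open>u j\<close> commutes with
  \<open>d j\<close>, so absorption on the left gives absorption on the right.\<close>

lemma uu_absorb:
  assumes j: "1 \<le> j" "j < k"
  shows "d j * (u j * u j) = u j * u j" "u j * u j * d j = u j * u j" "u j * u j * u j = u j * u j"
proof -
  show z: "d j * (u j * u j) = u j * u j"
    using duu0[OF j] by (simp add: d_def mult.assoc)
  then show "u j * u j * d j = u j * u j"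
    using uu_eq_dd[OF j] by (simp add: mult.assoc)
  show "u j * u j * u j = u j * u j"
    using uu_eq_dd[OF j] d_d_u[OF j] by simp
qed

text \<open>Both sides reduce to \<open>u j * u j\<close>.\<close>

lemma e_u_shift:
  assumes j: "1 \<le> j" "j < k"
  shows "u j * e (j + 1) = e j * u j"
  using uu_absorb[OF j] e_eq_d_u[OF j] e_eq_u_d[OF j(1)] by (simp add: mult.assoc)

lemma ee_adj:
  assumes j: "1 \<le> j" "j < k"
  shows "e j * e (j + 1) = u j * u j" "e (j + 1) * e j = u j * u j"
proof -
  show "e j * e (j + 1) = u j * u j"
  proof -
    have "e j * e (j + 1) = d j * (u j * u j) * d j"
      unfolding e_eq_d_u[OF j] e_eq_u_d[OF j(1)] by (simp add: mult.assoc)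
    then show ?thesis
      using uu_absorb[OF j] by simp
  qed
  have "e (j + 1) * e j = u j * (d j * d j) * u j"
    unfolding e_eq_d_u[OF j] e_eq_u_d[OF j(1)] by (simp add: mult.assoc)
  also have "\<dots> = u j * u j * u j * u j"
    by (simp only: uu_eq_dd[OF j, symmetric] mult.assoc)
  finally show "e (j + 1) * e j = u j * u j"
    by (simp only: uu_absorb(3)[OF j])
qed

lemma ee_u: "1 \<le> j \<Longrightarrow> j < k \<Longrightarrow> e j * e (j + 1) * u j = e j * e (j + 1)"
  using ee_adj uu_absorb by simp

text \<open>The relations between the \<open>x\<close>-letters and elements that live in single coordinates, as the
  families \<open>a\<^sub>i\<close>, \<open>b\<^sub>i\<close> and also \<open>e i\<close> do.\<close>

definition coord :: "(nat \<Rightarrow> 'a) \<Rightarrow> bool" where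
  "coord h \<longleftrightarrow> (\<forall>i. 1 \<le> i \<and> i < k \<longrightarrow> x * h i = h (i + 1) * x \<and> u i * h (i + 1) = h i * u i \<and>
     (\<forall>j. 1 \<le> j \<and> j \<le> k \<and> j \<noteq> i \<and> j \<noteq> i + 1 \<longrightarrow> u i * h j = h j * u i))"

lemma coordD:
  assumes "coord h" "1 \<le> i" "i < k"
  shows "x * h i = h (i + 1) * x" "u i * h (i + 1) = h i * u i"
    "1 \<le> j \<Longrightarrow> j \<le> k \<Longrightarrow> j \<noteq> i \<Longrightarrow> j \<noteq> i + 1 \<Longrightarrow> u i * h j = h j * u i"
  using assms unfolding coord_def by auto

lemma coord_e: "coord e"
  using x_e e_u_shift e_u_far unfolding coord_def by auto

lemma desc_coord_far:
  assumes "coord h" "1 \<le> a" "b \<le> k" "1 \<le> j" "j \<le> k" "b < j \<or> j < a"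
  shows "D a b * h j = h j * D a b"
  using assms by (intro desc_comm coordD(3)) auto

lemma desc_coord:
  assumes "coord h" "1 \<le> a" "a \<le> j" "j < b" "b \<le> k"
  shows "D a b * h (j + 1) = h j * D a b"
proof -
  have eq: "D a b = D (j + 1) b * u j * D a j"
    using desc_split[of a "j + 1" b u] desc_Suc[of a j u] assms(3,4) by (simp add: mult.assoc)
  have "D a b * h (j + 1) = D (j + 1) b * u j * (D a j * h (j + 1))"
    by (simp add: eq mult.assoc)
  also have "D a j * h (j + 1) = h (j + 1) * D a j"
    using assms by (intro desc_coord_far) auto
  also have "D (j + 1) b * u j * \<dots> = D (j + 1) b * (u j * h (j + 1)) * D a j"
    by (simp add: mult.assoc)
  also have "u j * h (j + 1) = h j * u j"
    using assms by (intro coordD) auto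
  also have "D (j + 1) b * (h j * u j) * D a j = (D (j + 1) b * h j) * u j * D a j"
    by (simp add: mult.assoc)
  also have "D (j + 1) b * h j = h j * D (j + 1) b"
    using assms by (intro desc_coord_far) auto
  finally show ?thesis
    by (simp add: eq mult.assoc)
qed

text \<open>The word \<open>e l\<close> moves each block other than \<open>l\<close> away and back
  again, and the index of \<open>h\<close> follows this movement. With \<open>h = e\<close> it
  yields the commutation of all idempotents, neighbours included.\<close>

lemma e_coord_comm:
  assumes h: "coord h" and l: "1 \<le> l" "l \<le> k" and j: "1 \<le> j" "j \<le> k" and "j \<noteq> l"
  shows "e l * h j = h j * e l"
proof (cases "j < l")
  case True
  have 1: "D l k * h j = h j * D l k"
    using h l j True by (intro desc_coord_far) auto
  have 2: "x * h j = h (j + 1) * x"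
    using h l j True by (intro coordD) auto
  have 3: "D 1 l * h (j + 1) = h j * D 1 l"
    using h l j True by (intro desc_coord) auto
  have "e l * h j = D 1 l * x * (D l k * h j)" by (simp add: e_def mult.assoc)
  also have "\<dots> = D 1 l * (x * h j) * D l k" by (simp add: 1 mult.assoc)
  also have "\<dots> = (D 1 l * h (j + 1)) * x * D l k" by (simp only: 2 mult.assoc)
  also have "\<dots> = h j * e l" by (simp only: 3 e_def mult.assoc)
  finally show ?thesis .
next
  case False
  with \<open>j \<noteq> l\<close> obtain i where i: "j = i + 1" "l \<le> i"
    using that[of "j - 1"] by auto
  have 1: "D l k * h j = h i * D l k"
    using desc_coord[OF h, of l i k] h l j i by simp
  have 2: "x * h i = h j * x"
    using h l j i coordD(1)[of h i] by auto
  have 3: "D 1 l * h j = h j * D 1 l"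
    using h l j i by (intro desc_coord_far) auto
  have "e l * h j = D 1 l * x * (D l k * h j)" by (simp add: e_def mult.assoc)
  also have "\<dots> = D 1 l * (x * h i) * D l k" by (simp add: 1 mult.assoc)
  also have "\<dots> = (D 1 l * h j) * x * D l k" by (simp only: 2 mult.assoc)
  also have "\<dots> = h j * e l" by (simp only: 3 e_def mult.assoc)
  finally show ?thesis .
qed

lemma e_comm: "1 \<le> i \<Longrightarrow> i \<le> k \<Longrightarrow> 1 \<le> j \<Longrightarrow> j \<le> k \<Longrightarrow> e i * e j = e j * e i"
  using e_coord_comm[OF coord_e] by (cases "i = j") auto

end

section \<open>Normal forms of the words in the x-letters\<close>

lemma sorted_wrt_eq_sorted_list_of_set:
  "sorted_wrt (<) (xs :: nat list) \<Longrightarrow> sorted_list_of_set (set xs) = xs"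
  by (metis sorted_list_of_set.idem_if_sorted_distinct strict_sorted_iff)

lemma mult_eq_assoc: "a * b = c * d \<Longrightarrow> a * (b * y) = c * (d * y)" for a :: "'a::semigroup_mult"
  by (metis mult.assoc)

lemma subset_atLeast2: "A \<subseteq> {1..k} \<Longrightarrow> 1 \<notin> A \<Longrightarrow> A \<subseteq> {2..k::nat}"
proof
  fix y assume "A \<subseteq> {1..k}" "1 \<notin> A" "y \<in> A"
  then have "1 \<le> y" "y \<le> k" "y \<noteq> 1" by auto
  then show "y \<in> {2..k}" by simp
qed

text \<open>Without a gap, membership passes from \<open>i + 1\<close> down to \<open>i\<close>, so
  \<open>B\<close> is everything from 1 to its maximum.\<close>

lemma initial_segment_or_gap:
  assumes "finite B" "0 \<notin> B"
  shows "B = {1..card B} \<or> (\<exists>i\<ge>1. i \<notin> B \<and> i + 1 \<in> B)"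
proof (cases "\<exists>i\<ge>1. i \<notin> B \<and> i + 1 \<in> B")
  case False
  have down: "j \<in> B" if "b \<in> B" "1 \<le> j" "j \<le> b" for b j
    using that(3,1)
  proof (induction rule: inc_induct)
    case (step n)
    then have "1 \<le> n" using that(2) by simp
    with step False show ?case by auto
  qed
  have "B = {1..Max B}" if "B \<noteq> {}"
  proof
    show "B \<subseteq> {1..Max B}"
      using assms by (auto simp: Suc_le_eq) (metis gr0I)
    show "{1..Max B} \<subseteq> B"
      using down Max_in[OF assms(1) that] by auto
  qed
  moreover have "card B = Max B" if "B = {1..Max B}"
    using arg_cong[OF that, of card] by simp
  ultimately show ?thesis
    by (cases "B = {}") auto
qed blast

text \<open>Moving \<open>i + 1\<close> into the gap at \<open>i\<close> keeps the size of the set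
  and lowers the sum of its elements, so repeated moves end in an initial segment.\<close>

lemma gap_induct [consumes 1, case_names initial gap]:
  fixes B :: "nat set"
  assumes "B \<subseteq> {1..k}"
    and "\<And>r. {1..r} \<subseteq> {1..k} \<Longrightarrow> Q {1..r}"
    and "\<And>B i. B \<subseteq> {1..k} \<Longrightarrow> 1 \<le> i \<Longrightarrow> i < k \<Longrightarrow> i \<notin> B \<Longrightarrow> i + 1 \<in> B \<Longrightarrow>
      Q (insert i (B - {i + 1})) \<Longrightarrow> Q B"
  shows "Q B"
  using assms(1)
proof (induction "\<Sum>B" arbitrary: B rule: less_induct)
  case less
  have fin: "finite B" using less.prems finite_subset by blast
  have "0 \<notin> B" using less.prems by auto
  from initial_segment_or_gap[OF fin this] show ?case
  proof
    assume "B = {1..card B}"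
    then show ?thesis using assms(2) less.prems by metis
  next
    assume "\<exists>i\<ge>1. i \<notin> B \<and> i + 1 \<in> B"
    then obtain i where i: "1 \<le> i" "i \<notin> B" "i + 1 \<in> B" by blast
    let ?B = "insert i (B - {i + 1})"
    have ik: "i < k" using i(3) less.prems by auto
    have "\<Sum>B = (i + 1) + \<Sum>(B - {i + 1})"
      using fin i(3) by (simp add: sum.remove)
    moreover have "\<Sum>?B = i + \<Sum>(B - {i + 1})"
      using fin i by simp
    moreover have "?B \<subseteq> {1..k}"
      using less.prems i ik by auto
    ultimately have "Q ?B"
      by (intro less.hyps) auto
    then show ?thesis
      by (rule assms(3)[OF less.prems i(1) ik i(2,3)])
  qed
qed

section \<open>The action of the x-letters on block numbers\<close>

text \<open>For \<open>i > 0\<close> the letter x_i is \<open>u (k - i)\<close>, hence the reversed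
  block numbers.\<close>

definition xstep :: "nat \<Rightarrow> nat \<Rightarrow> nat \<Rightarrow> nat option" where
  "xstep k i p = (if i = 0 then if 2 \<le> p then Some (p - 1) else None
     else if p = k - i then Some (p + 1) else if p = k - i + 1 then None else Some p)"

fun xact :: "nat \<Rightarrow> nat list \<Rightarrow> nat \<Rightarrow> nat option" where
  "xact k [] p = Some p"
| "xact k (i # w) p = Option.bind (xstep k i p) (xact k w)"

definition DOM :: "nat \<Rightarrow> nat list \<Rightarrow> nat set" where
  "DOM k w = {p \<in> {1..k}. xact k w p \<noteq> None}"

definition IMG :: "nat \<Rightarrow> nat list \<Rightarrow> nat set" where
  "IMG k w = (\<lambda>p. the (xact k w p)) ` DOM k w"

section \<open>Restrictions of the identity and how they pass the letters\<close>

context poi_relations begin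

definition es :: "nat list \<Rightarrow> 'a" where "es js = prod_list (map e js)"

lemma es_simps [simp]: "es [] = 1" "es (j # js) = e j * es js"
  by (simp_all add: es_def)

text \<open>\<open>restr A\<close> is the restriction of the identity to the blocks in \<open>A\<close>.\<close>

definition restr :: "nat set \<Rightarrow> 'a" where "restr A = es (sorted_list_of_set ({1..k} - A))"

lemma e_es_comm: "set js \<subseteq> {1..k} \<Longrightarrow> i \<in> {1..k} \<Longrightarrow> e i * es js = es js * e i"
proof (induction js)
  case (Cons j js)
  then have "e i * es (j # js) = e j * (e i * es js)"
    using mult_eq_assoc[OF e_comm[of i j]] by simp
  with Cons show ?case
    by (simp add: mult.assoc)
qed simp

lemma e_es_absorb: "set js \<subseteq> {1..k} \<Longrightarrow> i \<in> set js \<Longrightarrow> e i * es js = es js"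
proof (induction js)
  case (Cons j js)
  show ?case
  proof (cases "i = j")
    case True
    then show ?thesis
      using e_idem[of j] Cons.prems by (simp add: es_def flip: mult.assoc)
  next
    case False
    then have "e i * es (j # js) = e j * (e i * es js)"
      using mult_eq_assoc[OF e_comm[of i j]] Cons.prems by auto
    then show ?thesis
      using Cons False by (simp add: es_def)
  qed
qed simp

lemma es_absorb: "set js' \<subseteq> {1..k} \<Longrightarrow> set js \<subseteq> set js' \<Longrightarrow> es js * es js' = es js'"
proof (induction js)
  case (Cons j js)
  then show ?case
    using e_es_absorb[of js' j] by (simp add: es_def mult.assoc)
qed (simp add: es_def)

lemma es_comm: "set js \<subseteq> {1..k} \<Longrightarrow> set js' \<subseteq> {1..k} \<Longrightarrow> es js * es js' = es js' * es js"
proof (induction js)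
  case (Cons j js)
  have "es (j # js) * es js' = (e j * es js') * es js"
    using Cons by (simp add: es_def mult.assoc)
  also have "\<dots> = es js' * es (j # js)"
    using Cons e_es_comm[of js' j] by (simp add: es_def mult.assoc)
  finally show ?case .
qed (simp add: es_def)

text \<open>Each of the two products absorbs the other from the left, and they commute.\<close>

lemma es_cong: "set js = set js' \<Longrightarrow> set js \<subseteq> {1..k} \<Longrightarrow> es js = es js'"
  by (metis es_absorb es_comm order_refl)

lemma restr_eq_es: "set js = {1..k} - A \<Longrightarrow> restr A = es js"
  unfolding restr_def by (rule es_cong) auto

lemma restr_full: "restr {1..k} = 1"
  by (simp add: restr_def es_def)

lemma e_restr: "j \<in> {1..k} \<Longrightarrow> e j * restr A = restr (A - {j})"
proof -
  assume "j \<in> {1..k}"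
  then have "restr (A - {j}) = es (j # sorted_list_of_set ({1..k} - A))"
    by (intro restr_eq_es) auto
  then show ?thesis
    by (simp add: restr_def es_def)
qed

lemma restr_e: "j \<in> {1..k} \<Longrightarrow> restr A * e j = restr (A - {j})"
  using e_restr[of j A] e_es_comm[of "sorted_list_of_set ({1..k} - A)" j] by (simp add: restr_def)

lemma restr_Int: "restr (A \<inter> {1..k}) = restr A"
  unfolding restr_def by (rule arg_cong[of _ _ "\<lambda>S. es (sorted_list_of_set S)"]) auto

lemma restr_restr: "restr A * restr A = restr A"
  unfolding restr_def by (rule es_absorb) auto

lemma es_far_u:
  "1 \<le> i \<Longrightarrow> i < k \<Longrightarrow> set js \<subseteq> {1..k} - {i, i + 1} \<Longrightarrow> es js * u i = u i * es js"
proof (induction js)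
  case (Cons j js)
  have "es (j # js) * u i = e j * u i * es js"
    using Cons by (simp add: mult.assoc)
  also have "e j * u i = u i * e j"
    using Cons.prems by (intro e_u_far) auto
  finally show ?case
    by (simp add: mult.assoc)
qed simp

text \<open>The letter \<open>u i\<close> swallows \<open>e (i + 1)\<close> on its left and produces
  \<open>e i\<close> on its right. If block \<open>i\<close> is missing as well, \<open>e i\<close>
  becomes \<open>e (i + 1)\<close> while passing.\<close>

lemma restr_u:
  assumes i: "1 \<le> i" "i < k" and A: "i + 1 \<notin> A"
  shows "restr A * u i = u i * restr (if i \<in> A then insert (i + 1) (A - {i}) else A)"
proof -
  define js where "js = sorted_list_of_set ({1..k} - A - {i, i + 1})"
  have js: "set js = {1..k} - A - {i, i + 1}" by (simp add: js_def)
  have far: "es js * u i = u i * es js"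
    using i js by (intro es_far_u) auto
  have c: "e i * es js = es js * e i" "e (i + 1) * es js = es js * e (i + 1)"
    using i js by (intro e_es_comm; auto)+
  show ?thesis
  proof (cases "i \<in> A")
    case True
    have "restr A = es ((i + 1) # js)"
      using True A i by (intro restr_eq_es) (auto simp: js)
    then have "restr A * u i = es js * (e (i + 1) * u i)"
      using c(2) by (simp add: mult.assoc)
    also have "\<dots> = u i * es js"
      using e_u_succ[OF i] far by simp
    also have "\<dots> = (u i * e i) * es js"
      using u_e[OF i] by simp
    also have "\<dots> = u i * es (i # js)"
      by (simp add: es_def mult.assoc)
    also have "es (i # js) = restr (insert (i + 1) (A - {i}))"
      using True A i by (intro restr_eq_es[symmetric]) (auto simp: js)
    finally show ?thesis
      using True by simp
  next
    case False
    have NA: "restr A = es (i # (i + 1) # js)"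
      using False A i by (intro restr_eq_es) (auto simp: js)
    then have "restr A * u i = e i * (e (i + 1) * es js) * u i"
      by (simp add: mult.assoc)
    also have "\<dots> = (e i * es js) * (e (i + 1) * u i)"
      by (simp only: c(2)) (simp only: mult.assoc)
    also have "\<dots> = es js * (e i * u i)"
      by (simp only: e_u_succ[OF i] c(1)) (simp only: mult.assoc)
    also have "\<dots> = (es js * u i) * e (i + 1)"
      by (simp only: e_u_shift[OF i, symmetric] mult.assoc)
    also have "\<dots> = u i * (es js * e (i + 1))"
      by (simp only: far) (simp only: mult.assoc)
    also have "\<dots> = (u i * e i) * (e (i + 1) * es js)"
      by (simp only: c u_e[OF i])
    also have "\<dots> = u i * restr A"
      by (simp add: NA mult.assoc)
    finally show ?thesis
      using False by simp
  qed
qed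

text \<open>The block that \<open>u i\<close> moves and the block that it drops are both already
  missing, and \<open>e i * e (i + 1)\<close> absorbs \<open>u i\<close>.\<close>

lemma restr_u_absorb:
  assumes i: "1 \<le> i" "i < k" and A: "i \<notin> A" "i + 1 \<notin> A"
  shows "restr A * u i = restr A"
proof -
  have "restr A * u i = restr A * (e i * e (i + 1) * u i)"
    using restr_e[of i A] restr_e[of "i + 1" A] A i by (simp flip: mult.assoc)
  also have "\<dots> = restr A"
    using restr_e[of i A] restr_e[of "i + 1" A] A i unfolding ee_u[OF i] by (simp flip: mult.assoc)
  finally show ?thesis .
qed

lemma es_x: "set js \<subseteq> {2..k} \<Longrightarrow> es js * x = x * es (map (\<lambda>j. j - 1) js)"
proof (induction js)
  case (Cons j js)
  have "es (j # js) * x = e j * x * es (map (\<lambda>j. j - 1) js)"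
    using Cons by (simp add: mult.assoc)
  also have "e j * x = x * e (j - 1)"
  proof -
    have "1 \<le> j - 1" "j - 1 < k" using Cons.prems by auto
    then show ?thesis using x_e[of "j - 1"] by simp
  qed
  finally show ?case
    by (simp add: mult.assoc)
qed simp

text \<open>The factor \<open>e 1\<close> disappears into \<open>x\<close>, the other indices go
  down by one, and a factor \<open>e k\<close> appears because block \<open>k\<close> is not in the
  image of \<open>x\<close>.\<close>

lemma restr_x:
  assumes A: "1 \<notin> A" "A \<subseteq> {1..k}"
  shows "restr A * x = x * restr ((\<lambda>j. j - 1) ` A)"
proof -
  define js where "js = sorted_list_of_set ({2..k} - A)"
  have js: "set js = {2..k} - A" by (simp add: js_def)
  have js': "set js \<subseteq> {1..k}" using js by auto
  have m: "set (k # map (\<lambda>j. j - 1) js) = {1..k} - (\<lambda>j. j - 1) ` A"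
  proof -
    have "(\<lambda>j. j - 1) ` ({2..k} - A) = (\<lambda>j. j - 1) ` {2..k} - (\<lambda>j. j - 1) ` A"
    proof (rule inj_on_image_set_diff[of _ "{2..k}"])
      show "inj_on (\<lambda>j. j - 1) {2..k}" by (auto simp: inj_on_def)
      show "A \<subseteq> {2..k}" using A subset_atLeast2 by blast
    qed auto
    moreover have "(\<lambda>j. j - 1) ` {2..k} = {1..<k}"
    proof -
      have "j \<in> (\<lambda>j. j - 1) ` {2..k}" if "j \<in> {1..<k}" for j
        using that by (intro image_eqI[of _ _ "j + 1"]) auto
      then show ?thesis by auto
    qed
    moreover have "k \<notin> (\<lambda>j. j - 1) ` A"
    proof
      assume "k \<in> (\<lambda>j. j - 1) ` A"
      then obtain j where "j \<in> A" "k = j - 1" by blast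
      moreover from this have "j \<le> k" using A by auto
      ultimately show False using k by simp
    qed
    ultimately show ?thesis using k js by auto
  qed
  have "{1..k} = insert 1 {2..k}" using k by auto
  then have "set (1 # js) = {1..k} - A"
    using A(1) by (simp add: js insert_Diff_if)
  then have "restr A = es (1 # js)"
    by (rule restr_eq_es)
  then have "restr A * x = (es js * e 1) * x"
    using e_es_comm[of js 1] js' k by (simp add: es_def)
  also have "\<dots> = x * es (map (\<lambda>j. j - 1) js)"
    using e1_x es_x[of js] js by (simp add: mult.assoc)
  also have "\<dots> = (x * e k) * es (map (\<lambda>j. j - 1) js)"
    by (simp add: x_ek)
  also have "\<dots> = x * es (k # map (\<lambda>j. j - 1) js)"
    by (simp add: es_def mult.assoc)
  also have "es (k # map (\<lambda>j. j - 1) js) = restr ((\<lambda>j. j - 1) ` A)"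
    using m by (rule restr_eq_es[symmetric])
  finally show ?thesis .
qed

text \<open>The gap at \<open>j + 1\<close> is the block that the first letter \<open>u j\<close>
  drops. Passing this letter moves the gap to \<open>j\<close>, and so on until it arrives at
  1.\<close>

lemma restr_desc:
  assumes "j \<le> r" "r < k"
  shows "restr ({1..j} \<union> {j+2..r+1}) * D 1 (j + 1) = D 1 (j + 1) * restr {2..r+1}"
  using assms(1)
proof (induction j)
  case 0
  then show ?case by (simp add: numeral_2_eq_2)
next
  case (Suc j)
  let ?A = "{1..Suc j} \<union> {Suc j+2..r+1}"
  have "insert (Suc j + 1) (?A - {Suc j}) = {1..j} \<union> {j+2..r+1}"
    using Suc.prems by auto
  then have 1: "restr ?A * u (Suc j) = u (Suc j) * restr ({1..j} \<union> {j+2..r+1})"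
    using restr_u[of "Suc j" ?A] Suc.prems assms(2) by simp
  have "restr ?A * D 1 (Suc j + 1) = (restr ?A * u (Suc j)) * D 1 (j + 1)"
    by (simp add: desc_Suc mult.assoc)
  also have "\<dots> = u (Suc j) * (restr ({1..j} \<union> {j+2..r+1}) * D 1 (j + 1))"
    by (simp only: 1 mult.assoc)
  also have "\<dots> = D 1 (Suc j + 1) * restr {2..r+1}"
    using Suc by (simp add: desc_Suc mult.assoc)
  finally show ?case .
qed

lemma restr_desc_absorb:
  assumes "r < a" "b \<le> k" "1 \<le> a"
  shows "restr {1..r} * D a b = restr {1..r}"
  using assms(2)
proof (induction b)
  case (Suc b)
  show ?case
  proof (cases "a \<le> b")
    case True
    then have "restr {1..r} * D a (Suc b) = (restr {1..r} * u b) * D a b"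
      by (simp add: desc_Suc mult.assoc)
    also have "restr {1..r} * u b = restr {1..r}"
      using True assms Suc.prems by (intro restr_u_absorb) auto
    finally show ?thesis using Suc by simp
  qed simp
qed simp

text \<open>The word moves the blocks \<open>1..r\<close> up and down again, but it is only the
  initial part of \<open>e (r + 1)\<close>. The missing factor \<open>D (r + 1) k\<close> touches
  only blocks above \<open>r\<close>, so it can be inserted next to \<open>restr {1..r}\<close> once
  this has been carried to the right of the word; then \<open>e (r + 1)\<close> is absorbed.\<close>

lemma restr_cycle_absorb:
  assumes r: "r < k"
  shows "restr {1..r} * (D 1 (r + 1) * x) = restr {1..r}"
proof -
  define C where "C = D 1 (r + 1) * x"
  have "(\<lambda>j. j - 1) ` {2..r+1} = {1..r}"
  proof -
    have "j \<in> (\<lambda>j. j - 1) ` {2..r+1}" if "j \<in> {1..r}" for j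
      using that by (intro image_eqI[of _ _ "j + 1"]) auto
    then show ?thesis by auto
  qed
  then have sh: "restr {2..r+1} * x = x * restr {1..r}"
    using restr_x[of "{2..r+1}"] r by auto
  have "restr {1..r} * C = restr ({1..r} \<union> {r+2..r+1}) * D 1 (r + 1) * x"
    by (simp add: C_def mult.assoc)
  also have "\<dots> = D 1 (r + 1) * restr {2..r+1} * x"
    by (simp only: restr_desc[OF order_refl r])
  also have "\<dots> = D 1 (r + 1) * (x * restr {1..r})"
    by (simp only: sh mult.assoc)
  finally have comm: "restr {1..r} * C = C * restr {1..r}"
    by (simp only: C_def mult.assoc)
  also have "\<dots> = C * (restr {1..r} * D (r + 1) k)"
    using restr_desc_absorb[of r "r + 1" k] by simp
  also have "\<dots> = (restr {1..r} * C) * D (r + 1) k"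
    by (simp only: comm) (simp only: mult.assoc)
  also have "\<dots> = restr {1..r} * e (r + 1)"
    by (simp add: C_def e_def mult.assoc)
  also have "\<dots> = restr {1..r}"
    using r restr_e[of "r + 1" "{1..r}"] by simp
  finally show ?thesis by (simp add: C_def)
qed

section \<open>Spreading an initial segment over a set of blocks\<close>

text \<open>Moves the single block \<open>a\<close> to \<open>b\<close> and drops
  \<open>a + 1..b\<close>, whereas \<open>desc\<close> moves each of the blocks \<open>a..<b\<close>
  by one.\<close>

definition asc :: "nat \<Rightarrow> nat \<Rightarrow> 'a" where "asc a b = prod_list (map u [a..<b])"

lemma asc_Suc: "a \<le> b \<Longrightarrow> asc a (Suc b) = asc a b * u b"
  by (simp add: asc_def)

lemma asc_empty [simp]: "b \<le> a \<Longrightarrow> asc a b = 1"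
  by (simp add: asc_def)

lemma asc_Suc_left: "a < b \<Longrightarrow> asc a b = u a * asc (Suc a) b"
  by (simp add: asc_def upt_conv_Cons)

lemma asc_comm:
  assumes "\<And>i. a \<le> i \<Longrightarrow> i < b \<Longrightarrow> u i * y = y * u i"
  shows "asc a b * y = y * asc a b"
  using assms
proof (induction b)
  case (Suc b)
  show ?case
  proof (cases "a \<le> b")
    case True
    have "asc a (Suc b) * y = asc a b * (u b * y)"
      using True by (simp add: asc_Suc mult.assoc)
    also have "\<dots> = (asc a b * y) * u b"
      using Suc.prems[of b] True by (simp add: mult.assoc)
    also have "\<dots> = y * asc a (Suc b)"
      using Suc True by (simp add: asc_Suc mult.assoc)
    finally show ?thesis .
  qed simp
qed simp

lemma asc_x: "1 \<le> a \<Longrightarrow> b \<le> k \<Longrightarrow> asc (Suc a) b * x = x * asc a (b - 1)"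
proof (induction b)
  case (Suc b)
  show ?case
  proof (cases "Suc a \<le> b")
    case True
    have "asc (Suc a) (Suc b) * x = asc (Suc a) b * (u b * x)"
      using True by (simp add: asc_Suc mult.assoc)
    also have "\<dots> = (asc (Suc a) b * x) * u (b - 1)"
      using u_x[of b] True Suc.prems by (simp add: mult.assoc)
    also have "\<dots> = x * (asc a (b - 1) * u (b - 1))"
      using Suc by (simp add: mult.assoc)
    also have "\<dots> = x * asc a b"
      using asc_Suc[of a "b - 1"] True by simp
    finally show ?thesis by simp
  qed simp
qed simp

text \<open>The first letter \<open>u t\<close> of \<open>asc t b\<close> commutes into place and
  lengthens \<open>D 1 t\<close>; the other letters pass \<open>x\<close> with their indices
  lowered.\<close>

lemma asc_cycle:
  assumes "1 \<le> t" "t < b" "b \<le> k"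
  shows "asc t b * (D 1 t * x) = D 1 (t + 1) * x * asc t (b - 1)"
proof -
  have c: "asc (Suc t) b * D 1 t = D 1 t * asc (Suc t) b"
    using assms by (intro asc_comm sym[OF desc_comm_u]) auto
  have "asc t b * (D 1 t * x) = u t * (asc (Suc t) b * D 1 t) * x"
    using assms by (simp add: asc_Suc_left mult.assoc)
  also have "\<dots> = u t * D 1 t * (asc (Suc t) b * x)"
    by (simp only: c mult.assoc)
  also have "asc (Suc t) b * x = x * asc t (b - 1)"
    using assms by (intro asc_x) auto
  also have "u t * D 1 t * (x * asc t (b - 1)) = D 1 (t + 1) * x * asc t (b - 1)"
    using assms by (simp add: desc_Suc mult.assoc)
  finally show ?thesis .
qed

text \<open>The list entries are the targets of the blocks \<open>t, t + 1, ...\<close>. Later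
  entries give factors further to the left, so the highest block moves first.\<close>

fun climb :: "nat \<Rightarrow> nat list \<Rightarrow> 'a" where
  "climb t [] = 1"
| "climb t (b # bs) = climb (Suc t) bs * asc t b"

text \<open>Coming from the right, \<open>u i\<close> passes the factors with targets below
  \<open>i\<close> and prolongs the factor with target \<open>i\<close>.\<close>

lemma climb_u:
  assumes "sorted_wrt (<) bs" "set bs \<subseteq> {t..k}" "1 \<le> t" "i \<in> set bs" "i < k"
  shows "climb t (map (\<lambda>b. if b = i then Suc i else b) bs) = climb t bs * u i"
  using assms
proof (induction bs arbitrary: t)
  case (Cons b bs)
  show ?case
  proof (cases "b = i")
    case True
    then have "map (\<lambda>b. if b = i then Suc i else b) bs = bs"
      using Cons.prems by (intro map_idI) auto
    then show ?thesis
      using True Cons.prems by (simp add: asc_Suc mult.assoc)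
  next
    case False
    then have "b < i" "i \<in> set bs" using Cons.prems by auto
    moreover have "set bs \<subseteq> {Suc t..k}"
    proof
      fix y assume "y \<in> set bs"
      then have "b < y" "y \<le> k" using Cons.prems by auto
      then show "y \<in> {Suc t..k}" using Cons.prems by auto
    qed
    ultimately have IH: "climb (Suc t) (map (\<lambda>b. if b = i then Suc i else b) bs) = climb (Suc t) bs * u i"
      using Cons by auto
    have "asc t b * u i = u i * asc t b"
      using \<open>b < i\<close> Cons.prems by (intro asc_comm u_far') auto
    then show ?thesis
      using False by (simp add: IH mult.assoc)
  qed
qed simp

text \<open>The factor \<open>D 1 t\<close> carries the induction: every \<open>asc\<close> that is
  passed lengthens it by one letter. In the application \<open>t = 1\<close> and this factor is
  empty.\<close>

lemma climb_x:
  assumes "sorted_wrt (<) bs" "set bs \<subseteq> {t+1..k}" "1 \<le> t"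
  shows "climb t bs * (D 1 t * x) = D 1 (t + length bs) * x * climb t (map (\<lambda>b. b - 1) bs)"
  using assms
proof (induction bs arbitrary: t)
  case (Cons b bs)
  have "set bs \<subseteq> {Suc t + 1..k}"
  proof
    fix y assume "y \<in> set bs"
    then have "b < y" "y \<le> k" using Cons.prems by auto
    then show "y \<in> {Suc t + 1..k}" using Cons.prems by auto
  qed
  then have IH: "climb (Suc t) bs * (D 1 (Suc t) * x)
      = D 1 (Suc t + length bs) * x * climb (Suc t) (map (\<lambda>b. b - 1) bs)"
    using Cons by auto
  have "climb t (b # bs) * (D 1 t * x) = climb (Suc t) bs * (asc t b * (D 1 t * x))"
    by (simp add: mult.assoc)
  also have "\<dots> = (climb (Suc t) bs * (D 1 (Suc t) * x)) * asc t (b - 1)"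
    using asc_cycle[of t b] Cons.prems by (simp add: mult.assoc)
  also have "\<dots> = D 1 (Suc t + length bs) * x * climb (Suc t) (map (\<lambda>b. b - 1) bs) * asc t (b - 1)"
    by (simp only: IH)
  finally show ?case
    by (simp add: mult.assoc)
qed simp

text \<open>\<open>spread B\<close> maps \<open>{1..card B}\<close> onto \<open>B\<close>, moving the largest element first so that no block is hit.\<close>

definition spread :: "nat set \<Rightarrow> 'a" where
  "spread B = restr {1..card B} * climb 1 (sorted_list_of_set B)"

lemma spread_u:
  assumes B: "B \<subseteq> {1..k}" and i: "i \<in> B" "i + 1 \<notin> B" "i < k"
  shows "spread B * u i = spread (insert (i + 1) (B - {i}))"
proof -
  let ?bs = "sorted_list_of_set B" and ?f = "\<lambda>b. if b = i then Suc i else b"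
  have fin: "finite B" using B finite_subset by blast
  have "sorted_wrt (<) (map ?f ?bs)"
    unfolding sorted_wrt_map
  proof (rule sorted_wrt_mono_rel[of ?bs "(<)"])
    fix a b assume "a \<in> set ?bs" "b \<in> set ?bs" "a < b"
    \<comment> \<open>Since \<open>i + 1\<close> is not in \<open>B\<close>, replacing
      \<open>i\<close> by \<open>i + 1\<close> keeps the list strictly increasing.\<close>
    then have "b \<noteq> Suc i" "a < b" using i fin by auto
    then show "?f a < ?f b" by simp
  qed (rule strict_sorted_list_of_set)
  moreover have "set (map ?f ?bs) = insert (i + 1) (B - {i})"
    using i fin by auto
  ultimately have "sorted_list_of_set (insert (i + 1) (B - {i})) = map ?f ?bs"
    using sorted_wrt_eq_sorted_list_of_set by metis
  moreover have "card (insert (i + 1) (B - {i})) = card B"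
    using i fin card_Suc_Diff1[of B i] by simp
  moreover have "climb 1 (map ?f ?bs) = climb 1 ?bs * u i"
    using B fin i by (intro climb_u strict_sorted_list_of_set) auto
  ultimately show ?thesis
    by (simp add: spread_def mult.assoc)
qed

lemma spread_x:
  assumes B: "B \<subseteq> {1..k}" and i: "1 \<notin> B"
  shows "spread B * x = spread ((\<lambda>b. b - 1) ` B)"
proof -
  let ?bs = "sorted_list_of_set B" and ?f = "\<lambda>b. b - (1::nat)"
  have fin: "finite B" using B finite_subset by blast
  have B2: "B \<subseteq> {2..k}"
    using B i by (rule subset_atLeast2)
  have "sorted_wrt (<) (map ?f ?bs)"
    unfolding sorted_wrt_map
  proof (rule sorted_wrt_mono_rel[of ?bs "(<)"])
    fix a b assume "a \<in> set ?bs" "b \<in> set ?bs" "a < b"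
    then have "2 \<le> a" "a < b" using B2 fin by auto
    then show "?f a < ?f b" by simp
  qed (rule strict_sorted_list_of_set)
  moreover have "set (map ?f ?bs) = ?f ` B"
    using fin by auto
  ultimately have "sorted_list_of_set (?f ` B) = map ?f ?bs"
    using sorted_wrt_eq_sorted_list_of_set by metis
  moreover have "card (?f ` B) = card B"
    using B2 by (intro card_image) (auto simp: inj_on_def dest!: subsetD)
  ultimately have PB': "spread (?f ` B) = restr {1..card B} * climb 1 (map ?f ?bs)"
    by (simp only: spread_def)
  have climb: "climb 1 ?bs * (D 1 1 * x) = D 1 (1 + length ?bs) * x * climb 1 (map ?f ?bs)"
    using B2 fin by (intro climb_x strict_sorted_list_of_set) auto
  \<comment> \<open>Block 1 is missing from \<open>B\<close>, so the cycle produced by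
    \<open>climb_x\<close> is short enough for \<open>restr_cycle_absorb\<close>.\<close>
  have "card B < k"
    using card_mono[OF _ B2] k by simp
  then have restr: "restr {1..card B} * (D 1 (card B + 1) * x) = restr {1..card B}"
    by (rule restr_cycle_absorb)
  have "spread B * x = restr {1..card B} * (climb 1 ?bs * (D 1 1 * x))"
    by (simp add: spread_def mult.assoc)
  also have "\<dots> = restr {1..card B} * (D 1 (card B + 1) * x) * climb 1 (map ?f ?bs)"
    unfolding climb by (simp add: mult.assoc)
  finally show ?thesis
    by (simp only: restr PB')
qed

lemma climb_upt: "climb t [t..<n] = 1"
proof (induction "n - t" arbitrary: t)
  case (Suc d)
  then show ?case by (simp add: upt_conv_Cons)
qed simp

lemma spread_init: "spread {1..r} = restr {1..r}"
proof -
  have "sorted_list_of_set {1..r} = [1..<Suc r]"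
    using sorted_list_of_set_range[of 1 "Suc r"] by (simp add: atLeastLessThanSuc_atLeastAtMost)
  then show ?thesis
    by (simp only: spread_def climb_upt card_atLeastAtMost) simp
qed

text \<open>For initial segments both claims are the idempotency of \<open>restr\<close>. If
  \<open>B\<close> arises from \<open>B0\<close> by the move \<open>u i\<close>, then
  \<open>d i\<close> undoes this move, and \<open>d i * Q\<close> is a left inverse for
  \<open>B\<close>.\<close>

lemma spread_retract:
  assumes "B \<subseteq> {1..k}"
  shows "\<exists>Q. Q * spread B = restr B" and "spread B * restr B = spread B"
proof -
  have "(\<exists>Q. Q * spread B = restr B) \<and> spread B * restr B = spread B"
    using assms
  proof (induction rule: gap_induct)
    case (initial r)
    show ?case unfolding spread_init by (metis restr_restr mult_1_left)
  next
    case (gap B i)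
    note i = gap(2,4,5) and ik = gap(3)
    define B0 where "B0 = insert i (B - {i + 1})"
    have B: "B = insert (i + 1) (B0 - {i})" using i by (auto simp: B0_def)
    have B0k: "B0 \<subseteq> {1..k}" using gap(1) i ik by (auto simp: B0_def)
    obtain Q where Q: "Q * spread B0 = restr B0" and PN: "spread B0 * restr B0 = spread B0"
      using gap(6) unfolding B0_def by blast
    have iB0: "i \<in> B0" "i + 1 \<notin> B0" by (auto simp: B0_def)
    have PB: "spread B = spread B0 * u i"
      using spread_u[OF B0k iB0 ik] B by simp
    have NB: "restr B0 * u i = u i * restr B"
      using restr_u[OF i(1) ik iB0(2)] iB0(1) B by simp
    have "d i * Q * spread B = d i * (Q * spread B0) * u i"
      by (simp add: PB mult.assoc)
    also have "\<dots> = d i * (restr B0 * u i)"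
      by (simp add: Q mult.assoc)
    also have "\<dots> = e i * restr B"
      using e_eq_d_u[OF i(1) ik] by (simp add: NB mult.assoc)
    also have "\<dots> = restr B"
      using e_restr[of i B] i ik by simp
    finally have "\<exists>Q. Q * spread B = restr B" ..
    moreover have "spread B * restr B = spread B0 * (u i * restr B)"
      by (simp add: PB mult.assoc)
    then have "spread B * restr B = (spread B0 * restr B0) * u i"
      by (simp only: NB mult.assoc)
    then have "spread B * restr B = spread B"
      by (simp add: PN PB)
    ultimately show ?case by blast
  qed
  then show "\<exists>Q. Q * spread B = restr B" and "spread B * restr B = spread B" by blast+
qed

lemma spread_u_absorb:
  assumes "B \<subseteq> {1..k}" "1 \<le> i" "i < k" "i \<notin> B" "i + 1 \<notin> B"
  shows "spread B * u i = spread B"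
proof -
  have "spread B * u i = spread B * (restr B * u i)"
    by (simp add: spread_retract(2)[OF assms(1)] flip: mult.assoc)
  then show ?thesis
    by (simp only: restr_u_absorb[OF assms(2-5)] spread_retract(2)[OF assms(1)])
qed

section \<open>Words in the x-letters are determined by domain and image\<close>

definition xgen :: "nat \<Rightarrow> 'a" where "xgen i = (if i = 0 then x else u (k - i))"

definition xeval :: "nat list \<Rightarrow> 'a" where "xeval w = prod_list (map xgen w)"

lemma img_u:
  "0 < i \<Longrightarrow> k - i + 1 \<notin> A \<Longrightarrow> (\<lambda>p. the (xstep k i p)) ` A =
     (if k - i \<in> A then insert (k - i + 1) (A - {k - i}) else A)"
  by (cases "k - i \<in> A")
    (auto simp: xstep_def image_iff split: if_splits intro!: image_cong[of A A _ id, simplified])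

lemma img_x: "A \<subseteq> {1..k} \<Longrightarrow> 1 \<notin> A \<Longrightarrow> (\<lambda>p. the (xstep k 0 p)) ` A = (\<lambda>p. p - 1) ` A"
  using subset_atLeast2[of A k] by (intro image_cong) (auto simp: xstep_def)

lemma restr_xgen:
  assumes A: "A \<subseteq> {1..k}" "\<forall>p\<in>A. xstep k i p \<noteq> None" and i: "i < k"
  shows "restr A * xgen i = xgen i * restr ((\<lambda>p. the (xstep k i p)) ` A)"
proof (cases "i = 0")
  case True
  then have "1 \<notin> A" using A by (auto simp: xstep_def)
  then show ?thesis using True restr_x[of A] A img_x by (simp add: xgen_def)
next
  case False
  then have "k - i + 1 \<notin> A" using A(2) by (auto simp: xstep_def)
  then show ?thesis using False restr_u[of "k - i" A] A img_u i by (simp add: xgen_def)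
qed

lemma spread_xgen:
  assumes A: "A \<subseteq> {1..k}" "\<forall>p\<in>A. xstep k i p \<noteq> None" and i: "i < k"
  shows "spread A * xgen i = spread ((\<lambda>p. the (xstep k i p)) ` A)"
proof (cases "i = 0")
  case True
  then have "1 \<notin> A" using A by (auto simp: xstep_def)
  then show ?thesis using True spread_x[of A] A img_x by (simp add: xgen_def)
next
  case False
  then have "k - i + 1 \<notin> A" using A(2) by (auto simp: xstep_def)
  then show ?thesis
    using False spread_u[of A "k - i"] spread_u_absorb[of A "k - i"] A img_u i by (simp add: xgen_def)
qed

lemma xstep_range: "i < k \<Longrightarrow> p \<in> {1..k} \<Longrightarrow> xstep k i p = Some q \<Longrightarrow> q \<in> {1..k}"
  by (auto simp: xstep_def split: if_splits)

lemma DOM_Cons: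
  "i < k \<Longrightarrow> p \<in> DOM k (i # w) \<longleftrightarrow> p \<in> {1..k} \<and> xstep k i p \<noteq> None \<and> the (xstep k i p) \<in> DOM k w"
proof (cases "xstep k i p")
  case (Some q)
  assume "i < k"
  then have "p \<in> {1..k} \<Longrightarrow> q \<in> {1..k}"
    using xstep_range[OF _ _ Some] by blast
  then show ?thesis
    using Some by (auto simp: DOM_def)
qed (simp add: DOM_def)

lemma restr_xgen_restrict:
  assumes i: "i < k"
  shows "restr A * xgen i = restr {p \<in> A. xstep k i p \<noteq> None} * xgen i"
proof (cases "i = 0")
  case True
  \<comment> \<open>The set \<open>A\<close> is arbitrary and may contain 0, which
    \<open>xstep\<close> rejects together with 1; hence the comparison inside
    \<open>{1..k}\<close>.\<close>
  then have "restr {p \<in> A. xstep k i p \<noteq> None} = restr (A - {1})"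
    by (subst (1 2) restr_Int[symmetric]) (auto simp: xstep_def intro!: arg_cong[of _ _ restr])
  also have "\<dots> = restr A * e 1"
    using restr_e[of 1 A] k by simp
  finally show ?thesis
    using e1_x True by (simp add: xgen_def mult.assoc)
next
  case False
  then have "{p \<in> A. xstep k i p \<noteq> None} = A - {k - i + 1}"
    by (auto simp: xstep_def)
  then have "restr {p \<in> A. xstep k i p \<noteq> None} = restr A * e (k - i + 1)"
    using restr_e[of "k - i + 1" A] i False by simp
  then show ?thesis
    using e_u_succ[of "k - i"] i False by (simp add: xgen_def mult.assoc)
qed

text \<open>The blocks lost at the first letter are removed, the others are carried across it,
  restricted there by induction, and carried back.\<close>

lemma restr_xeval_restrict:
  assumes "set w \<subseteq> {..<k}" "A \<subseteq> {1..k}"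
  shows "restr A * xeval w = restr (A \<inter> DOM k w) * xeval w"
  using assms
proof (induction w arbitrary: A)
  case Nil
  then have "A \<inter> DOM k [] = A" by (auto simp: DOM_def)
  then show ?case by simp
next
  case (Cons i w)
  let ?f = "\<lambda>p. the (xstep k i p)"
  define A1 where "A1 = {p \<in> A. xstep k i p \<noteq> None}"
  have i: "i < k" using Cons.prems by simp
  have fA1: "?f ` A1 \<subseteq> {1..k}"
  proof
    fix q assume "q \<in> ?f ` A1"
    then obtain p where "p \<in> A" "xstep k i p = Some q" by (auto simp: A1_def)
    then show "q \<in> {1..k}" using xstep_range[OF i] Cons.prems(2) by blast
  qed
  have *: "?f ` (A \<inter> DOM k (i # w)) = ?f ` A1 \<inter> DOM k w"
  proof -
    have "A \<inter> DOM k (i # w) = {p \<in> A1. ?f p \<in> DOM k w}"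
      using Cons.prems(2) DOM_Cons[OF i] unfolding A1_def by blast
    then show ?thesis by blast
  qed
  have "restr A * xeval (i # w) = (restr A1 * xgen i) * xeval w"
    using restr_xgen_restrict[OF i, of A] by (simp add: xeval_def A1_def flip: mult.assoc)
  also have "restr A1 * xgen i = xgen i * restr (?f ` A1)"
    using Cons.prems i by (intro restr_xgen) (auto simp: A1_def)
  also have "xgen i * restr (?f ` A1) * xeval w = xgen i * (restr (?f ` A1) * xeval w)"
    by (simp add: mult.assoc)
  also have "restr (?f ` A1) * xeval w = restr (?f ` (A \<inter> DOM k (i # w))) * xeval w"
    using Cons.IH[OF _ fA1] Cons.prems by (simp add: *)
  also have "xgen i * (restr (?f ` (A \<inter> DOM k (i # w))) * xeval w)
      = (xgen i * restr (?f ` (A \<inter> DOM k (i # w)))) * xeval w"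
    by (simp add: mult.assoc)
  also have "xgen i * restr (?f ` (A \<inter> DOM k (i # w))) = restr (A \<inter> DOM k (i # w)) * xgen i"
    using Cons.prems i DOM_Cons[OF i] by (intro restr_xgen[symmetric]) blast+
  finally show ?case
    by (simp add: xeval_def mult.assoc)
qed

lemma spread_xeval:
  assumes "set w \<subseteq> {..<k}" "A \<subseteq> DOM k w"
  shows "spread A * xeval w = spread ((\<lambda>p. the (xact k w p)) ` A)"
  using assms
proof (induction w arbitrary: A)
  case Nil
  then show ?case by (simp add: xeval_def)
next
  case (Cons i w)
  let ?f = "\<lambda>p. the (xstep k i p)"
  have i: "i < k" using Cons.prems by simp
  have "\<forall>p\<in>A. p \<in> {1..k} \<and> xstep k i p \<noteq> None \<and> ?f p \<in> DOM k w"
    using subsetD[OF Cons.prems(2)] by (simp add: DOM_Cons[OF i])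
  then have A: "A \<subseteq> {1..k}" "\<forall>p\<in>A. xstep k i p \<noteq> None" and fA: "?f ` A \<subseteq> DOM k w"
    by blast+
  have "spread A * xeval (i # w) = (spread A * xgen i) * xeval w"
    by (simp add: xeval_def mult.assoc)
  also have "\<dots> = spread ((\<lambda>p. the (xact k w p)) ` ?f ` A)"
    using spread_xgen[OF A i] Cons.IH[OF _ fA] Cons.prems by simp
  also have "(\<lambda>p. the (xact k w p)) ` ?f ` A = (\<lambda>p. the (xact k (i # w) p)) ` A"
    unfolding image_image using A(2) by (intro image_cong) auto
  finally show ?case .
qed

lemma DOM_subset: "DOM k w \<subseteq> {1..k}"
  by (auto simp: DOM_def)

lemma restr_DOM_xeval: "set w \<subseteq> {..<k} \<Longrightarrow> restr (DOM k w) * xeval w = xeval w"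
proof -
  assume w: "set w \<subseteq> {..<k}"
  have "{1..k} \<inter> DOM k w = DOM k w"
    using DOM_subset by blast
  then show ?thesis
    using restr_xeval_restrict[OF w, of "{1..k}"] by (simp only: restr_full mult_1_left)
qed

lemma xeval_determined:
  assumes "set w \<subseteq> {..<k}" "set w' \<subseteq> {..<k}" "DOM k w = DOM k w'" "IMG k w = IMG k w'"
  shows "xeval w = xeval w'"
proof -
  obtain Q where Q: "Q * spread (DOM k w) = restr (DOM k w)"
    using spread_retract(1)[OF DOM_subset] by blast
  \<comment> \<open>One left inverse \<open>Q\<close> serves both words because their domains
    agree.\<close>
  have *: "xeval v = Q * spread (IMG k v)" if "set v \<subseteq> {..<k}" "DOM k v = DOM k w" for v
  proof -
    have "xeval v = restr (DOM k v) * xeval v"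
      by (rule restr_DOM_xeval[OF that(1), symmetric])
    also have "restr (DOM k v) = Q * spread (DOM k v)"
      unfolding that(2) by (rule Q[symmetric])
    also have "\<dots> * xeval v = Q * (spread (DOM k v) * xeval v)"
      by (simp only: mult.assoc)
    finally show ?thesis
      by (simp only: spread_xeval[OF that(1) order_refl] IMG_def)
  qed
  show ?thesis
    using *[OF assms(1) refl] *[OF assms(2) assms(3)[symmetric]] assms(4) by simp
qed

end

section \<open>The presentation of the symmetric group\<close>

definition aswap :: "nat \<Rightarrow> nat \<Rightarrow> nat" where
  "aswap j c = (if c = j then j + 1 else if c = j + 1 then j else c)"

fun aswaps :: "nat list \<Rightarrow> nat \<Rightarrow> nat" where
  "aswaps [] c = c"
| "aswaps (j # w) c = aswaps w (aswap j c)"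

lemma aswap_aswap [simp]: "aswap j (aswap j c) = c"
  by (simp add: aswap_def)

lemma aswaps_append: "aswaps (v @ w) c = aswaps w (aswaps v c)"
  by (induction v arbitrary: c) auto

lemma aswaps_rev: "aswaps (rev w) (aswaps w c) = c"
  by (induction w arbitrary: c) (auto simp: aswaps_append)

lemma aswaps_rev': "aswaps w (aswaps (rev w) c) = c"
  using aswaps_rev[of "rev w" c] by simp

lemma aswaps_le: "set w \<subseteq> {..<n} \<Longrightarrow> c \<le> n \<Longrightarrow> aswaps w c \<le> n"
  by (induction w arbitrary: c) (auto simp: aswap_def)

lemma aswaps_fix: "set w \<subseteq> {..<n} \<Longrightarrow> n < c \<Longrightarrow> aswaps w c = c"
  by (induction w) (auto simp: aswap_def)

text \<open>The word acts from its left end, so the point \<open>n\<close> is carried down step by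
  step to \<open>i\<close> and each point on the way moves up by one.\<close>

lemma aswaps_cycle: "i \<le> n \<Longrightarrow> aswaps (rev [i..<n]) c = (if c = n then i else if i \<le> c \<and> c < n then c + 1 else c)"
proof (induction n arbitrary: c)
  case (Suc n)
  then show ?case
    by (cases "i = Suc n") (auto simp: aswap_def)
qed simp

text \<open>A cycle \<open>w2\<close> sends the last point to its image under \<open>\<pi>\<close>;
  composing \<open>\<pi>\<close> with the inverse of this cycle fixes the last point and leaves a
  permutation of the others.\<close>

lemma permutation_word:
  "bij_betw \<pi> {..n} {..n} \<Longrightarrow> \<exists>w. set w \<subseteq> {..<n} \<and> (\<forall>c\<le>n. aswaps w c = \<pi> c)"
proof (induction n arbitrary: \<pi>)
  case 0
  then have "\<pi> 0 = 0" by (auto simp: bij_betw_def)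
  then show ?case by (intro exI[of _ "[]"]) auto
next
  case (Suc n)
  define i where "i = \<pi> (Suc n)"
  have i: "i \<le> Suc n" using Suc.prems by (auto simp: i_def bij_betw_def)
  define w2 where "w2 = rev [i..<Suc n]"
  have w2: "set w2 \<subseteq> {..<Suc n}" by (auto simp: w2_def)
  define \<pi>' where "\<pi>' = aswaps (rev w2) \<circ> \<pi>"
  have "aswaps w2 (Suc n) = i"
    unfolding w2_def using i by (subst aswaps_cycle) auto
  then have pfix: "\<pi>' (Suc n) = Suc n"
    using aswaps_rev[of w2 "Suc n"] by (simp add: \<pi>'_def i_def)
  have "bij_betw (aswaps (rev w2)) {..Suc n} {..Suc n}"
  proof (rule bij_betw_byWitness[of _ "aswaps w2"])
    show "aswaps (rev w2) ` {..Suc n} \<subseteq> {..Suc n}" "aswaps w2 ` {..Suc n} \<subseteq> {..Suc n}"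
      using aswaps_le[of w2 "Suc n"] aswaps_le[of "rev w2" "Suc n"] w2 by auto
  qed (simp_all add: aswaps_rev aswaps_rev')
  then have bij: "bij_betw \<pi>' {..Suc n} {..Suc n}"
    unfolding \<pi>'_def using Suc.prems by (rule bij_betw_trans[rotated])
  have "bij_betw \<pi>' ({..Suc n} - {Suc n}) ({..Suc n} - {\<pi>' (Suc n)})"
    using bij by (rule bij_betw_DiffI) (auto simp: bij_betw_def pfix)
  then have "bij_betw \<pi>' {..n} {..n}"
    by (simp add: pfix atMost_Suc)
  from Suc.IH[OF this] obtain v where v: "set v \<subseteq> {..<n}" "\<forall>c\<le>n. aswaps v c = \<pi>' c"
    by blast
  have "aswaps (v @ w2) c = \<pi> c" if "c \<le> Suc n" for c
  proof -
    have "aswaps v c = \<pi>' c"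
    proof (cases "c = Suc n")
      case True
      then show ?thesis using v(1) aswaps_fix[of v n c] pfix by simp
    qed (use v that in auto)
    then show ?thesis
      by (simp add: aswaps_append \<pi>'_def aswaps_rev')
  qed
  moreover have "set (v @ w2) \<subseteq> {..<Suc n}" using v(1) w2 by auto
  ultimately show ?case by blast
qed

text \<open>The assumption \<open>separates\<close> says that the permutation of a word can be read off from its value
  in the monoid; it turns equations found by rewriting into equations between permutations.\<close>

locale coxeter =
  fixes M :: nat and t :: "nat \<Rightarrow> 'a::monoid_mult"
  assumes invol: "\<And>j. j < M \<Longrightarrow> t j * t j = 1"
    and braid: "\<And>j. j + 1 < M \<Longrightarrow> t j * t (j + 1) * t j = t (j + 1) * t j * t (j + 1)"
    and far: "\<And>i j. i + 2 \<le> j \<Longrightarrow> j < M \<Longrightarrow> t i * t j = t j * t i"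
    and separates: "\<And>v w c. set v \<subseteq> {..<M} \<Longrightarrow> set w \<subseteq> {..<M} \<Longrightarrow>
      prod_list (map t v) = prod_list (map t w) \<Longrightarrow> c \<le> M \<Longrightarrow> aswaps v c = aswaps w c"
begin

abbreviation tw where "tw w \<equiv> prod_list (map t w)"

lemma desc_far_t: "b \<le> M \<Longrightarrow> j < M \<Longrightarrow> b < j \<or> j + 2 \<le> a \<Longrightarrow> desc t a b * t j = t j * desc t a b"
  using far[of _ j] far[of j] by (intro desc_comm) auto

lemma desc_t:
  assumes "i \<le> l" "l + 1 < b" "b \<le> M"
  shows "desc t i b * t (l + 1) = t l * desc t i b"
  using assms by (intro desc_braid braid[symmetric] far far[symmetric]) auto

text \<open>The factor \<open>desc t i (Suc n)\<close> is determined by the image \<open>i\<close> of the point \<open>n + 1\<close>.\<close>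

lemma normal_form:
  assumes "n < M" "set w \<subseteq> {..<Suc n}"
  shows "\<exists>v i. set v \<subseteq> {..<n} \<and> i \<le> Suc n \<and> tw w = tw v * desc t i (Suc n)"
  using assms(2)
proof (induction w rule: rev_induct)
  case Nil
  have "tw [] = tw [] * desc t (Suc n) (Suc n)" by simp
  then show ?case by (metis empty_set empty_subsetI order_refl)
next
  case (snoc j w)
  then obtain v i where v: "set v \<subseteq> {..<n}" "i \<le> Suc n" "tw w = tw v * desc t i (Suc n)"
    by auto
  have j: "j \<le> n" using snoc.prems by auto
  have eq: "tw (w @ [j]) = tw v * (desc t i (Suc n) * t j)"
    by (simp add: v(3) mult.assoc)
  \<comment> \<open>In the four cases the new letter passes the cycle with its index lowered,
    cancels the last letter of the cycle, prolongs the cycle, or commutes with it.\<close>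
  consider "i < j" | "j = i" | "i = Suc j" | "Suc j < i" by linarith
  then show ?case
  proof cases
    case 1
    then have "desc t i (Suc n) * t j = t (j - 1) * desc t i (Suc n)"
      using desc_t[of i "j - 1" "Suc n"] j assms(1) by simp
    then have "tw (w @ [j]) = tw (v @ [j - 1]) * desc t i (Suc n)"
      unfolding eq by (simp add: mult.assoc)
    moreover have "set (v @ [j - 1]) \<subseteq> {..<n}" using v j 1 by auto
    ultimately show ?thesis using v(2) by blast
  next
    case 2
    then have "desc t i (Suc n) * t j = desc t (Suc j) (Suc n)"
      using desc_Suc_right[of j "Suc n" t] invol[of j] j assms(1) by (simp add: mult.assoc)
    then show ?thesis using v(1) j eq by (metis Suc_le_mono)
  next
    case 3
    then have "desc t i (Suc n) * t j = desc t j (Suc n)"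
      using desc_Suc_right[of j "Suc n" t] j by simp
    then show ?thesis using v(1) j eq by (metis le_SucI)
  next
    case 4
    then have "desc t i (Suc n) * t j = t j * desc t i (Suc n)"
      using j assms(1) by (intro desc_far_t) auto
    then have "tw (w @ [j]) = tw (v @ [j]) * desc t i (Suc n)"
      unfolding eq by (simp add: mult.assoc)
    moreover have "set (v @ [j]) \<subseteq> {..<n}" using v 4 by auto
    ultimately show ?thesis using v(2) by blast
  qed
qed

text \<open>The shorter words \<open>v\<close> and \<open>v'\<close> fix the point
  \<open>Suc n\<close>, so its image tells the last factor of the normal form. Cancelling that
  factor leaves equal permutations for \<open>v\<close> and \<open>v'\<close>.\<close>

lemma coxeter_complete:
  assumes "n \<le> M" "set w \<subseteq> {..<n}" "set w' \<subseteq> {..<n}" "\<And>c. c \<le> M \<Longrightarrow> aswaps w c = aswaps w' c"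
  shows "tw w = tw w'"
  using assms
proof (induction n arbitrary: w w')
  case (Suc n)
  have "n < M" using Suc.prems(1) by simp
  obtain v i where v: "set v \<subseteq> {..<n}" "i \<le> Suc n" "tw w = tw v * desc t i (Suc n)"
    using normal_form[OF \<open>n < M\<close> Suc.prems(2)] by blast
  obtain v' i' where v': "set v' \<subseteq> {..<n}" "i' \<le> Suc n" "tw w' = tw v' * desc t i' (Suc n)"
    using normal_form[OF \<open>n < M\<close> Suc.prems(3)] by blast
  have aswaps: "aswaps u c = aswaps (rev [l..<Suc n]) (aswaps x c)"
    if "c \<le> M" "set u \<subseteq> {..<Suc n}" "set x \<subseteq> {..<n}" "tw u = tw x * desc t l (Suc n)" for c u x l
  proof -
    have "aswaps u c = aswaps (x @ rev [l..<Suc n]) c"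
      by (rule separates) (use that \<open>n < M\<close> in \<open>auto simp: desc_def\<close>)
    then show ?thesis by (simp add: aswaps_append)
  qed
  have eq: "aswaps (rev [i..<Suc n]) (aswaps v c) = aswaps (rev [i'..<Suc n]) (aswaps v' c)" if "c \<le> M" for c
    using aswaps[OF that Suc.prems(2) v(1,3)] aswaps[OF that Suc.prems(3) v'(1,3)] Suc.prems(4)[OF that]
    by metis
  have "aswaps v (Suc n) = Suc n" "aswaps v' (Suc n) = Suc n"
    using v(1) v'(1) by (simp_all add: aswaps_fix)
  then have "i = i'"
    using eq[of "Suc n"] \<open>n < M\<close> v(2) v'(2) aswaps_cycle[of i "Suc n"] aswaps_cycle[of i' "Suc n"]
    by simp
  then have "aswaps v c = aswaps v' c" if "c \<le> M" for c
    using eq[OF that] by (metis aswaps_rev rev_rev_ident)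
  then have "tw v = tw v'"
    using Suc.IH[OF _ v(1) v'(1)] \<open>n < M\<close> by simp
  then show ?case
    using v(3) v'(3) \<open>i = i'\<close> by simp
qed simp

end

text \<open>Words in the two generators are Boolean lists: \<open>True\<close> stands for the transposition,
  \<open>False\<close> for the cycle.\<close>

fun boolact :: "nat \<Rightarrow> bool list \<Rightarrow> nat \<Rightarrow> nat" where
  "boolact m [] c = c"
| "boolact m (q # w) c = boolact m w (if q then aswap 0 c else (c + 1) mod m)"

lemma boolact_append: "boolact m (v @ w) c = boolact m w (boolact m v c)"
  by (induction v arbitrary: c) auto

lemma boolact_replicate_False: "c < m \<Longrightarrow> boolact m (replicate n False) c = (c + n) mod m"
proof (induction n arbitrary: c)
  case (Suc n)
  then have "(c + 1) mod m < m" by simp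
  then show ?case using Suc.IH by (simp add: mod_simps add_ac)
qed simp

definition conj_word :: "nat \<Rightarrow> nat \<Rightarrow> bool list" where
  "conj_word m j = replicate (m - j) False @ [True] @ replicate j False"

text \<open>The first \<open>m - j\<close> rotations bring \<open>j\<close> and \<open>j + 1\<close>
  to 0 and 1, and the last \<open>j\<close> rotations bring them back.\<close>

lemma boolact_conj_word:
  assumes "j + 1 < m" "c < m"
  shows "boolact m (conj_word m j) c = aswap j c"
proof -
  have "boolact m (conj_word m j) c = boolact m (replicate j False) (aswap 0 ((c + (m - j)) mod m))"
    using assms by (simp add: conj_word_def boolact_append boolact_replicate_False)
  also have "(c + (m - j)) mod m = (if c < j then c + (m - j) else c - j)"
  proof (cases "c < j")
    case False
    then have "c + (m - j) = (c - j) + m" using assms by simp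
    then show ?thesis
      using False assms by (simp only: mod_add_self2) simp
  qed (use assms in auto)
  also have "boolact m (replicate j False) (aswap 0 \<dots>) = (aswap 0 (if c < j then c + (m - j) else c - j) + j) mod m"
    using assms by (intro boolact_replicate_False) (auto simp: aswap_def)
  also have "\<dots> = aswap j c"
    using assms by (auto simp: aswap_def)
  finally show ?thesis .
qed

lemma boolact_conj_words:
  "set w \<subseteq> {..<m - 1} \<Longrightarrow> c < m \<Longrightarrow> boolact m (concat (map (conj_word m) w)) c = aswaps w c"
proof (induction w arbitrary: c)
  case (Cons j w)
  then have "aswap j c < m" by (auto simp: aswap_def)
  then show ?case using Cons boolact_conj_word[of j m c] by (auto simp: boolact_append)
qed simp

lemma permutation_bool_word:
  assumes "2 \<le> m" "bij_betw \<pi> {..<m} {..<m}"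
  shows "\<exists>w. \<forall>c<m. boolact m w c = \<pi> c"
proof -
  have "{..<m} = {..m - 1}" using assms(1) by auto
  then obtain w where "set w \<subseteq> {..<m - 1}" "\<forall>c\<le>m - 1. aswaps w c = \<pi> c"
    using permutation_word[of \<pi> "m - 1"] assms by auto
  then have "\<forall>c<m. boolact m (concat (map (conj_word m) w)) c = \<pi> c"
    using boolact_conj_words by auto
  then show ?thesis by blast
qed

lemma left_inverse_eq_right_inverse: "p * q = 1 \<Longrightarrow> q * r = 1 \<Longrightarrow> p = r" for p :: "'a::monoid_mult"
  using mult.assoc[of p q r] by simp

section \<open>From the two generators of the symmetric group to Coxeter generators\<close>

locale symmetric_relations =
  fixes m :: nat and a b :: "'a::monoid_mult"
  assumes m: "2 \<le> m"
    and aa: "a * a = 1"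
    and bm: "b ^ m = 1"
    and ba: "(b * a) ^ (m - 1) = 1"
    and ab3: "(a * b ^ (m - 1) * a * b) ^ 3 = 1"
    and ab2: "\<And>j. 2 \<le> j \<Longrightarrow> j \<le> m - 2 \<Longrightarrow> (a * b ^ (m - j) * a * b ^ j) ^ 2 = 1"
    and sep: "\<And>v w c. prod_list (map (\<lambda>q. if q then a else b) v) =
      prod_list (map (\<lambda>q. if q then a else b) w) \<Longrightarrow> c < m \<Longrightarrow> boolact m v c = boolact m w c"
begin

abbreviation abw where "abw w \<equiv> prod_list (map (\<lambda>q. if q then a else b) w)"

definition s where "s j = b ^ (m - j) * a * b ^ j"

lemma b_inv: "i \<le> m \<Longrightarrow> b ^ i * b ^ (m - i) = 1" "i \<le> m \<Longrightarrow> b ^ (m - i) * b ^ i = 1"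
  using bm by (simp_all flip: power_add)

lemma s0: "s 0 = a"
  using bm by (simp add: s_def)

text \<open>The relations only speak of pairs that contain \<open>s 0\<close>; conjugation by powers
  of \<open>b\<close> carries them to all other pairs.\<close>

lemma s_shift: "i + d \<le> m \<Longrightarrow> b ^ (m - d) * s i * b ^ d = s (i + d)"
proof -
  assume i: "i + d \<le> m"
  have "b ^ (m - d) * b ^ (m - i) = b ^ m * b ^ (m - (i + d))"
    using i by (simp flip: power_add add: algebra_simps)
  then have 1: "b ^ (m - d) * b ^ (m - i) = b ^ (m - (i + d))"
    using bm by simp
  have "b ^ (m - d) * s i * b ^ d = (b ^ (m - d) * b ^ (m - i)) * a * (b ^ i * b ^ d)"
    by (simp add: s_def mult.assoc)
  then show ?thesis
    unfolding 1 s_def by (simp add: power_add)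
qed

lemma conj_mult:
  assumes "d \<le> m"
  shows "b ^ (m - d) * y * b ^ d * (b ^ (m - d) * z * b ^ d) = b ^ (m - d) * (y * z) * b ^ d"
proof -
  have "b ^ (m - d) * y * b ^ d * (b ^ (m - d) * z * b ^ d)
      = b ^ (m - d) * y * (b ^ d * b ^ (m - d)) * z * b ^ d"
    by (simp add: mult.assoc)
  then show ?thesis
    using b_inv[OF assms] by (simp add: mult.assoc)
qed

lemma s_invol: "j \<le> m \<Longrightarrow> s j * s j = 1"
  using conj_mult[of j a a] b_inv[of j] aa by (simp add: s_def)

text \<open>For the pair \<open>s 0\<close>, \<open>s 1\<close> the third power says that
  \<open>s 0 * s 1 * s 0\<close> is a left inverse of \<open>s 1 * s 0 * s 1\<close>, and the latter
  is its own inverse.\<close>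

lemma s_braid:
  assumes "j + 1 < m"
  shows "s j * s (j + 1) * s j = s (j + 1) * s j * s (j + 1)"
proof -
  have s1: "s 1 * s 1 = 1" and ss: "s 0 * s 0 = 1"
    using s_invol[of 1] s_invol[of 0] m by auto
  have "(s 0 * s 1) ^ 3 = 1"
    using ab3 by (simp add: s_def bm mult.assoc)
  then have "(s 0 * s 1 * s 0) * (s 1 * s 0 * s 1) = 1"
    by (simp add: numeral_3_eq_3 mult.assoc)
  moreover have "(s 1 * s 0 * s 1) * (s 1 * s 0 * s 1) = s 1 * (s 0 * (s 1 * s 1) * s 0) * s 1"
    by (simp only: mult.assoc)
  then have "(s 1 * s 0 * s 1) * (s 1 * s 0 * s 1) = 1"
    by (simp only: s1 ss mult_1_right)
  ultimately have b0: "s 0 * s 1 * s 0 = s 1 * s 0 * s 1"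
    by (rule left_inverse_eq_right_inverse)
  have "s j = b ^ (m - j) * s 0 * b ^ j" "s (j + 1) = b ^ (m - j) * s 1 * b ^ j"
    using s_shift[of 0 j] s_shift[of 1 j] assms by (simp_all add: add.commute)
  then show ?thesis
    using b0 assms by (simp only: conj_mult add_leD1 less_imp_le)
qed

text \<open>The product \<open>s 0 * s l\<close> is its own inverse, and \<open>s l * s 0\<close> is
  also an inverse of it. The bound on \<open>j\<close> keeps the difference \<open>l\<close> within
  the range of \<open>ab2\<close>.\<close>

lemma s_far:
  assumes "i + 2 \<le> j" "j < m - 1"
  shows "s i * s j = s j * s i"
proof -
  define l where "l = j - i"
  have l: "j = l + i" "2 \<le> l" "l \<le> m - 2" "l \<le> m" using assms by (auto simp: l_def)
  have ss: "s l * s l = 1" "s 0 * s 0 = 1"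
    using s_invol[of l] s_invol[of 0] l by auto
  have "(s 0 * s l) ^ 2 = 1"
    using ab2[OF l(2,3)] by (simp add: s_def bm mult.assoc)
  then have "(s 0 * s l) * (s 0 * s l) = 1"
    by (simp add: power2_eq_square)
  moreover have "(s 0 * s l) * (s l * s 0) = s 0 * (s l * s l) * s 0"
    by (simp only: mult.assoc)
  then have "(s 0 * s l) * (s l * s 0) = 1"
    by (simp only: ss mult_1_right)
  ultimately have c: "s 0 * s l = s l * s 0"
    by (rule left_inverse_eq_right_inverse)
  have "s i = b ^ (m - i) * s 0 * b ^ i" "s j = b ^ (m - i) * s l * b ^ i"
    using s_shift[of 0 i] s_shift[of l i] assms l by simp_all
  moreover have "i \<le> m" using assms by simp
  ultimately show ?thesis
    using c by (simp only: conj_mult)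
qed

text \<open>A letter \<open>a\<close> standing before \<open>b ^ n\<close> is carried through it and
  becomes \<open>s n\<close>, because \<open>b ^ n * s n = a * b ^ n\<close>.\<close>

lemma ba_power: "n \<le> m \<Longrightarrow> (b * a) ^ n = b ^ n * desc s 0 n"
proof (induction n)
  case (Suc n)
  have "b ^ n * s n = a * b ^ n"
    using b_inv[of n] Suc.prems by (simp add: s_def flip: mult.assoc)
  have "(b * a) ^ Suc n = b * (a * b ^ n) * desc s 0 n"
    using Suc by (simp add: mult.assoc)
  also have "\<dots> = b * (b ^ n * s n) * desc s 0 n"
    using \<open>b ^ n * s n = a * b ^ n\<close> by simp
  also have "\<dots> = b ^ Suc n * desc s 0 (Suc n)"
    by (simp add: desc_Suc mult.assoc)
  finally show ?case .
qed simp

lemma b_eq: "b = desc s 0 (m - 1)"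
proof -
  have "b = b * (b ^ (m - 1) * desc s 0 (m - 1))"
    using ba_power[of "m - 1"] ba by simp
  also have "\<dots> = b ^ Suc (m - 1) * desc s 0 (m - 1)"
    by (simp add: mult.assoc)
  finally show ?thesis
    using bm m by simp
qed

lemma abw_conj_word: "abw (conj_word m j) = s j"
  by (simp add: conj_word_def s_def mult.assoc)

lemma abw_conj_words: "abw (concat (map (conj_word m) w)) = prod_list (map s w)"
  by (induction w) (simp_all add: abw_conj_word)

sublocale coxeter "m - 1" s
proof
  fix v w c
  assume *: "set v \<subseteq> {..<m - 1}" "set w \<subseteq> {..<m - 1}"
    "prod_list (map s v) = prod_list (map s w)" "c \<le> m - 1"
  then have "boolact m (concat (map (conj_word m) v)) c = boolact m (concat (map (conj_word m) w)) c"
    using m by (intro sep) (auto simp: abw_conj_words)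
  then show "aswaps v c = aswaps w c"
    using * m by (simp add: boolact_conj_words)
qed (use s_invol s_braid s_far in auto)

text \<open>Substitutes the expression of \<open>b\<close> from \<open>b_eq\<close>. The next lemmas
  show that this preserves both the value in the monoid and the permutation.\<close>

definition aswaps_of :: "bool list \<Rightarrow> nat list" where
  "aswaps_of w = concat (map (\<lambda>q. if q then [0] else rev [0..<m - 1]) w)"

lemma set_aswaps_of: "set (aswaps_of w) \<subseteq> {..<m - 1}"
  using m by (auto simp: aswaps_of_def split: if_splits)

lemma abw_aswaps_of: "prod_list (map s (aswaps_of w)) = abw w"
proof (induction w)
  case (Cons q w)
  then show ?case
    using s0 b_eq by (simp add: aswaps_of_def desc_def)
qed (simp add: aswaps_of_def)

lemma aswaps_aswaps_of: "c < m \<Longrightarrow> aswaps (aswaps_of w) c = boolact m w c"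
proof (induction w arbitrary: c)
  case (Cons q w)
  have "aswaps (rev [0..<m - 1]) c = (c + 1) mod m"
    using Cons.prems m by (subst aswaps_cycle) (auto simp: mod_Suc)
  moreover have "aswap 0 c < m" using Cons.prems m by (auto simp: aswap_def)
  ultimately show ?case
    using Cons m by (auto simp: aswaps_of_def aswaps_append)
qed (simp add: aswaps_of_def)

lemma symmetric_complete:
  assumes "\<And>c. c < m \<Longrightarrow> boolact m v c = boolact m w c"
  shows "abw v = abw w"
proof -
  have "prod_list (map s (aswaps_of v)) = prod_list (map s (aswaps_of w))"
    using assms m by (intro coxeter_complete[OF order_refl set_aswaps_of set_aswaps_of]) (simp add: aswaps_aswaps_of)
  then show ?thesis by (simp add: abw_aswaps_of)
qed

end

section \<open>Action of words on blocks and inside blocks\<close>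

text \<open>A point of \<open>\<Omega>\<^sub>n\<close> is a pair of a block and a place \<open>c < m\<close> inside it. \<open>bact\<close> follows the block and
  \<open>cact\<close> the place; \<open>cact\<close> is meaningful only as long as the block is not dropped.\<close>

definition bstep :: "nat \<Rightarrow> gen \<Rightarrow> nat \<Rightarrow> nat option" where
  "bstep k g p = (case g of gx i \<Rightarrow> xstep k i p | _ \<Rightarrow> Some p)"

definition cstep :: "nat \<Rightarrow> gen \<Rightarrow> nat \<Rightarrow> nat \<Rightarrow> nat" where
  "cstep m g p c = (case g of ga j \<Rightarrow> if p = j then aswap 0 c else c
     | gb j \<Rightarrow> if p = j then (c + 1) mod m else c | gx _ \<Rightarrow> c)"

fun bact :: "nat \<Rightarrow> gen list \<Rightarrow> nat \<Rightarrow> nat option" where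
  "bact k [] p = Some p"
| "bact k (g # w) p = Option.bind (bstep k g p) (bact k w)"

fun cact :: "nat \<Rightarrow> nat \<Rightarrow> gen list \<Rightarrow> nat \<Rightarrow> nat \<Rightarrow> nat" where
  "cact k m [] p c = c"
| "cact k m (g # w) p c = cact k m w (the (bstep k g p)) (cstep m g p c)"

text \<open>This is equality of the induced partial maps (\<open>pmap_eq_iff\<close>), in a form
  that can be checked letter by letter.\<close>

definition sem_eq :: "nat \<Rightarrow> nat \<Rightarrow> gen list \<Rightarrow> gen list \<Rightarrow> bool" where
  "sem_eq k m u v \<longleftrightarrow> (\<forall>p\<in>{1..k}. bact k u p = bact k v p \<and>
     (bact k u p \<noteq> None \<longrightarrow> (\<forall>c<m. cact k m u p c = cact k m v p c)))"

lemma bact_append: "bact k (u @ v) p = Option.bind (bact k u p) (bact k v)"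
  by (induction u arbitrary: p) (auto simp: bind_assoc split: bind_splits)

lemma cact_append: "bact k u p = Some q \<Longrightarrow> cact k m (u @ v) p c = cact k m v q (cact k m u p c)"
  by (induction u arbitrary: p c) (auto split: bind_splits)

abbreviation words :: "nat \<Rightarrow> gen list set" where
  "words k \<equiv> lists (generators k)"

lemma bstep_range: "2 \<le> k \<Longrightarrow> g \<in> generators k \<Longrightarrow> p \<in> {1..k} \<Longrightarrow> bstep k g p = Some q \<Longrightarrow> q \<in> {1..k}"
  by (auto simp: bstep_def generators_def xstep_def split: if_splits)

lemma bact_range:
  "2 \<le> k \<Longrightarrow> w \<in> words k \<Longrightarrow> p \<in> {1..k} \<Longrightarrow> bact k w p = Some q \<Longrightarrow> q \<in> {1..k}"
proof (induction w arbitrary: p)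
  case (Cons g w)
  from Cons.prems obtain r where "bstep k g p = Some r" "bact k w r = Some q"
    by (auto simp: bind_eq_Some_conv)
  then show ?case
    using Cons bstep_range[of k g p r] by auto
qed simp

lemma cstep_less: "2 \<le> m \<Longrightarrow> c < m \<Longrightarrow> cstep m g p c < m"
  by (auto simp: cstep_def aswap_def split: gen.splits)

lemma cact_less: "2 \<le> m \<Longrightarrow> c < m \<Longrightarrow> cact k m w p c < m"
  by (induction w arbitrary: p c) (auto simp: cstep_less)

lemma sem_eq_refl: "sem_eq k m u u"
  by (simp add: sem_eq_def)

lemma sem_eq_sym: "sem_eq k m u v \<Longrightarrow> sem_eq k m v u"
  by (auto simp: sem_eq_def)

lemma sem_eq_trans: "sem_eq k m u v \<Longrightarrow> sem_eq k m v w \<Longrightarrow> sem_eq k m u w"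
  by (auto simp: sem_eq_def)

lemma sem_eq_append:
  assumes "2 \<le> k" "2 \<le> m" "u \<in> words k" "v \<in> words k"
    and "sem_eq k m u v" "sem_eq k m u' v'"
  shows "sem_eq k m (u @ u') (v @ v')"
  unfolding sem_eq_def
proof (intro ballI)
  fix p assume p: "p \<in> {1..k}"
  have eq: "bact k u p = bact k v p" using assms(5) p by (simp add: sem_eq_def)
  show "bact k (u @ u') p = bact k (v @ v') p \<and>
    (bact k (u @ u') p \<noteq> None \<longrightarrow> (\<forall>c<m. cact k m (u @ u') p c = cact k m (v @ v') p c))"
  proof (cases "bact k u p")
    case (Some q)
    then have q: "q \<in> {1..k}" using bact_range[OF assms(1,3) p] by blast
    have "cact k m u p c = cact k m v p c" if "c < m" for c
      using assms(5) p Some that by (simp add: sem_eq_def)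
    moreover have "cact k m v p c < m" if "c < m" for c
      using cact_less assms(2) that by blast
    ultimately show ?thesis
      using assms(6) q Some eq by (simp add: bact_append cact_append[OF Some] cact_append[of k v p q] sem_eq_def)
  qed (use eq in \<open>simp add: bact_append\<close>)
qed

definition coord_letter :: "nat \<Rightarrow> bool \<Rightarrow> gen" where "coord_letter i q = (if q then ga i else gb i)"

lemma bact_coord_letter: "bact k (map (coord_letter i) w) p = Some p"
  by (induction w) (auto simp: bstep_def coord_letter_def)

lemma cact_coord_letter: "cact k m (map (coord_letter i) w) p c = (if p = i then boolact m w c else c)"
  by (induction w arbitrary: c) (auto simp: bstep_def cstep_def coord_letter_def)

lemma sem_eq_coord_letter:
  assumes "\<And>c. c < m \<Longrightarrow> boolact m v c = boolact m w c"
  shows "sem_eq k m (map (coord_letter i) v) (map (coord_letter i) w)"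
  using assms by (simp add: sem_eq_def bact_coord_letter cact_coord_letter)

lemma map_wpow: "map h (w \<up> n) = map h w \<up> n"
  by (simp add: wpow_def map_concat)

lemma wpow_single: "[g] \<up> n = replicate n g"
  by (induction n) (simp_all add: wpow_def)

lemma boolact_wpow: "boolact m (w \<up> n) c = (boolact m w ^^ n) c"
  by (induction n arbitrary: c) (simp_all add: wpow_def boolact_append funpow_swap1)

lemma boolact_True_conj_word:
  "j + 1 < m \<Longrightarrow> c < m \<Longrightarrow>
   boolact m ([True] @ replicate (m - j) False @ [True] @ replicate j False) c = aswap j (aswap 0 c)"
  using boolact_conj_word[of j m "aswap 0 c"] by (simp add: conj_word_def aswap_def)

text \<open>The cycle followed by the transposition fixes 0 and rotates the remaining
  \<open>m - 1\<close> points.\<close>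

lemma boolact_long_cycle:
  assumes "c < m" "2 \<le> m"
  shows "(boolact m [False, True] ^^ (m - 1)) c = c"
proof (cases c)
  case 0
  have "(boolact m [False, True] ^^ n) 0 = 0" for n
    using assms(2) by (induction n) (auto simp: aswap_def)
  then show ?thesis using 0 by simp
next
  case (Suc d)
  have "(boolact m [False, True] ^^ n) (Suc d) = Suc ((d + n) mod (m - 1))" for n
  proof (induction n)
    case 0
    then show ?case using assms(1) Suc by simp
  next
    case (Suc n)
    define r where "r = (d + n) mod (m - 1)"
    have r: "r < m - 1" using assms(2) by (simp add: r_def)
    have "(boolact m [False, True] ^^ Suc n) (Suc d) = boolact m [False, True] (Suc r)"
      by (simp only: funpow.simps comp_apply Suc r_def)
    also have "\<dots> = Suc (Suc r mod (m - 1))"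
      using r by (cases "Suc r = m - 1") (auto simp: aswap_def)
    also have "Suc r mod (m - 1) = (d + Suc n) mod (m - 1)"
      by (simp add: r_def mod_Suc_eq)
    finally show ?case .
  qed
  moreover have "(d + (m - 1)) mod (m - 1) = d"
    using Suc assms(1) by (simp only: mod_add_self2) simp
  ultimately show ?thesis using Suc by (simp only:)
qed

section \<open>Soundness: the relations hold for the actions\<close>

lemma sem_rels_R:
  assumes m: "2 \<le> m" and uv: "(u, v) \<in> rels_R k m"
  shows "sem_eq k m u v"
proof -
  have coord_letter: "sem_eq k m u v" if "u = map (coord_letter i) w" "v = []" "\<And>c. c < m \<Longrightarrow> boolact m w c = c" for u v i w
    using sem_eq_coord_letter[of m w "[]" k i] that by simp
  have words: "[ga i] = map (coord_letter i) [True]" "[gb i] = map (coord_letter i) [False]" for i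
    by (simp_all add: coord_letter_def)
  have long: "(([ga i] @ [gb i] \<up> (m - j) @ [ga i] @ [gb i] \<up> j) \<up> n)
    = map (coord_letter i) (([True] @ replicate (m - j) False @ [True] @ replicate j False) \<up> n)" for i j n
    by (simp add: map_wpow wpow_single coord_letter_def)
  show ?thesis
    using uv unfolding rels_R_def
  proof (elim UnE CollectE exE conjE)
    fix i assume "(u, v) = ([ga i] \<up> 2, [])"
    then show ?thesis
      by (intro coord_letter[of _ i "[True] \<up> 2"]) (auto simp: words map_wpow boolact_wpow numeral_2_eq_2)
  next
    fix i assume "(u, v) = ([gb i] \<up> m, [])"
    then show ?thesis
      by (intro coord_letter[of _ i "[False] \<up> m"])
        (auto simp: words map_wpow wpow_single boolact_replicate_False)
  next
    fix i assume "(u, v) = ([gb i, ga i] \<up> (m - 1), [])"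
    moreover have "[gb i, ga i] \<up> (m - 1) = map (coord_letter i) ([False, True] \<up> (m - 1))"
      by (simp add: map_wpow coord_letter_def)
    moreover have "boolact m ([False, True] \<up> (m - 1)) c = c" if "c < m" for c
      unfolding boolact_wpow by (rule boolact_long_cycle[OF that m])
    ultimately show ?thesis
      by (intro coord_letter[of _ i "[False, True] \<up> (m - 1)"]) auto
  next
    fix i assume *: "(u, v) = (([ga i] @ [gb i] \<up> (m - 1) @ [ga i] @ [gb i]) \<up> 3, [])"
    let ?w = "[True] @ replicate (m - 1) False @ [True] @ replicate 1 False"
    have "boolact m (?w \<up> 3) c = c" if "c < m" for c
    \<comment> \<open>For \<open>m = 2\<close> the point \<open>j + 1 = 2\<close> does not exist, so
      \<open>boolact_True_conj_word\<close> does not apply with \<open>j = 1\<close>. Then both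
      letters swap the two points, and the word has four letters.\<close>
    proof (cases "m = 2")
      case True
      then have "c = 0 \<or> c = 1" using that by auto
      then have "boolact m ?w c = c" using True by (auto simp: aswap_def)
      then show ?thesis by (simp add: boolact_wpow numeral_3_eq_3)
    next
      case False
      have aswap_less: "aswap 1 (aswap 0 d) < m" if "d < m" for d
        using that False m by (auto simp: aswap_def)
      have step: "boolact m ?w d = aswap 1 (aswap 0 d)" if "d < m" for d
        using boolact_True_conj_word[of 1 m d] that False m by simp
      have "boolact m (?w \<up> 3) c = boolact m ?w (boolact m ?w (boolact m ?w c))"
        by (simp only: boolact_wpow numeral_3_eq_3 funpow.simps comp_apply id_apply)
      also have "\<dots> = aswap 1 (aswap 0 (aswap 1 (aswap 0 (aswap 1 (aswap 0 c)))))"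
        by (simp only: step aswap_less that)
      also have "\<dots> = c"
        by (simp add: aswap_def)
      finally show ?thesis .
    qed
    then show ?thesis
      using * long[of i 1 3] by (intro coord_letter[of _ i "?w \<up> 3"]) (auto simp: wpow_single)
  next
    fix i j assume *: "(u, v) = (([ga i] @ [gb i] \<up> (m - j) @ [ga i] @ [gb i] \<up> j) \<up> 2, [])"
      and j: "2 \<le> j" "j \<le> m - 2"
    let ?w = "[True] @ replicate (m - j) False @ [True] @ replicate j False"
    have "boolact m (?w \<up> 2) c = c" if "c < m" for c
    proof -
      have aswap_less: "aswap j (aswap 0 d) < m" if "d < m" for d
        using that j by (auto simp: aswap_def)
      have step: "boolact m ?w d = aswap j (aswap 0 d)" if "d < m" for d
        using that j by (intro boolact_True_conj_word) auto
      have "boolact m (?w \<up> 2) c = boolact m ?w (boolact m ?w c)"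
        by (simp only: boolact_wpow numeral_2_eq_2 funpow.simps comp_apply id_apply)
      also have "\<dots> = aswap j (aswap 0 (aswap j (aswap 0 c)))"
        by (simp only: step aswap_less that)
      also have "\<dots> = c"
        using j by (simp add: aswap_def)
      finally show ?thesis .
    qed
    then show ?thesis
      using * long[of i j 2] by (intro coord_letter[of _ i "?w \<up> 2"]) auto
  qed (auto simp: sem_eq_def bstep_def cstep_def)
qed

lemma sem_rels_R':
  assumes "2 \<le> k" "(u, v) \<in> rels_R' k"
  shows "sem_eq k m u v"
  using assms(2) unfolding rels_R'_def
  by (elim UN_E UnE CollectE exE conjE insertE emptyE;
      use assms(1) in \<open>auto simp: sem_eq_def bstep_def cstep_def xstep_def\<close>)

lemma bact_gx: "bact k (map gx w) p = xact k w p"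
proof (induction w arbitrary: p)
  case (Cons i w)
  have "bact k (map gx w) = xact k w"
    using Cons by (rule ext)
  then show ?case by (simp add: bstep_def)
qed simp

lemma cact_gx: "cact k m (map gx w) p c = c"
  by (induction w arbitrary: p) (auto simp: cstep_def)

lemma sem_eq_gx:
  "(\<And>p. 1 \<le> p \<Longrightarrow> p \<le> k \<Longrightarrow> xact k v p = xact k w p) \<Longrightarrow> sem_eq k m (map gx v) (map gx w)"
  by (auto simp: sem_eq_def bact_gx cact_gx)

lemma xact_append: "xact k (v @ w) p = Option.bind (xact k v p) (xact k w)"
  by (induction v arbitrary: p) (auto simp: bind_assoc split: bind_splits)

text \<open>The letters act at descending block numbers, so a block that has been moved up is out of
  reach of the following letters.\<close>

lemma xact_upt:
  "1 \<le> i \<Longrightarrow> i \<le> j \<Longrightarrow> j \<le> k \<Longrightarrow> xact k [i..<j] p =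
     (if k - j < p \<and> p \<le> k - i then Some (p + 1) else if i < j \<and> p = k - i + 1 then None else Some p)"
proof (induction j)
  case (Suc j)
  show ?case
  proof (cases "i = Suc j")
    case False
    then have "xact k [i..<Suc j] p = Option.bind (xact k [i..<j] p) (xstep k j)"
    proof -
      have "xact k [j] = xstep k j"
        by (rule ext) (simp split: bind_splits)
      then show ?thesis using Suc.prems False by (simp only: upt_Suc xact_append le_Suc_eq simp_thms if_True)
    qed
    then show ?thesis
      using Suc False by (auto simp: xstep_def)
  qed (use Suc.prems in auto)
qed simp

lemma xact_cyc0: "2 \<le> k \<Longrightarrow> 1 \<le> p \<Longrightarrow> p \<le> k \<Longrightarrow> xact k [0..<k] p = (if p = 1 then None else Some p)"
  by (auto simp: upt_conv_Cons[of 0 k] xact_upt[of 1 k k, simplified] xstep_def)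

lemma xact_cyc:
  assumes "1 \<le> i" "i < k" "1 \<le> p" "p \<le> k"
  shows "xact k ([i..<k] @ [0..<i]) p = (if p = k - i + 1 then None else Some p)"
  using assms by (auto simp: xact_append xact_upt upt_conv_Cons[of 0 i] xstep_def)

text \<open>The word is that of \<open>d (k - i)\<close>, the inverse of x_i; the preceding lemma
  concerns \<open>e (k - i + 1)\<close>.\<close>

lemma xact_cyc':
  assumes "1 \<le> i" "i < k" "1 \<le> p" "p \<le> k"
  shows "xact k ([i + 1..<k] @ [0..<i]) p
    = (if p = k - i then None else if p = k - i + 1 then Some (k - i) else Some p)"
proof (cases "p \<le> k - (i + 1)")
  case True
  then have "xact k [i + 1..<k] p = Some (p + 1)"
    using assms by (subst xact_upt) auto
  then show ?thesis
    using assms True xact_upt[of 1 i k p] by (auto simp: xact_append upt_conv_Cons[of 0 i] xstep_def)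
next
  case False
  then have "xact k [i + 1..<k] p = (if p = k - i \<and> i + 1 < k then None else Some p)"
    using assms by (subst xact_upt) auto
  then show ?thesis
    using assms False xact_upt[of 1 i k "p - 1"]
    by (auto simp: xact_append upt_conv_Cons[of 0 i] xstep_def)
qed

lemma sem_rels_W:
  assumes k: "2 \<le> k" and uv: "(u, v) \<in> rels_W k"
  shows "sem_eq k m u v"
proof -
  have gx: "sem_eq k m u v"
    if "u = map gx u'" "v = map gx v'" "\<And>p. 1 \<le> p \<Longrightarrow> p \<le> k \<Longrightarrow> xact k u' p = xact k v' p" for u v u' v'
    using sem_eq_gx[of k u' v' m] that by simp
  show ?thesis
    using uv unfolding rels_W_def
  proof (elim UnE CollectE exE conjE insertE emptyE)
    fix i assume "(u, v) = ([gx i, gx 0], [gx 0, gx (i + 1)])" "1 \<le> i" "i \<le> k - 2"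
    then show ?thesis by (intro gx[of _ "[i,0]" _ "[0,i+1]"]) (auto simp: xstep_def)
  next
    fix i j assume "(u, v) = ([gx j, gx i], [gx i, gx j])" "2 \<le> i + 1" "i + 1 < j" "j \<le> k - 1"
    then show ?thesis by (intro gx[of _ "[j,i]" _ "[i,j]"]) (auto simp: xstep_def)
  next
    assume "(u, v) = ([gx 0, gx 0, gx 1], [gx 0, gx 0])"
    then show ?thesis using k by (intro gx[of _ "[0,0,1]" _ "[0,0]"]) (auto simp: xstep_def)
  next
    assume "(u, v) = ([gx 0, gx 0], [gx (k - 1), gx 0, gx 0])"
    then show ?thesis using k by (intro gx[of _ "[0,0]" _ "[k-1,0,0]"]) (auto simp: xstep_def)
  next
    fix i assume "(u, v) = ([gx (i + 1), gx i, gx (i + 1)], [gx (i + 1), gx i])" "1 \<le> i" "i \<le> k - 2"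
    then show ?thesis by (intro gx[of _ "[i+1,i,i+1]" _ "[i+1,i]"]) (auto simp: xstep_def)
  next
    fix i assume "(u, v) = ([gx (i + 1), gx i], [gx i, gx (i + 1), gx i])" "1 \<le> i" "i \<le> k - 2"
    then show ?thesis by (intro gx[of _ "[i+1,i]" _ "[i,i+1,i]"]) (auto simp: xstep_def)
  next
    fix i assume *: "(u, v) = (cyc k i @ [gx i], [gx i])" "0 \<le> i" "i \<le> k - 1"
    show ?thesis
    proof (rule gx[of _ "([i..<k] @ [0..<i]) @ [i]" _ "[i]"])
      fix p assume "1 \<le> p" "p \<le> k"
      then show "xact k (([i..<k] @ [0..<i]) @ [i]) p = xact k [i] p"
        unfolding xact_append[of k "[i..<k] @ [0..<i]"]
        using * k xact_cyc[of i k p] xact_cyc0[of k p] by (cases "i = 0") (auto simp: xstep_def)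
    qed (use * in \<open>auto simp: cyc_def\<close>)
  next
    fix i assume *: "(u, v) = (cyc' k i @ [gx i, gx i], [gx i, gx i])" "1 \<le> i" "i \<le> k - 1"
    show ?thesis
    proof (rule gx[of _ "([i + 1..<k] @ [0..<i]) @ [i, i]" _ "[i, i]"])
      fix p assume "1 \<le> p" "p \<le> k"
      then show "xact k (([i + 1..<k] @ [0..<i]) @ [i, i]) p = xact k [i, i] p"
        unfolding xact_append[of k "[i + 1..<k] @ [0..<i]"]
        using * k xact_cyc'[of i k p] by (auto simp: xstep_def)
    qed (use * in \<open>auto simp: cyc'_def\<close>)
  qed
qed

lemma sem_relations:
  "2 \<le> k \<Longrightarrow> 2 \<le> m \<Longrightarrow> (u, v) \<in> relations k m \<Longrightarrow> sem_eq k m u v"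
  unfolding relations_def using sem_rels_R sem_rels_W sem_rels_R' by blast

section \<open>Completeness of the relations\<close>

text \<open>Once the tail is replaced, \<open>G j\<close> and \<open>H j\<close> both commute with
  it and reach \<open>T\<close>, where they disappear if they differ. In the application
  \<open>T\<close> is the x-part, and the factors that may differ sit at blocks outside its
  domain.\<close>

lemma prod_list_replace:
  fixes G H :: "nat \<Rightarrow> 'a::monoid_mult"
  assumes "distinct js"
    and "\<And>j. j \<in> set js \<Longrightarrow> G j = H j \<or> G j * T = T \<and> H j * T = T"
    and "\<And>i j. i \<in> set js \<Longrightarrow> j \<in> set js \<Longrightarrow> i \<noteq> j \<Longrightarrow> G i * H j = H j * G i \<and> H i * H j = H j * H i"
  shows "prod_list (map G js) * T = prod_list (map H js) * T"
  using assms
proof (induction js)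
  case (Cons j js)
  have IH: "prod_list (map G js) * T = prod_list (map H js) * T"
    using Cons by simp
  have comm_letter: "y * H i = H i * y" if "y = G j \<or> y = H j" "i \<in> set js" for y i
    using Cons.prems(1) Cons.prems(3)[of j i] that by auto
  have comm: "y * prod_list (map H js) = prod_list (map H js) * y" if y: "y = G j \<or> y = H j" for y
  proof -
    have "y * prod_list (map H is) = prod_list (map H is) * y" if "set is \<subseteq> set js" for "is"
      using that
    proof (induction "is")
      case (Cons i "is")
      have "y * prod_list (map H (i # is)) = H i * (y * prod_list (map H is))"
        using mult_eq_assoc[OF comm_letter[OF y, of i]] Cons.prems by simp
      also have "y * prod_list (map H is) = prod_list (map H is) * y"
        using Cons by auto
      finally show ?case
        by (simp add: mult.assoc)
    qed simp
    then show ?thesis by blast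
  qed
  have "G j * (prod_list (map H js) * T) = H j * (prod_list (map H js) * T)"
  proof (cases "G j = H j")
    case False
    then have "G j * T = T" "H j * T = T" using Cons.prems(2)[of j] by auto
    moreover have "G j * (prod_list (map H js) * T) = prod_list (map H js) * (G j * T)"
      "H j * (prod_list (map H js) * T) = prod_list (map H js) * (H j * T)"
      by (rule mult_eq_assoc, rule comm, simp)+
    ultimately show ?thesis by simp
  qed simp
  then show ?case
    by (simp add: mult.assoc IH)
qed simp

section \<open>Unit words and their components\<close>

text \<open>The value 0 for x-letters is no block number, so \<open>strand i\<close> ignores them
  for every block \<open>i\<close>.\<close>

fun coordinate :: "gen \<Rightarrow> nat" where
  "coordinate (ga i) = i"
| "coordinate (gb i) = i"
| "coordinate (gx i) = 0"

definition strand :: "nat \<Rightarrow> gen list \<Rightarrow> bool list" where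
  "strand i g = map (\<lambda>l. l = ga i) (filter (\<lambda>l. coordinate l = i) g)"

definition unit_word :: "nat \<Rightarrow> gen list \<Rightarrow> bool" where
  "unit_word k g \<longleftrightarrow> set g \<subseteq> ga ` {1..k} \<union> gb ` {1..k}"

lemma bact_unit: "unit_word k g \<Longrightarrow> bact k g p = Some p"
  by (induction g) (auto simp: unit_word_def bstep_def)

lemma cact_unit: "unit_word k g \<Longrightarrow> cact k m g p c = boolact m (strand p g) c"
  by (induction g arbitrary: c) (auto simp: unit_word_def strand_def bstep_def cstep_def)

text \<open>An interpretation of the letters that satisfies the relations and (\<open>sep\<close>) through which the
  action on partial maps factors.\<close>

locale poi_model =
  fixes k m :: nat and f :: "gen \<Rightarrow> 'a::monoid_mult"
  assumes k2: "2 \<le> k" and m2: "2 \<le> m"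
    and rels: "\<And>u v. (u, v) \<in> relations k m \<Longrightarrow> prod_list (map f u) = prod_list (map f v)"
    and sep: "\<And>u v. u \<in> words k \<Longrightarrow> v \<in> words k \<Longrightarrow>
      prod_list (map f u) = prod_list (map f v) \<Longrightarrow> sem_eq k m u v"
begin

abbreviation ev where "ev w \<equiv> prod_list (map f w)"

lemma gens: "generators k = ga ` {1..k} \<union> gb ` {1..k} \<union> gx ` {..<k}"
proof -
  have "{0..k - 1} = {..<k}" using k2 by auto
  then show ?thesis by (simp add: generators_def)
qed

lemma ev_wpow: "ev (w \<up> n) = ev w ^ n"
  by (induction n) (simp_all add: wpow_def)

lemma rel_W: "(u, v) \<in> rels_W k \<Longrightarrow> ev u = ev v"
  and rel_R: "(u, v) \<in> rels_R k m \<Longrightarrow> ev u = ev v"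
  and rel_R': "(u, v) \<in> rels_R' k \<Longrightarrow> ev u = ev v"
  using rels by (auto simp: relations_def)

text \<open>Since \<open>u j\<close> is x_{k-j}, descending indices of \<open>u\<close> are
  ascending indices of x; this reversal gives the bounds.\<close>

lemma desc_ev: "a \<le> b \<Longrightarrow> b \<le> k + 1 \<Longrightarrow> desc (\<lambda>j. f (gx (k - j))) a b = ev (map gx [k + 1 - b..<k + 1 - a])"
proof (induction b)
  case (Suc b)
  show ?case
  proof (cases "a = Suc b")
    case False
    then have "a \<le> b" using Suc.prems by simp
    have "k + 1 - b = Suc (k - b)" "k + 1 - Suc b = k - b" "k - b < k + 1 - a"
      using Suc.prems \<open>a \<le> b\<close> by auto
    then show ?thesis
      using Suc \<open>a \<le> b\<close> by (simp add: desc_Suc upt_conv_Cons)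
  qed simp
qed simp

lemma W_shift: "1 \<le> i \<Longrightarrow> i \<le> k - 2 \<Longrightarrow> f (gx i) * f (gx 0) = f (gx 0) * f (gx (i + 1))"
proof -
  assume "1 \<le> i" "i \<le> k - 2"
  then have "([gx i, gx 0], [gx 0, gx (i + 1)]) \<in> rels_W k" unfolding rels_W_def by blast
  from rel_W[OF this] show ?thesis by simp
qed

lemma W_far: "1 \<le> i \<Longrightarrow> i + 1 < j \<Longrightarrow> j \<le> k - 1 \<Longrightarrow> f (gx j) * f (gx i) = f (gx i) * f (gx j)"
proof -
  assume "1 \<le> i" "i + 1 < j" "j \<le> k - 1"
  moreover from this have "2 \<le> i + 1" by simp
  ultimately have "([gx j, gx i], [gx i, gx j]) \<in> rels_W k" unfolding rels_W_def by blast
  from rel_W[OF this] show ?thesis by simp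
qed

lemma W_00:
  "f (gx 0) * f (gx 0) * f (gx 1) = f (gx 0) * f (gx 0)"
  "f (gx (k - 1)) * f (gx 0) * f (gx 0) = f (gx 0) * f (gx 0)"
proof -
  have "([gx 0, gx 0, gx 1], [gx 0, gx 0]) \<in> rels_W k"
    "([gx 0, gx 0], [gx (k - 1), gx 0, gx 0]) \<in> rels_W k"
    unfolding rels_W_def by blast+
  from this[THEN rel_W] show "f (gx 0) * f (gx 0) * f (gx 1) = f (gx 0) * f (gx 0)"
    "f (gx (k - 1)) * f (gx 0) * f (gx 0) = f (gx 0) * f (gx 0)"
    by (simp_all add: mult.assoc)
qed

lemma W_braid:
  assumes "1 \<le> i" "i \<le> k - 2"
  shows "f (gx (i + 1)) * f (gx i) * f (gx (i + 1)) = f (gx (i + 1)) * f (gx i)"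
    "f (gx i) * f (gx (i + 1)) * f (gx i) = f (gx (i + 1)) * f (gx i)"
proof -
  have "([gx (i + 1), gx i, gx (i + 1)], [gx (i + 1), gx i]) \<in> rels_W k"
    "([gx (i + 1), gx i], [gx i, gx (i + 1), gx i]) \<in> rels_W k"
    using assms unfolding rels_W_def by blast+
  from this[THEN rel_W] show "f (gx (i + 1)) * f (gx i) * f (gx (i + 1)) = f (gx (i + 1)) * f (gx i)"
    "f (gx i) * f (gx (i + 1)) * f (gx i) = f (gx (i + 1)) * f (gx i)"
    by (simp_all add: mult.assoc)
qed

lemma W_cyc: "i \<le> k - 1 \<Longrightarrow> ev (cyc k i) * f (gx i) = f (gx i)"
proof -
  assume "i \<le> k - 1"
  then have "(cyc k i @ [gx i], [gx i]) \<in> rels_W k" unfolding rels_W_def by blast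
  from rel_W[OF this] show ?thesis by simp
qed

lemma W_cyc': "1 \<le> i \<Longrightarrow> i \<le> k - 1 \<Longrightarrow> ev (cyc' k i) * f (gx i) * f (gx i) = f (gx i) * f (gx i)"
proof -
  assume "1 \<le> i" "i \<le> k - 1"
  then have "(cyc' k i @ [gx i, gx i], [gx i, gx i]) \<in> rels_W k" unfolding rels_W_def by blast
  from rel_W[OF this] show ?thesis by (simp add: mult.assoc)
qed

sublocale poi_relations k "\<lambda>j. f (gx (k - j))" "f (gx 0)"
proof
  let ?u = "\<lambda>j. f (gx (k - j))" and ?x = "f (gx 0)"
  show "2 \<le> k" by (rule k2)
  show "?u j * ?x = ?x * ?u (j - 1)" if "2 \<le> j" "j < k" for j
  proof -
    have "k - (j - 1) = k - j + 1" using that by simp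
    then show ?thesis using W_shift[of "k - j"] that by simp
  qed
  show "?u i * ?u j = ?u j * ?u i" if "1 \<le> i" "i + 2 \<le> j" "j < k" for i j
    using W_far[of "k - j" "k - i"] that by simp
  show "?x * ?x * ?u (k - 1) = ?x * ?x" "?u 1 * ?x * ?x = ?x * ?x"
    using W_00 k2 by simp_all
  have up: "k - j = k - (j + 1) + 1" if "j + 1 < k" for j
    using that by simp
  show "?u j * ?u (j + 1) * ?u j = ?u j * ?u (j + 1)"
    "?u (j + 1) * ?u j * ?u (j + 1) = ?u j * ?u (j + 1)" if "1 \<le> j" "j + 1 < k" for j
    unfolding up[OF that(2)] using that W_braid[of "k - (j + 1)"] by simp_all
  have u0: "[0..<i] = 0 # [1..<i]" if "0 < i" for i
    using that by (simp add: upt_conv_Cons)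
  have "ev (cyc k 0) = ?x * desc ?u 1 k"
    using desc_ev[of 1 k] k2 by (simp add: cyc_def u0)
  then show "?x * desc ?u 1 k * ?x = ?x"
    using W_cyc[of 0] by simp
  fix j assume j: "1 \<le> j" "j < k"
  have 1: "desc ?u 1 (j + 1) = ev (map gx [k - j..<k])"
    and 2: "desc ?u (j + 1) k = ev (map gx [1..<k - j])"
    using desc_ev[of 1 "j + 1"] desc_ev[of "j + 1" k] j by simp_all
  have 3: "desc ?u 1 j = ev (map gx [k - j + 1..<k])"
    using desc_ev[of 1 j] j by (simp add: Suc_diff_le)
  have "ev (cyc k (k - j)) = desc ?u 1 (j + 1) * ?x * desc ?u (j + 1) k"
    unfolding 1 2 using j by (simp add: cyc_def u0 mult.assoc)
  then show "desc ?u 1 (j + 1) * ?x * desc ?u (j + 1) k * ?u j = ?u j"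
    using W_cyc[of "k - j"] j by simp
  have "ev (cyc' k (k - j)) = desc ?u 1 j * ?x * desc ?u (j + 1) k"
    unfolding 2 3 using j by (simp add: cyc'_def u0 mult.assoc)
  then show "desc ?u 1 j * ?x * desc ?u (j + 1) k * ?u j * ?u j = ?u j * ?u j"
    using W_cyc'[of "k - j"] j by simp
qed

lemma xeval_ev: "set w \<subseteq> {..<k} \<Longrightarrow> xeval w = ev (map gx w)"
proof (induction w)
  case (Cons i w)
  then have "xgen i = f (gx i)" by (simp add: xgen_def)
  then show ?case using Cons by (simp add: xeval_def)
qed (simp add: xeval_def)

lemma unit_absorb_x:
  assumes "g \<in> {ga, gb}"
  shows "f (g 1) * f (gx 0) = f (gx 0)"
    and "1 \<le> j \<Longrightarrow> j < k \<Longrightarrow> f (g (j + 1)) * f (gx (k - j)) = f (gx (k - j))"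
    and "i \<le> k - 1 \<Longrightarrow> f (gx i) * f (g (k - i)) = f (gx i)"
proof -
  have "([g 1, gx 0], [gx 0]) \<in> rels_R' k"
    unfolding rels_R'_def by - (rule UN_I[OF assms], blast)
  from rel_R'[OF this] show "f (g 1) * f (gx 0) = f (gx 0)" by simp
next
  assume j: "1 \<le> j" "j < k"
  then have "2 \<le> j + 1" "j + 1 \<le> k" by simp_all
  then have "([g (j + 1), gx (k - (j + 1) + 1)], [gx (k - (j + 1) + 1)]) \<in> rels_R' k"
    unfolding rels_R'_def by - (rule UN_I[OF assms], blast)
  from rel_R'[OF this] show "f (g (j + 1)) * f (gx (k - j)) = f (gx (k - j))"
    using j by (simp add: Suc_diff_Suc)
next
  assume "i \<le> k - 1"
  then have "([gx i, g (k - i)], [gx i]) \<in> rels_R' k"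
    unfolding rels_R'_def by - (rule UN_I[OF assms], blast)
  from rel_R'[OF this] show "f (gx i) * f (g (k - i)) = f (gx i)" by simp
qed

lemma unit_shift_x:
  assumes "g \<in> {ga, gb}"
  shows "1 \<le> i \<Longrightarrow> i \<le> k - 1 \<Longrightarrow> f (gx 0) * f (g i) = f (g (i + 1)) * f (gx 0)"
    and "1 \<le> i \<Longrightarrow> i \<le> k - 1 \<Longrightarrow> f (gx i) * f (g (k - i + 1)) = f (g (k - i)) * f (gx i)"
    and "1 \<le> i \<Longrightarrow> i \<le> k - 1 \<Longrightarrow> 1 \<le> j \<Longrightarrow> j \<le> k \<Longrightarrow> j \<noteq> k - i \<Longrightarrow> j \<noteq> k - i + 1 \<Longrightarrow>
      f (gx i) * f (g j) = f (g j) * f (gx i)"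
proof -
  assume "1 \<le> i" "i \<le> k - 1"
  then have "([gx 0, g i], [g (i + 1), gx 0]) \<in> rels_R' k"
    "([gx i, g (k - i + 1)], [g (k - i), gx i]) \<in> rels_R' k"
    unfolding rels_R'_def by - (rule UN_I[OF assms], blast)+
  from this[THEN rel_R'] show "f (gx 0) * f (g i) = f (g (i + 1)) * f (gx 0)"
    "f (gx i) * f (g (k - i + 1)) = f (g (k - i)) * f (gx i)" by simp_all
next
  assume "1 \<le> i" "i \<le> k - 1" "1 \<le> j" "j \<le> k" "j \<noteq> k - i" "j \<noteq> k - i + 1"
  then have "([gx i, g j], [g j, gx i]) \<in> rels_R' k"
    unfolding rels_R'_def by - (rule UN_I[OF assms], blast)
  from rel_R'[OF this] show "f (gx i) * f (g j) = f (g j) * f (gx i)" by simp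
qed

text \<open>The first letter of \<open>e j\<close> is \<open>u (j - 1)\<close>, or \<open>x\<close>
  for \<open>j = 1\<close>. It drops block \<open>j\<close>, and R' lets it absorb the unit letters
  of that block from the left.\<close>

lemma unit_e:
  assumes g: "g \<in> {ga, gb}" and j: "1 \<le> j" "j \<le> k"
  shows "f (g j) * e j = e j"
proof (cases "j = 1")
  case True
  then show ?thesis
    using unit_absorb_x(1)[OF g] by (simp add: e_def flip: mult.assoc)
next
  case False
  then obtain l where l: "j = Suc l" using j by (cases j) auto
  with False j have "1 \<le> l" "l < k" by auto
  then have "f (g j) * (f (gx (k - l)) * y) = f (gx (k - l)) * y" for y
    using unit_absorb_x(2)[OF g, of l] l by (simp flip: mult.assoc)
  then show ?thesis
    using \<open>1 \<le> l\<close> by (simp add: e_def l desc_Suc mult.assoc)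
qed

text \<open>Block \<open>k - i\<close> is not in the image of x_i, also for \<open>i = 0\<close>, so
  a unit letter there is absorbed. At any other block the letter moves to the block that x_i sends
  there.\<close>

lemma push_letter:
  assumes g: "g \<in> {ga, gb}" and i: "i < k" and j: "1 \<le> j" "j \<le> k"
  shows "f (gx i) * f (g j) = f (gx i) \<or> (\<exists>l\<in>{1..k}. f (gx i) * f (g j) = f (g l) * f (gx i))"
proof (cases "j = k - i")
  case True
  then show ?thesis using unit_absorb_x(3)[OF g, of i] i by simp
next
  case False
  show ?thesis
  proof (cases "i = 0")
    case True
    then have "f (gx i) * f (g j) = f (g (j + 1)) * f (gx i)"
      using unit_shift_x(1)[OF g, of j] j False by simp
    moreover have "j + 1 \<in> {1..k}" using j False True by simp
    ultimately show ?thesis by blast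
  next
    case i0: False
    show ?thesis
    proof (cases "j = k - i + 1")
      case True
      then have "f (gx i) * f (g j) = f (g (k - i)) * f (gx i)"
        using unit_shift_x(2)[OF g, of i] i i0 by simp
      moreover have "k - i \<in> {1..k}" using i by simp
      ultimately show ?thesis by blast
    next
      case j': False
      then have "f (gx i) * f (g j) = f (g j) * f (gx i)"
        using unit_shift_x(3)[OF g, of i j] i i0 j False by simp
      then show ?thesis using j by auto
    qed
  qed
qed

lemma push_word:
  assumes i: "i < k"
  shows "unit_word k g \<Longrightarrow> \<exists>g'. unit_word k g' \<and> f (gx i) * ev g = ev g' * f (gx i)"
proof (induction g)
  case Nil
  then show ?case by (intro exI[of _ "[]"]) simp
next
  case (Cons l g)
  then obtain g' where g': "unit_word k g'" "f (gx i) * ev g = ev g' * f (gx i)"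
    by (auto simp: unit_word_def)
  obtain h j where h: "h \<in> {ga, gb}" "1 \<le> j" "j \<le> k" "l = h j"
    using Cons.prems that[of ga] that[of gb] by (auto simp: unit_word_def)
  from push_letter[OF h(1) i h(2,3)] show ?case
  proof
    assume "f (gx i) * f (h j) = f (gx i)"
    then have "f (gx i) * ev (l # g) = ev g' * f (gx i)"
      using g'(2) h(4) by (simp flip: mult.assoc)
    with g'(1) show ?thesis by blast
  next
    assume "\<exists>r\<in>{1..k}. f (gx i) * f (h j) = f (h r) * f (gx i)"
    then obtain r where r: "r \<in> {1..k}" "f (gx i) * f (h j) = f (h r) * f (gx i)" by blast
    have "f (gx i) * ev (l # g) = f (h r) * (f (gx i) * ev g)"
      using mult_eq_assoc[OF r(2)] h(4) by simp
    then have "f (gx i) * ev (l # g) = ev (h r # g') * f (gx i)"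
      by (simp add: g'(2) mult.assoc)
    moreover have "unit_word k (h r # g')"
      using g'(1) r(1) h(1) by (auto simp: unit_word_def)
    ultimately show ?thesis by blast
  qed
qed

lemma unit_times_x_word:
  "w \<in> words k \<Longrightarrow>
   \<exists>g w'. unit_word k g \<and> set w' \<subseteq> {..<k} \<and> ev w = ev g * ev (map gx w')"
proof (induction w)
  case Nil
  then show ?case by (intro exI[of _ "[]"]) (simp add: unit_word_def)
next
  case (Cons l w)
  then obtain g w' where gw: "unit_word k g" "set w' \<subseteq> {..<k}" "ev w = ev g * ev (map gx w')"
    by auto
  from Cons.prems consider "l \<in> ga ` {1..k} \<union> gb ` {1..k}" | i where "i < k" "l = gx i"
    unfolding gens by auto
  then show ?case
  proof cases
    case 1
    then have "unit_word k (l # g)" using gw(1) by (simp add: unit_word_def)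
    moreover have "ev (l # w) = ev (l # g) * ev (map gx w')"
      by (simp add: gw(3) mult.assoc)
    ultimately show ?thesis using gw(2) by blast
  next
    case 2
    then obtain g' where g': "unit_word k g'" "f (gx i) * ev g = ev g' * f (gx i)"
      using push_word gw(1) by blast
    have "ev (l # w) = f (gx i) * ev g * ev (map gx w')"
      by (simp add: gw(3) 2 mult.assoc)
    then have "ev (l # w) = ev g' * ev (map gx (i # w'))"
      by (simp add: g'(2) mult.assoc)
    moreover have "set (i # w') \<subseteq> {..<k}" using gw(2) 2 by simp
    ultimately show ?thesis using g'(1) by blast
  qed
qed

abbreviation ev_coord where "ev_coord i w \<equiv> prod_list (map (\<lambda>q. if q then f (ga i) else f (gb i)) w)"

lemma ev_coord_coord_letter: "ev_coord i w = ev (map (coord_letter i) w)"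
  by (induction w) (auto simp: coord_letter_def)

lemma coord_letter_lists: "i \<in> {1..k} \<Longrightarrow> map (coord_letter i) w \<in> words k"
  by (auto simp: coord_letter_def generators_def)

lemma letters_commute:
  assumes "i \<in> {1..k}" "j \<in> {1..k}" "i \<noteq> j"
  shows "f (coord_letter i q) * f (coord_letter j r) = f (coord_letter j r) * f (coord_letter i q)"
proof -
  have ab: "f (ga i) * f (gb j) = f (gb j) * f (ga i)" if "i \<in> {1..k}" "j \<in> {1..k}" "i \<noteq> j" for i j
  proof -
    from that have "1 \<le> i" "i \<le> k" "1 \<le> j" "j \<le> k" by simp_all
    with that(3) have "([ga i, gb j], [gb j, ga i]) \<in> rels_R k m" unfolding rels_R_def by blast
    from rel_R[OF this] show ?thesis by simp
  qed
  have less: "f (ga i) * f (ga j) = f (ga j) * f (ga i) \<and> f (gb i) * f (gb j) = f (gb j) * f (gb i)"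
    if "i \<in> {1..k}" "j \<in> {1..k}" "i < j" for i j
  proof -
    from that have "1 \<le> i" "j \<le> k" by simp_all
    with that(3) have "([ga i, ga j], [ga j, ga i]) \<in> rels_R k m" "([gb i, gb j], [gb j, gb i]) \<in> rels_R k m"
      unfolding rels_R_def by blast+
    from this[THEN rel_R] show ?thesis by simp
  qed
  have aa: "f (ga i) * f (ga j) = f (ga j) * f (ga i)" and bb: "f (gb i) * f (gb j) = f (gb j) * f (gb i)"
    using less[of i j] less[of j i] assms by (metis linorder_neqE_nat)+
  note ba = ab[OF assms(2,1) assms(3)[symmetric], symmetric]
  show ?thesis
    by (cases q; cases r; simp only: coord_letter_def if_True if_False; rule aa bb ab[OF assms] ba)
qed

lemma ev_coord_commute:
  assumes "i \<in> {1..k}" "j \<in> {1..k}" "i \<noteq> j"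
  shows "ev_coord i v * ev_coord j w = ev_coord j w * ev_coord i v"
proof -
  have letter: "f (coord_letter i q) * ev_coord j w = ev_coord j w * f (coord_letter i q)" for q
    unfolding ev_coord_coord_letter
  proof (induction w)
    case (Cons r w)
    have "f (coord_letter i q) * ev (map (coord_letter j) (r # w)) = f (coord_letter j r) * (f (coord_letter i q) * ev (map (coord_letter j) w))"
      using mult_eq_assoc[OF letters_commute[OF assms]] by simp
    also have "\<dots> = f (coord_letter j r) * (ev (map (coord_letter j) w) * f (coord_letter i q))"
      by (simp only: Cons)
    finally show ?case by (simp add: mult.assoc)
  qed simp
  show ?thesis
  proof (induction v)
    case (Cons q v)
    have "ev_coord i (q # v) * ev_coord j w = f (coord_letter i q) * (ev_coord i v * ev_coord j w)"
      by (simp add: coord_letter_def mult.assoc)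
    also have "\<dots> = f (coord_letter i q) * ev_coord j w * ev_coord i v"
      by (simp add: Cons mult.assoc)
    also have "\<dots> = ev_coord j w * ev_coord i (q # v)"
      unfolding letter by (simp add: coord_letter_def mult.assoc)
    finally show ?case .
  qed simp
qed

text \<open>Letters of different coordinates commute, so a unit word can be sorted by coordinate,
  with the order inside each coordinate kept.\<close>

lemma ev_unit: "unit_word k g \<Longrightarrow> ev g = prod_list (map (\<lambda>i. ev_coord i (strand i g)) [1..<k + 1])"
proof (induction g)
  case Nil
  have "prod_list (map (\<lambda>i. ev_coord i (strand i [])) is) = 1" for "is"
    by (induction "is") (simp_all add: strand_def)
  then show ?case by simp
next
  case (Cons l g)
  then obtain j q where j: "j \<in> {1..k}" "l = coord_letter j q"
    by (auto simp: unit_word_def coord_letter_def) metis+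
  have str: "strand i (l # g) = (if i = j then q # strand i g else strand i g)" if "1 \<le> i" for i
    using that j by (auto simp: strand_def coord_letter_def)
  let ?F = "\<lambda>g is. prod_list (map (\<lambda>i. ev_coord i (strand i g)) is)"
  have other: "?F (l # g) is = ?F g is" if "j \<notin> set is" "set is \<subseteq> {1..k}" for "is"
    using that by (intro arg_cong[of _ _ prod_list] map_cong) (auto simp: str)
  have "f l * ?F g is = ?F (l # g) is" if "j \<in> set is" "distinct is" "set is \<subseteq> {1..k}" for "is"
    using that
  proof (induction "is")
    case (Cons i "is")
    show ?case
    proof (cases "i = j")
      case True
      have "strand j (l # g) = q # strand j g" using str[of j] j(1) by simp
      then have "ev_coord j (strand j (l # g)) = f l * ev_coord j (strand j g)"
        by (simp add: j(2) coord_letter_def)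
      then show ?thesis
        using Cons.prems other[of "is"] True by (simp add: mult.assoc)
    next
      case False
      have "f l * ev_coord i (strand i g) = ev_coord i (strand i g) * f l"
        using ev_coord_commute[of j i "[q]" "strand i g"] False Cons.prems j
        by (cases q) (simp_all add: coord_letter_def)
      then have "f l * ?F g (i # is) = ev_coord i (strand i g) * (f l * ?F g is)"
        using mult_eq_assoc by simp
      then show ?thesis
        using Cons False by (simp add: str)
    qed
  qed simp
  then have F: "f l * ?F g [1..<k + 1] = ?F (l # g) [1..<k + 1]"
    by this (use j(1) in auto)
  have "ev g = ?F g [1..<k + 1]"
    by (rule Cons.IH) (use Cons.prems in \<open>simp add: unit_word_def\<close>)
  then have "ev (l # g) = f l * ?F g [1..<k + 1]"
    by (simp only: list.map prod_list.Cons)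
  then show ?case
    by (simp only: F)
qed

lemma symmetric_coord:
  assumes i: "i \<in> {1..k}"
  shows "symmetric_relations m (f (ga i)) (f (gb i))"
proof
  have i': "1 \<le> i" "i \<le> k" using i by simp_all
  show "2 \<le> m" by (rule m2)
  have "([ga i] \<up> 2, []) \<in> rels_R k m" "([gb i] \<up> m, []) \<in> rels_R k m"
    "([gb i, ga i] \<up> (m - 1), []) \<in> rels_R k m"
    "(([ga i] @ [gb i] \<up> (m - 1) @ [ga i] @ [gb i]) \<up> 3, []) \<in> rels_R k m"
    using i' unfolding rels_R_def by blast+
  from this[THEN rel_R] show "f (ga i) * f (ga i) = 1" "f (gb i) ^ m = 1"
    "(f (gb i) * f (ga i)) ^ (m - 1) = 1" "(f (ga i) * f (gb i) ^ (m - 1) * f (ga i) * f (gb i)) ^ 3 = 1"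
    by (simp_all add: ev_wpow power2_eq_square mult.assoc)
  show "(f (ga i) * f (gb i) ^ (m - j) * f (ga i) * f (gb i) ^ j)\<^sup>2 = 1" if "2 \<le> j" "j \<le> m - 2" for j
  proof -
    have "(([ga i] @ [gb i] \<up> (m - j) @ [ga i] @ [gb i] \<up> j) \<up> 2, []) \<in> rels_R k m"
      using i' that unfolding rels_R_def by blast
    from rel_R[OF this] show ?thesis by (simp add: ev_wpow mult.assoc)
  qed
  \<comment> \<open>Letters of coordinate \<open>i\<close> never move a block, so the two
    permutations can be compared at the places of block \<open>i\<close>.\<close>
  fix v w c assume "ev_coord i v = ev_coord i w" "c < m"
  then have "sem_eq k m (map (coord_letter i) v) (map (coord_letter i) w)"
    using coord_letter_lists[OF i] by (intro sep) (simp_all add: ev_coord_coord_letter)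
  then have "cact k m (map (coord_letter i) v) i c = cact k m (map (coord_letter i) w) i c"
    using i \<open>c < m\<close> unfolding sem_eq_def bact_coord_letter by blast
  then show "boolact m v c = boolact m w c"
    by (simp add: cact_coord_letter)
qed

text \<open>By \<open>sep\<close> the normal forms induce the same maps as the given words, hence
  equal maps. For a normal form the block map depends on the x-part alone and the places on the
  strands alone.\<close>

lemma complete:
  assumes uv: "u \<in> words k" "v \<in> words k" and sem: "sem_eq k m u v"
  shows "ev u = ev v"
proof -
  obtain g w where gw: "unit_word k g" "set w \<subseteq> {..<k}" "ev u = ev g * ev (map gx w)"
    using unit_times_x_word[OF uv(1)] by blast
  obtain h w' where hw: "unit_word k h" "set w' \<subseteq> {..<k}" "ev v = ev h * ev (map gx w')"
    using unit_times_x_word[OF uv(2)] by blast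
  have lists: "g @ map gx w \<in> words k" if "unit_word k g" "set w \<subseteq> {..<k}" for g w
  proof -
    have "set (g @ map gx w) \<subseteq> generators k"
      using that image_mono[of "set w" "{..<k}" gx] unfolding gens unit_word_def by auto
    then show ?thesis by auto
  qed
  have "sem_eq k m u (g @ map gx w)" "sem_eq k m v (h @ map gx w')"
    by (rule sep[OF uv(1) lists[OF gw(1,2)]], simp add: gw(3))
      (rule sep[OF uv(2) lists[OF hw(1,2)]], simp add: hw(3))
  then have *: "sem_eq k m (g @ map gx w) (h @ map gx w')"
    using sem sem_eq_sym sem_eq_trans by blast
  have b: "bact k (g @ map gx w) p = xact k w p" if "unit_word k g" for g w p
    using that by (simp add: bact_append bact_unit bact_gx)
  have c: "cact k m (g @ map gx w) p c = boolact m (strand p g) c" if "unit_word k g" for g w p c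
    using that by (simp add: cact_append[OF bact_unit] cact_gx cact_unit)
  have xact_eq: "xact k w p = xact k w' p" if "p \<in> {1..k}" for p
    using * that gw hw by (simp add: sem_eq_def b)
  then have "DOM k w = DOM k w'"
    unfolding DOM_def by auto
  moreover have "IMG k w = IMG k w'"
    unfolding IMG_def \<open>DOM k w = DOM k w'\<close>
  proof (rule image_cong[OF refl])
    fix p assume "p \<in> DOM k w'"
    then have "p \<in> {1..k}" using DOM_subset by blast
    then show "the (xact k w p) = the (xact k w' p)" by (simp only: xact_eq)
  qed
  ultimately have T: "ev (map gx w) = ev (map gx w')"
    using xeval_determined[OF gw(2) hw(2)] xeval_ev gw(2) hw(2) by simp
  \<comment> \<open>If the x-part is undefined at block \<open>j\<close>, then it absorbs
    \<open>e j\<close> on its left, and \<open>e j\<close> absorbs the unit letters of block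
    \<open>j\<close>.\<close>
  have absorb: "ev_coord j s * ev (map gx w) = ev (map gx w)" if "j \<in> {1..k}" "j \<notin> DOM k w" for j s
  proof -
    have "restr (DOM k w - {j}) = restr (DOM k w)" using that by simp
    then have "e j * ev (map gx w) = ev (map gx w)"
      using e_restr[OF that(1), of "DOM k w"] restr_DOM_xeval[OF gw(2)] xeval_ev[OF gw(2)]
      by (metis mult.assoc)
    then have "f (coord_letter j q) * ev (map gx w) = ev (map gx w)" for q
      using unit_e[of ga j] unit_e[of gb j] that(1) unfolding coord_letter_def
      by (cases q) (simp_all, (metis mult.assoc)+)
    then show ?thesis
      unfolding ev_coord_coord_letter by (induction s) (simp_all add: mult.assoc)
  qed
  have "prod_list (map (\<lambda>i. ev_coord i (strand i g)) [1..<k + 1]) * ev (map gx w)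
      = prod_list (map (\<lambda>i. ev_coord i (strand i h)) [1..<k + 1]) * ev (map gx w)"
  proof (rule prod_list_replace)
    fix j assume j: "j \<in> set [1..<k + 1]"
    show "ev_coord j (strand j g) = ev_coord j (strand j h) \<or>
      ev_coord j (strand j g) * ev (map gx w) = ev (map gx w) \<and> ev_coord j (strand j h) * ev (map gx w) = ev (map gx w)"
    proof (cases "j \<in> DOM k w")
      case True
      then have "\<forall>c<m. cact k m (g @ map gx w) j c = cact k m (h @ map gx w') j c"
        using * gw(1) by (auto simp: sem_eq_def b DOM_def)
      then have "boolact m (strand j g) c = boolact m (strand j h) c" if "c < m" for c
        using that gw(1) hw(1) by (simp add: c)
      moreover have "j \<in> {1..k}" using j by auto
      ultimately have "ev_coord j (strand j g) = ev_coord j (strand j h)"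
        by (intro symmetric_relations.symmetric_complete[OF symmetric_coord])
      then show ?thesis ..
    next
      case False
      moreover have "j \<in> {1..k}" using j by auto
      ultimately show ?thesis using absorb by blast
    qed
  next
    fix i j assume "i \<in> set [1..<k + 1]" "j \<in> set [1..<k + 1]" "i \<noteq> j"
    then have ij: "i \<in> {1..k}" "j \<in> {1..k}" "i \<noteq> j" by auto
    show "ev_coord i (strand i g) * ev_coord j (strand j h) = ev_coord j (strand j h) * ev_coord i (strand i g) \<and>
      ev_coord i (strand i h) * ev_coord j (strand j h) = ev_coord j (strand j h) * ev_coord i (strand i h)"
      by (intro conjI ev_coord_commute ij)
  qed (rule distinct_upt)
  then have "ev g * ev (map gx w) = ev h * ev (map gx w)"
    by (simp only: ev_unit[OF gw(1)] ev_unit[OF hw(1)])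
  then show ?thesis
    by (simp only: gw(3) hw(3) T)
qed

end

section \<open>Partial maps as wreath data\<close>

text \<open>Closed forms in place of the definite description \<open>block_index\<close>; blocks are
  counted from 1 and places from 0.\<close>

definition block_of :: "nat \<Rightarrow> nat \<Rightarrow> nat" where "block_of m x = (x - 1) div m + 1"
definition offset :: "nat \<Rightarrow> nat \<Rightarrow> nat" where "offset m x = (x - 1) mod m"
definition point :: "nat \<Rightarrow> nat \<Rightarrow> nat \<Rightarrow> nat" where "point m p c = (p - 1) * m + c + 1"

lemma point_block_of [simp]: "1 \<le> p \<Longrightarrow> c < m \<Longrightarrow> block_of m (point m p c) = p"
  and point_offset [simp]: "c < m \<Longrightarrow> offset m (point m p c) = c"
  by (simp_all add: block_of_def offset_def point_def)

lemma point_Omega: "1 \<le> p \<Longrightarrow> p \<le> k \<Longrightarrow> c < m \<Longrightarrow> point m p c \<in> Omega (k * m)"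
proof -
  assume "1 \<le> p" "p \<le> k" "c < m"
  then have "(p - 1) * m + c + 1 \<le> (p - 1) * m + m" by simp
  also have "\<dots> = p * m" using \<open>1 \<le> p\<close> by (cases p) auto
  also have "\<dots> \<le> k * m" using \<open>p \<le> k\<close> by simp
  finally show ?thesis by (simp add: point_def Omega_def)
qed

lemma Omega_cases:
  assumes "x \<in> Omega (k * m)"
  shows "block_of m x \<in> {1..k}" "offset m x < m" "point m (block_of m x) (offset m x) = x"
proof -
  have x: "1 \<le> x" "x \<le> k * m" using assms by (auto simp: Omega_def)
  then have m: "0 < m" by (cases m) auto
  have "x - 1 < k * m" using x by simp
  then have "(x - 1) div m < k" by (simp add: less_mult_imp_div_less)
  then show "block_of m x \<in> {1..k}" by (simp add: block_of_def)
  show "offset m x < m" using m by (simp add: offset_def)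
  show "point m (block_of m x) (offset m x) = x" using x(1) by (simp add: point_def block_of_def offset_def)
qed

lemma block_point: "1 \<le> p \<Longrightarrow> block m p = point m p ` {..<m}"
proof -
  assume "1 \<le> p"
  then obtain q where q: "p = Suc q" by (cases p) auto
  have "y \<in> point m p ` {..<m}" if "y \<in> block m p" for y
  proof -
    have "q * m + 1 \<le> y" "y \<le> q * m + m" using that by (auto simp: block_def q)
    then have "y = point m p (y - q * m - 1)" "y - q * m - 1 < m" by (auto simp: point_def q)
    then show ?thesis by blast
  qed
  then show ?thesis by (auto simp: block_def q point_def)
qed

lemma block_index_point:
  assumes "1 \<le> p" "p \<le> k" "c < m"
  shows "block_index k m (point m p c) = p"
  unfolding block_index_def
proof (rule the_equality)
  show "p \<in> {1..k} \<and> point m p c \<in> block m p"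
    using assms by (auto simp: block_point)
  fix i assume "i \<in> {1..k} \<and> point m p c \<in> block m i"
  then obtain c' where "1 \<le> i" "c' < m" "point m p c = point m i c'"
    by (auto simp: block_point)
  then show "i = p" using assms point_block_of by metis
qed

lemma block_index_block_of: "x \<in> Omega (k * m) \<Longrightarrow> block_index k m x = block_of m x"
  using block_index_point[of "block_of m x" k "offset m x" m] Omega_cases[of x k m] by simp

definition wreath :: "nat \<Rightarrow> nat \<Rightarrow> (nat \<Rightarrow> nat option) \<Rightarrow> (nat \<Rightarrow> nat \<Rightarrow> nat) \<Rightarrow> nat \<rightharpoonup> nat" where
  "wreath k m \<beta> \<sigma> = (\<lambda>x. if x \<in> Omega (k * m)
     then map_option (\<lambda>q. point m q (\<sigma> (block_of m x) (offset m x))) (\<beta> (block_of m x)) else None)"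

text \<open>Strict monotonicity of \<open>\<beta>\<close> combines order preservation with
  injectivity: two blocks cannot share an image block, because one block already fills it.\<close>

definition wreath_data :: "nat \<Rightarrow> nat \<Rightarrow> (nat \<Rightarrow> nat option) \<Rightarrow> (nat \<Rightarrow> nat \<Rightarrow> nat) \<Rightarrow> bool" where
  "wreath_data k m \<beta> \<sigma> \<longleftrightarrow>
     (\<forall>p\<in>{1..k}. \<forall>q. \<beta> p = Some q \<longrightarrow> q \<in> {1..k} \<and> bij_betw (\<sigma> p) {..<m} {..<m}) \<and>
     (\<forall>p\<in>{1..k}. \<forall>p'\<in>{1..k}. \<forall>q q'. p < p' \<and> \<beta> p = Some q \<and> \<beta> p' = Some q' \<longrightarrow> q < q')"

lemma wreath_dataD:
  assumes "wreath_data k m \<beta> \<sigma>" "p \<in> {1..k}" "\<beta> p = Some q"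
  shows "q \<in> {1..k}" "bij_betw (\<sigma> p) {..<m} {..<m}" "c < m \<Longrightarrow> \<sigma> p c < m"
proof -
  show *: "q \<in> {1..k}" "bij_betw (\<sigma> p) {..<m} {..<m}"
    using assms unfolding wreath_data_def by blast+
  show "c < m \<Longrightarrow> \<sigma> p c < m"
    using bij_betwE[OF *(2)] by simp
qed

lemma wreath_data_mono:
  assumes "wreath_data k m \<beta> \<sigma>" "p \<in> {1..k}" "\<beta> p = Some q" "p' \<in> {1..k}" "\<beta> p' = Some q'"
  shows "p < p' \<Longrightarrow> q < q'"
  using assms unfolding wreath_data_def by blast

lemma wreath_point:
  assumes "p \<in> {1..k}" "c < m"
  shows "wreath k m \<beta> \<sigma> (point m p c) = map_option (\<lambda>q. point m q (\<sigma> p c)) (\<beta> p)"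
  using assms point_Omega[of p k c m] by (simp add: wreath_def)

lemma wreath_in_carrier:
  assumes g: "wreath_data k m \<beta> \<sigma>"
  shows "wreath k m \<beta> \<sigma> \<in> POI_carrier k m"
proof -
  let ?\<alpha> = "wreath k m \<beta> \<sigma>"
  have dom_imp: "\<exists>p c q. p \<in> {1..k} \<and> c < m \<and> \<beta> p = Some q \<and> x = point m p c" if "x \<in> dom ?\<alpha>" for x
  proof -
    from that have x: "x \<in> Omega (k * m)" "\<beta> (block_of m x) \<noteq> None"
      by (auto simp: wreath_def dom_def split: if_splits)
    then obtain q where "\<beta> (block_of m x) = Some q" by blast
    then show ?thesis using Omega_cases[OF x(1)] by metis
  qed
  have val: "?\<alpha> (point m p c) = Some (point m q (\<sigma> p c))" if "p \<in> {1..k}" "c < m" "\<beta> p = Some q" for p c q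
    using that by (simp add: wreath_point)
  have idx: "block_index k m (point m p c) = p" if "p \<in> {1..k}" "c < m" for p c
    using that by (intro block_index_point) auto
  have qd: "q \<in> {1..k}" "\<sigma> p c < m" if "p \<in> {1..k}" "c < m" "\<beta> p = Some q" for p c q
    using wreath_dataD[OF g that(1,3)] that(2) by auto
  have "dom ?\<alpha> \<subseteq> Omega (k * m)"
    by (auto simp: wreath_def split: if_splits)
  moreover have "ran ?\<alpha> \<subseteq> Omega (k * m)"
  proof
    fix y assume "y \<in> ran ?\<alpha>"
    then obtain x where x: "?\<alpha> x = Some y" by (auto simp: ran_def)
    then obtain p c q where p: "p \<in> {1..k}" "c < m" "\<beta> p = Some q" "x = point m p c"
      using dom_imp by blast
    then show "y \<in> Omega (k * m)"
      using x val[OF p(1-3)] qd[OF p(1-3)] point_Omega[of q k "\<sigma> p c" m] by auto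
  qed
  moreover have "inj_on ?\<alpha> (dom ?\<alpha>)"
  proof (rule inj_onI)
    fix x y assume "x \<in> dom ?\<alpha>" "y \<in> dom ?\<alpha>" and eq: "?\<alpha> x = ?\<alpha> y"
    then obtain p c q p' c' q' where p: "p \<in> {1..k}" "c < m" "\<beta> p = Some q" "x = point m p c"
      and p': "p' \<in> {1..k}" "c' < m" "\<beta> p' = Some q'" "y = point m p' c'"
      using dom_imp by meson
    have e: "point m q (\<sigma> p c) = point m q' (\<sigma> p' c')"
      using eq val[OF p(1-3)] val[OF p'(1-3)] p(4) p'(4) by simp
    have qq: "q = q'"
      using arg_cong[OF e, of "block_of m"] qd[OF p(1-3)] qd[OF p'(1-3)] by simp
    have ss: "\<sigma> p c = \<sigma> p' c'"
      using arg_cong[OF e, of "offset m"] qd[OF p(1-3)] qd[OF p'(1-3)] by simp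
    have "p = p'"
      using wreath_data_mono[OF g p(1,3) p'(1,3)] wreath_data_mono[OF g p'(1,3) p(1,3)] qq
      by (metis less_irrefl linorder_neqE_nat)
    moreover from this have "c = c'"
      using ss wreath_dataD(2)[OF g p(1,3)] p(2) p'(2) by (auto simp: bij_betw_def inj_on_def)
    ultimately show "x = y" using p p' by simp
  qed
  moreover have "block m (block_index k m x) \<subseteq> dom ?\<alpha> \<and>
    (\<lambda>y. the (?\<alpha> y)) ` block m (block_index k m x) = block m (block_index k m (the (?\<alpha> x)))"
    if x: "x \<in> dom ?\<alpha>" for x
  proof -
    obtain p c q where p: "p \<in> {1..k}" "c < m" "\<beta> p = Some q" "x = point m p c"
      using dom_imp[OF x] by blast
    have 1: "block_index k m x = p" using idx p by simp
    have 2: "block_index k m (the (?\<alpha> x)) = q"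
      using val[OF p(1-3)] p(4) idx[OF qd[OF p(1-3)]] by simp
    have "(\<lambda>y. the (?\<alpha> y)) ` point m p ` {..<m} = point m q ` \<sigma> p ` {..<m}"
      unfolding image_image using val[OF p(1) _ p(3)] by (intro image_cong) auto
    also have "\<sigma> p ` {..<m} = {..<m}"
      using wreath_dataD(2)[OF g p(1,3)] by (simp add: bij_betw_def)
    finally have "(\<lambda>y. the (?\<alpha> y)) ` block m p = block m q"
      using p(1) qd[OF p(1-3)] by (simp add: block_point)
    moreover have "block m p \<subseteq> dom ?\<alpha>"
      using p(1) val[OF p(1) _ p(3)] by (auto simp: block_point)
    ultimately show ?thesis by (simp add: 1 2)
  qed
  moreover have "block_index k m (the (?\<alpha> x)) \<le> block_index k m (the (?\<alpha> y))"
    if x: "x \<in> dom ?\<alpha>" and y: "y \<in> dom ?\<alpha>" and le: "block_index k m x \<le> block_index k m y" for x y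
  proof -
    obtain p c q where p: "p \<in> {1..k}" "c < m" "\<beta> p = Some q" "x = point m p c"
      using dom_imp[OF x] by blast
    obtain p' c' q' where p': "p' \<in> {1..k}" "c' < m" "\<beta> p' = Some q'" "y = point m p' c'"
      using dom_imp[OF y] by blast
    have "p \<le> p'" using le idx p p' by simp
    then have "q \<le> q'"
      using wreath_data_mono[OF g p(1,3) p'(1,3)] p(3) p'(3) by (cases "p = p'") auto
    then show ?thesis
      using val[OF p(1-3)] val[OF p'(1-3)] p(4) p'(4) idx[OF qd[OF p(1-3)]] idx[OF qd[OF p'(1-3)]]
      by simp
  qed
  ultimately show ?thesis
    unfolding POI_carrier_def by blast
qed

lemma carrier_is_wreath:
  assumes m: "1 \<le> m" and \<alpha>: "\<alpha> \<in> POI_carrier k m"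
  shows "\<exists>\<beta> \<sigma>. wreath_data k m \<beta> \<sigma> \<and> \<alpha> = wreath k m \<beta> \<sigma>"
proof -
  have dom: "dom \<alpha> \<subseteq> Omega (k * m)" and ran: "ran \<alpha> \<subseteq> Omega (k * m)" and inj: "inj_on \<alpha> (dom \<alpha>)"
    and stab: "\<And>x. x \<in> dom \<alpha> \<Longrightarrow> block m (block_index k m x) \<subseteq> dom \<alpha>"
      "\<And>x. x \<in> dom \<alpha> \<Longrightarrow> (\<lambda>y. the (\<alpha> y)) ` block m (block_index k m x) = block m (block_index k m (the (\<alpha> x)))"
    and ord: "\<And>x y. x \<in> dom \<alpha> \<Longrightarrow> y \<in> dom \<alpha> \<Longrightarrow> block_index k m x \<le> block_index k m y \<Longrightarrow>
      block_index k m (the (\<alpha> x)) \<le> block_index k m (the (\<alpha> y))"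
    using \<alpha> unfolding POI_carrier_def by blast+
  have idx: "block_index k m (point m p c) = p" if "p \<in> {1..k}" "c < m" for p c
    using that by (intro block_index_point) auto
  define \<beta> where "\<beta> p = map_option (block_of m) (\<alpha> (point m p 0))" for p
  define \<sigma> where "\<sigma> p c = offset m (the (\<alpha> (point m p c)))" for p c
  have Om: "the (\<alpha> x) \<in> Omega (k * m)" if "x \<in> dom \<alpha>" for x
    using that ran by (auto simp: ran_def)
  have bidx: "block_index k m (the (\<alpha> x)) = block_of m (the (\<alpha> x))" if "x \<in> dom \<alpha>" for x
    using Om[OF that] by (rule block_index_block_of)
  have blk: "point m p c' \<in> dom \<alpha>" if "point m p c \<in> dom \<alpha>" "p \<in> {1..k}" "c < m" "c' < m" for p c c'
    using stab(1)[OF that(1)] that by (auto simp: idx block_point)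
  \<comment> \<open>Points of one block have block numbers that are \<open>\<le>\<close> each other
    in both directions, so order preservation gives equal image blocks.\<close>
  have same: "block_of m (the (\<alpha> (point m p c))) = block_of m (the (\<alpha> (point m p c')))"
    if "point m p c \<in> dom \<alpha>" "p \<in> {1..k}" "c < m" "c' < m" for p c c'
  proof -
    note d' = blk[OF that]
    show ?thesis
      using ord[OF that(1) d'] ord[OF d' that(1)] that by (simp add: idx bidx d')
  qed
  have val: "\<alpha> (point m p c) = map_option (\<lambda>q. point m q (\<sigma> p c)) (\<beta> p)" if p: "p \<in> {1..k}" "c < m" for p c
  proof (cases "point m p c \<in> dom \<alpha>")
    case True
    then obtain y where y: "\<alpha> (point m p c) = Some y" by blast
    have "point m p 0 \<in> dom \<alpha>" using blk[OF True p] m by simp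
    then obtain z where z: "\<alpha> (point m p 0) = Some z" by blast
    have "block_of m z = block_of m y" using same[OF True p, of 0] m y z by simp
    moreover have "point m (block_of m y) (offset m y) = y"
      using Omega_cases(3)[of y k m] Om[OF True] y by simp
    ultimately show ?thesis using y z by (simp add: \<beta>_def \<sigma>_def)
  next
    case False
    then have "point m p 0 \<notin> dom \<alpha>" using blk[of p 0 c] p m by auto
    with False show ?thesis by (auto simp: \<beta>_def dom_def)
  qed
  have "\<alpha> = wreath k m \<beta> \<sigma>"
  proof
    fix x
    show "\<alpha> x = wreath k m \<beta> \<sigma> x"
    proof (cases "x \<in> Omega (k * m)")
      case True
      then show ?thesis
        using val[OF Omega_cases(1,2)[OF True]] Omega_cases(3)[OF True] by (simp add: wreath_def)
    next
      case False
      then show ?thesis using dom by (auto simp: wreath_def dom_def)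
    qed
  qed
  moreover have "wreath_data k m \<beta> \<sigma>"
  proof -
    have in_dom: "point m p c \<in> dom \<alpha>" if "p \<in> {1..k}" "\<beta> p = Some q" "c < m" for p q c
      using val[OF that(1,3)] that(2) by auto
    have q: "q \<in> {1..k} \<and> bij_betw (\<sigma> p) {..<m} {..<m}" if p: "p \<in> {1..k}" "\<beta> p = Some q" for p q
    proof
      have d0: "point m p 0 \<in> dom \<alpha>" using in_dom[OF p, of 0] m by simp
      have "q = block_of m (the (\<alpha> (point m p 0)))" using p(2) d0 by (auto simp: \<beta>_def)
      then show qk: "q \<in> {1..k}" using Omega_cases(1)[OF Om[OF d0]] by simp
      have maps: "\<sigma> p c < m" if "c < m" for c
        using Omega_cases(2)[OF Om[OF in_dom[OF p that]]] by (simp add: \<sigma>_def)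
      moreover have "inj_on (\<sigma> p) {..<m}"
      proof (rule inj_onI)
        fix c c' assume c: "c \<in> {..<m}" "c' \<in> {..<m}" and "\<sigma> p c = \<sigma> p c'"
        then have "\<alpha> (point m p c) = \<alpha> (point m p c')"
          using val[OF p(1)] by simp
        then have "point m p c = point m p c'"
          using inj in_dom[OF p] c by (auto simp: inj_on_def)
        then show "c = c'" by (simp add: point_def)
      qed
      moreover have "\<sigma> p ` {..<m} = {..<m}"
        using maps calculation(2) by (intro endo_inj_surj) auto
      ultimately show "bij_betw (\<sigma> p) {..<m} {..<m}" by (simp add: bij_betw_def)
    qed
    moreover have "q < q'"
      if p: "p \<in> {1..k}" "\<beta> p = Some q" and p': "p' \<in> {1..k}" "\<beta> p' = Some q'" and less: "p < p'" for p p' q q'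
    proof -
      have d: "point m p 0 \<in> dom \<alpha>" "point m p' 0 \<in> dom \<alpha>" using in_dom p p' m by auto
      have b: "q = block_of m (the (\<alpha> (point m p 0)))" "q' = block_of m (the (\<alpha> (point m p' 0)))"
        using p(2) p'(2) d by (auto simp: \<beta>_def)
      have le: "q \<le> q'"
        using ord[OF d] less p(1) p'(1) m unfolding b by (simp add: idx bidx d)
      \<comment> \<open>If the image blocks coincided, the point hit by place 0 of \<open>p'\<close>
        would also be hit from block \<open>p\<close>, against injectivity.\<close>
      have "q \<noteq> q'"
      proof
        assume "q = q'"
        have "bij_betw (\<sigma> p) {..<m} {..<m}" "bij_betw (\<sigma> p') {..<m} {..<m}"
          using q p p' by blast+
        then have "\<sigma> p' 0 \<in> \<sigma> p ` {..<m}"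
          using m by (auto simp: bij_betw_def)
        then obtain c where c: "c < m" "\<sigma> p c = \<sigma> p' 0" by auto
        then have "\<alpha> (point m p c) = \<alpha> (point m p' 0)"
          using val[OF p(1) c(1)] val[OF p'(1), of 0] p(2) p'(2) m \<open>q = q'\<close> by simp
        then have "point m p c = point m p' 0"
          using inj in_dom[OF p c(1)] d(2) by (auto simp: inj_on_def)
        moreover have "block_of m (point m p c) = p" "block_of m (point m p' 0) = p'"
          using p(1) p'(1) c(1) m by simp_all
        ultimately have "p = p'" by simp
        with less show False by simp
      qed
      with le show ?thesis by simp
    qed
    ultimately show ?thesis unfolding wreath_data_def by blast
  qed
  ultimately show ?thesis by blast
qed

section \<open>Partial maps induced by words\<close>

lemma bstep_mono:
  "2 \<le> k \<Longrightarrow> p < p' \<Longrightarrow> bstep k g p = Some q \<Longrightarrow> bstep k g p' = Some q' \<Longrightarrow> q < q'"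
  by (auto simp: bstep_def xstep_def split: gen.splits if_splits)

lemma bact_mono:
  "2 \<le> k \<Longrightarrow> p < p' \<Longrightarrow> bact k w p = Some q \<Longrightarrow> bact k w p' = Some q' \<Longrightarrow> q < q'"
proof (induction w arbitrary: p p')
  case (Cons g w)
  from Cons.prems obtain r r' where "bstep k g p = Some r" "bact k w r = Some q"
    "bstep k g p' = Some r'" "bact k w r' = Some q'"
    by (auto simp: bind_eq_Some_conv)
  then show ?case using Cons.IH[of r r'] bstep_mono[of k p p' g r r'] Cons.prems by blast
qed simp

lemma bij_cstep: "2 \<le> m \<Longrightarrow> bij_betw (cstep m g p) {..<m} {..<m}"
proof -
  assume m: "2 \<le> m"
  have "cstep m g p = id \<or> cstep m g p = aswap 0 \<or> cstep m g p = (\<lambda>c. (c + 1) mod m)"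
    by (cases g) (auto simp: cstep_def fun_eq_iff)
  moreover have "inj_on (aswap 0) {..<m}"
    by (rule inj_on_inverseI[of _ "aswap 0"]) simp
  moreover have "inj_on (\<lambda>c. (c + 1) mod m) {..<m}"
    by (auto simp: inj_on_def mod_Suc split: if_splits)
  ultimately have inj: "inj_on (cstep m g p) {..<m}"
    by (metis inj_on_id)
  have "cstep m g p ` {..<m} = {..<m}"
    using inj cstep_less[OF m] by (intro endo_inj_surj) auto
  with inj show ?thesis by (simp add: bij_betw_def)
qed

lemma bij_cact: "2 \<le> m \<Longrightarrow> bij_betw (cact k m w p) {..<m} {..<m}"
proof (induction w arbitrary: p)
  case Nil
  have "cact k m [] p = id" by auto
  then show ?case by (simp only: bij_betw_id)
next
  case (Cons g w)
  have "cact k m (g # w) p = cact k m w (the (bstep k g p)) \<circ> cstep m g p" by auto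
  then show ?case using Cons bij_cstep bij_betw_trans by metis
qed

lemma wreath_data_word:
  assumes "2 \<le> k" "2 \<le> m" "w \<in> words k"
  shows "wreath_data k m (bact k w) (cact k m w)"
  unfolding wreath_data_def using bact_range[OF assms(1,3)] bij_cact[OF assms(2)] bact_mono[OF assms(1)] by blast

definition pmap :: "nat \<Rightarrow> nat \<Rightarrow> gen list \<Rightarrow> nat \<rightharpoonup> nat" where
  "pmap k m w = wreath k m (bact k w) (cact k m w)"

lemma wreath_eq_iff:
  assumes m: "1 \<le> m" and g: "wreath_data k m \<beta> \<sigma>" "wreath_data k m \<beta>' \<sigma>'"
  shows "wreath k m \<beta> \<sigma> = wreath k m \<beta>' \<sigma>' \<longleftrightarrow>
    (\<forall>p\<in>{1..k}. \<beta> p = \<beta>' p \<and> (\<beta> p \<noteq> None \<longrightarrow> (\<forall>c<m. \<sigma> p c = \<sigma>' p c)))"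
proof
  assume eq: "wreath k m \<beta> \<sigma> = wreath k m \<beta>' \<sigma>'"
  show "\<forall>p\<in>{1..k}. \<beta> p = \<beta>' p \<and> (\<beta> p \<noteq> None \<longrightarrow> (\<forall>c<m. \<sigma> p c = \<sigma>' p c))"
  proof
    fix p assume p: "p \<in> {1..k}"
    have *: "map_option (\<lambda>q. point m q (\<sigma> p c)) (\<beta> p) = map_option (\<lambda>q. point m q (\<sigma>' p c)) (\<beta>' p)"
      if "c < m" for c
      using fun_cong[OF eq, of "point m p c"] wreath_point[OF p that] by simp
    show "\<beta> p = \<beta>' p \<and> (\<beta> p \<noteq> None \<longrightarrow> (\<forall>c<m. \<sigma> p c = \<sigma>' p c))"
    proof (cases "\<beta> p")
      case None
      then show ?thesis using *[of 0] m by simp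
    next
      case (Some q)
      then obtain q' where q': "\<beta>' p = Some q'" using *[of 0] m by (cases "\<beta>' p") auto
      have e: "point m q (\<sigma> p c) = point m q' (\<sigma>' p c)" if "c < m" for c
        using *[OF that] Some q' by simp
      have lt: "\<sigma> p c < m" "\<sigma>' p c < m" if "c < m" for c
        using wreath_dataD(3)[OF g(1) p Some that] wreath_dataD(3)[OF g(2) p q' that] by auto
      have "1 \<le> q" "1 \<le> q'" using wreath_dataD(1)[OF g(1) p Some] wreath_dataD(1)[OF g(2) p q'] by auto
      then have "q = q'"
        using arg_cong[OF e, of 0 "block_of m"] lt[of 0] m by simp
      moreover have "\<sigma> p c = \<sigma>' p c" if "c < m" for c
        using arg_cong[OF e[OF that], of "offset m"] lt[OF that] by simp
      ultimately show ?thesis using Some q' by simp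
    qed
  qed
next
  assume *: "\<forall>p\<in>{1..k}. \<beta> p = \<beta>' p \<and> (\<beta> p \<noteq> None \<longrightarrow> (\<forall>c<m. \<sigma> p c = \<sigma>' p c))"
  show "wreath k m \<beta> \<sigma> = wreath k m \<beta>' \<sigma>'"
  proof
    fix x
    show "wreath k m \<beta> \<sigma> x = wreath k m \<beta>' \<sigma>' x"
    proof (cases "x \<in> Omega (k * m)")
      case True
      have "\<beta> (block_of m x) = \<beta>' (block_of m x) \<and>
          (\<beta> (block_of m x) \<noteq> None \<longrightarrow> \<sigma> (block_of m x) (offset m x) = \<sigma>' (block_of m x) (offset m x))"
        using * Omega_cases(1,2)[OF True] by blast
      then show ?thesis
        by (cases "\<beta> (block_of m x)") (auto simp: wreath_def)
    qed (simp add: wreath_def)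
  qed
qed

lemma pmap_eq_iff:
  assumes "2 \<le> k" "2 \<le> m" "u \<in> words k" "v \<in> words k"
  shows "pmap k m u = pmap k m v \<longleftrightarrow> sem_eq k m u v"
  unfolding pmap_def sem_eq_def using assms by (intro wreath_eq_iff wreath_data_word) auto

lemma pmap_append:
  assumes "2 \<le> k" "2 \<le> m" "u \<in> words k"
  shows "pmap k m (u @ v) = pmap k m v \<circ>\<^sub>m pmap k m u"
proof
  fix x
  show "pmap k m (u @ v) x = (pmap k m v \<circ>\<^sub>m pmap k m u) x"
  proof (cases "x \<in> Omega (k * m)")
    case True
    define p c where "p = block_of m x" and "c = offset m x"
    have p: "p \<in> {1..k}" "c < m" "x = point m p c"
      using Omega_cases[OF True] by (simp_all add: p_def c_def)
    show ?thesis
    proof (cases "bact k u p")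
      case None
      then show ?thesis
        unfolding p(3) pmap_def map_comp_def wreath_point[OF p(1,2)] by (simp add: bact_append)
    next
      case (Some q)
      have q: "q \<in> {1..k}" "cact k m u p c < m"
        using bact_range[OF assms(1,3) p(1) Some] cact_less[OF assms(2) p(2)] by auto
      show ?thesis
        unfolding p(3) pmap_def map_comp_def wreath_point[OF p(1,2)]
        using wreath_point[OF q] Some by (simp add: bact_append cact_append)
    qed
  qed (simp add: pmap_def wreath_def map_comp_def)
qed

section \<open>Every partial map is induced by a word\<close>

lemma res_word:
  assumes "2 \<le> k" "C \<subseteq> {1..k}"
  shows "\<exists>w. set w \<subseteq> {..<k} \<and> (\<forall>p\<in>{1..k}. xact k w p = (if p \<in> C then None else Some p))"
proof -
  have "finite C" using assms(2) finite_subset by blast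
  then show ?thesis
    using assms(2)
  proof (induction C rule: finite_induct)
    case empty
    then show ?case by (intro exI[of _ "[]"]) simp
  next
    case (insert j C)
    then obtain w where w: "set w \<subseteq> {..<k}" "\<forall>p\<in>{1..k}. xact k w p = (if p \<in> C then None else Some p)"
      by auto
    have "\<exists>v. set v \<subseteq> {..<k} \<and> (\<forall>p\<in>{1..k}. xact k v p = (if p = j then None else Some p))"
    proof (cases "j = 1")
      case True
      then show ?thesis using xact_cyc0[OF assms(1)] by (intro exI[of _ "[0..<k]"]) auto
    next
      case False
      \<comment> \<open>The word that removes block \<open>j\<close> is
        \<open>cyc k (k + 1 - j)\<close>; for \<open>j = 1\<close> the index \<open>k\<close> wraps
        around to 0.\<close>
      then have j: "1 \<le> k + 1 - j" "k + 1 - j < k" "k - (k + 1 - j) + 1 = j" using insert.prems by auto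
      then show ?thesis using xact_cyc[OF j(1,2)] 
        by (intro exI[of _ "[k + 1 - j..<k] @ [0..<k + 1 - j]"]) auto
    qed
    then obtain v where v: "set v \<subseteq> {..<k}" "\<forall>p\<in>{1..k}. xact k v p = (if p = j then None else Some p)"
      by blast
    have "\<forall>p\<in>{1..k}. xact k (v @ w) p = (if p \<in> insert j C then None else Some p)"
      using v(2) w(2) by (simp add: xact_append)
    moreover have "set (v @ w) \<subseteq> {..<k}" using v(1) w(1) by simp
    ultimately show ?case by blast
  qed
qed

lemma res_word_DOM:
  assumes "2 \<le> k" "A \<subseteq> {1..k}"
  shows "\<exists>w. set w \<subseteq> {..<k} \<and> DOM k w = A \<and> IMG k w = A"
proof -
  obtain w where w: "set w \<subseteq> {..<k}" "\<forall>p\<in>{1..k}. xact k w p = (if p \<in> {1..k} - A then None else Some p)"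
    using res_word[OF assms(1), of "{1..k} - A"] by blast
  then have D: "DOM k w = A" using assms(2) by (auto simp: DOM_def split: if_splits)
  moreover have "IMG k w = (\<lambda>p. p) ` A"
    unfolding IMG_def D using w(2) assms(2) by (intro image_cong) (auto split: if_splits)
  ultimately show ?thesis using w(1) by auto
qed

text \<open>The two words are those of \<open>u i\<close> and of its inverse
  \<open>d i\<close>.\<close>

lemma up_down_words:
  assumes k: "2 \<le> k" and A: "A \<subseteq> {1..k}" and i: "1 \<le> i" "i \<notin> A" "i + 1 \<in> A"
  defines "A0 \<equiv> insert i (A - {i + 1})"
  shows "\<exists>u. set u \<subseteq> {..<k} \<and> A0 \<subseteq> DOM k u \<and> (\<lambda>p. the (xact k u p)) ` A0 = A"
    and "\<exists>v. set v \<subseteq> {..<k} \<and> A \<subseteq> DOM k v \<and> (\<lambda>p. the (xact k v p)) ` A = A0"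
proof -
  have ik: "i < k" using i(3) A by auto
  have s: "1 \<le> k - i" "k - i < k" "k - (k - i) = i" using ik i by auto
  have u: "xact k [k - i] p = (if p = i then Some (i + 1) else if p = i + 1 then None else Some p)" for p
    using s by (simp add: xstep_def split: bind_splits)
  have "(\<lambda>p. the (xact k [k - i] p)) ` A0 = A"
    unfolding u A0_def using i by (auto simp: image_iff split: if_splits)
  moreover have "A0 \<subseteq> DOM k [k - i]"
    using A i ik by (auto simp: A0_def DOM_def u simp del: xact.simps)
  moreover have "set [k - i] \<subseteq> {..<k}" using s by simp
  ultimately show "\<exists>u. set u \<subseteq> {..<k} \<and> A0 \<subseteq> DOM k u \<and> (\<lambda>p. the (xact k u p)) ` A0 = A"
    by blast
  define vw where "vw = [k - i + 1..<k] @ [0..<k - i]"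
  have v: "xact k vw p = (if p = i then None else if p = i + 1 then Some i else Some p)" if "p \<in> {1..k}" for p
    using xact_cyc'[OF s(1,2), of p] that s(3) by (simp add: vw_def)
  have "(\<lambda>p. the (xact k vw p)) ` A = (\<lambda>p. if p = i + 1 then i else p) ` A"
    using A by (intro image_cong refl) (use i in \<open>auto simp: v subset_eq\<close>)
  also have "\<dots> = A0"
    unfolding A0_def using i by (auto simp: image_iff split: if_splits)
  finally have "(\<lambda>p. the (xact k vw p)) ` A = A0" .
  moreover have "A \<subseteq> DOM k vw"
    using A i by (auto simp: DOM_def v)
  moreover have "set vw \<subseteq> {..<k}" using ik by (auto simp: vw_def)
  ultimately show "\<exists>v. set v \<subseteq> {..<k} \<and> A \<subseteq> DOM k v \<and> (\<lambda>p. the (xact k v p)) ` A = A0"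
    by blast
qed

lemma DOM_IMG_append:
  assumes "set v \<subseteq> {..<k}" "IMG k v \<subseteq> DOM k w"
  shows "DOM k (v @ w) = DOM k v" "IMG k (v @ w) = (\<lambda>p. the (xact k w p)) ` IMG k v"
proof -
  have ex: "\<exists>q. xact k v p = Some q \<and> xact k w q \<noteq> None" if "p \<in> DOM k v" for p
  proof -
    from that obtain q where q: "xact k v p = Some q" by (auto simp: DOM_def)
    then have "q \<in> IMG k v" using that unfolding IMG_def by force
    with assms(2) q show ?thesis unfolding DOM_def by blast
  qed
  show D: "DOM k (v @ w) = DOM k v"
  proof
    show "DOM k (v @ w) \<subseteq> DOM k v"
      by (auto simp: DOM_def xact_append bind_eq_Some_conv)
    show "DOM k v \<subseteq> DOM k (v @ w)"
    proof
      fix p assume p: "p \<in> DOM k v"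
      with ex[OF p] show "p \<in> DOM k (v @ w)" by (auto simp: DOM_def xact_append)
    qed
  qed
  show "IMG k (v @ w) = (\<lambda>p. the (xact k w p)) ` IMG k v"
    unfolding IMG_def D image_image
  proof (rule image_cong[OF refl])
    fix p assume p: "p \<in> DOM k v"
    from ex[OF p] obtain q where "xact k v p = Some q" by blast
    then show "the (xact k (v @ w) p) = the (xact k w (the (xact k v p)))"
      by (simp only: xact_append bind.simps option.sel)
  qed
qed

lemma initial_words:
  assumes k: "2 \<le> k" and "A \<subseteq> {1..k}"
  shows "\<exists>w. set w \<subseteq> {..<k} \<and> DOM k w = A \<and> IMG k w = {1..card A}"
    and "\<exists>w. set w \<subseteq> {..<k} \<and> DOM k w = {1..card A} \<and> IMG k w = A"
proof -
  have "(\<exists>w. set w \<subseteq> {..<k} \<and> DOM k w = A \<and> IMG k w = {1..card A}) \<and>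
    (\<exists>w. set w \<subseteq> {..<k} \<and> DOM k w = {1..card A} \<and> IMG k w = A)"
    using assms(2)
  proof (induction rule: gap_induct)
    case (initial r)
    then show ?case using res_word_DOM[OF k initial] by simp
  next
    case (gap A i)
    note i = gap(2,4,5)
    define A0 where "A0 = insert i (A - {i + 1})"
    obtain w0 w1 where
      w0: "set w0 \<subseteq> {..<k}" "DOM k w0 = A0" "IMG k w0 = {1..card A0}" and
      w1: "set w1 \<subseteq> {..<k}" "DOM k w1 = {1..card A0}" "IMG k w1 = A0"
      using gap(6) unfolding A0_def by blast
    have card: "card A0 = card A"
      using i finite_subset[OF gap(1)] card_Suc_Diff1[of A "i + 1"] by (simp add: A0_def)
    obtain u where u: "set u \<subseteq> {..<k}" "A0 \<subseteq> DOM k u" "(\<lambda>p. the (xact k u p)) ` A0 = A"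
      using up_down_words(1)[OF k gap(1) i] unfolding A0_def by blast
    obtain v where v: "set v \<subseteq> {..<k}" "A \<subseteq> DOM k v" "(\<lambda>p. the (xact k v p)) ` A = A0"
      using up_down_words(2)[OF k gap(1) i] unfolding A0_def by blast
    obtain r where r: "set r \<subseteq> {..<k}" "DOM k r = A" "IMG k r = A"
      using res_word_DOM[OF k gap(1)] by blast
    \<comment> \<open>The word \<open>v\<close> may be defined outside \<open>A\<close>; the
      preceding \<open>r\<close> cuts the domain down to \<open>A\<close>.\<close>
    have rv: "DOM k (r @ v) = A" "IMG k (r @ v) = A0" "set (r @ v) \<subseteq> {..<k}"
      using DOM_IMG_append[of r k v] r v by simp_all
    have d: "DOM k ((r @ v) @ w0) = A"
      using DOM_IMG_append(1)[of "r @ v" k w0] rv w0 by simp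
    have "IMG k ((r @ v) @ w0) = (\<lambda>p. the (xact k w0 p)) ` A0"
      using DOM_IMG_append(2)[of "r @ v" k w0] rv w0 by simp
    also have "\<dots> = {1..card A}"
      using w0(2,3) card by (simp only: IMG_def)
    finally have down: "\<exists>w. set w \<subseteq> {..<k} \<and> DOM k w = A \<and> IMG k w = {1..card A}"
      using d rv(3) w0(1) by (intro exI[of _ "(r @ v) @ w0"]) simp
    have "DOM k (w1 @ u) = {1..card A}" "IMG k (w1 @ u) = A"
      using DOM_IMG_append[of w1 k u] w1 u card by simp_all
    then have "\<exists>w. set w \<subseteq> {..<k} \<and> DOM k w = {1..card A} \<and> IMG k w = A"
      using w1(1) u(1) by (intro exI[of _ "w1 @ u"]) simp
    with down show ?case by blast
  qed
  then show "\<exists>w. set w \<subseteq> {..<k} \<and> DOM k w = A \<and> IMG k w = {1..card A}"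
    "\<exists>w. set w \<subseteq> {..<k} \<and> DOM k w = {1..card A} \<and> IMG k w = A" by blast+
qed

text \<open>A strictly increasing map turns the increasing list of \<open>A\<close> into the
  increasing list of its image.\<close>

lemma strict_mono_on_determined:
  fixes f g :: "nat \<Rightarrow> nat"
  assumes "finite A" "strict_mono_on A f" "strict_mono_on A g" "f ` A = g ` A" "a \<in> A"
  shows "f a = g a"
proof -
  have "sorted_list_of_set (h ` A) = map h (sorted_list_of_set A)" if "strict_mono_on A h" for h :: "nat \<Rightarrow> nat"
  proof -
    have "sorted_wrt (<) (map h (sorted_list_of_set A))"
      unfolding sorted_wrt_map
    proof (rule sorted_wrt_mono_rel[of "sorted_list_of_set A" "(<)"])
      fix x y assume "x \<in> set (sorted_list_of_set A)" "y \<in> set (sorted_list_of_set A)" "x < y"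
      then show "h x < h y" using that assms(1) by (simp add: strict_mono_on_def)
    qed (rule strict_sorted_list_of_set)
    from sorted_wrt_eq_sorted_list_of_set[OF this] show ?thesis using assms(1) by simp
  qed
  then have "map f (sorted_list_of_set A) = map g (sorted_list_of_set A)"
    using assms(2-4) by metis
  then show ?thesis using assms(1,5) by simp
qed

text \<open>The map is factored through the initial segment of the same size. A word with the right
  domain and image is then the right map, because both are strictly increasing.\<close>

lemma partial_order_word:
  assumes k: "2 \<le> k" and range: "\<And>p q. p \<in> {1..k} \<Longrightarrow> \<beta> p = Some q \<Longrightarrow> q \<in> {1..k}"
    and mono: "\<And>p p' q q'. p \<in> {1..k} \<Longrightarrow> p' \<in> {1..k} \<Longrightarrow> p < p' \<Longrightarrow>
      \<beta> p = Some q \<Longrightarrow> \<beta> p' = Some q' \<Longrightarrow> q < q'"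
  shows "\<exists>w. set w \<subseteq> {..<k} \<and> (\<forall>p\<in>{1..k}. xact k w p = \<beta> p)"
proof -
  define A where "A = {p \<in> {1..k}. \<beta> p \<noteq> None}"
  define f where "f p = the (\<beta> p)" for p
  have A: "A \<subseteq> {1..k}" and fin: "finite A" by (auto simp: A_def)
  have f: "\<beta> p = Some (f p)" if "p \<in> A" for p using that by (auto simp: A_def f_def)
  have fA: "f ` A \<subseteq> {1..k}" using range f A by blast
  have fmono: "strict_mono_on A f"
    unfolding strict_mono_on_def using mono f A by blast
  have card: "card (f ` A) = card A"
    using strict_mono_on_imp_inj_on[OF fmono] by (rule card_image)
  obtain w1 where w1: "set w1 \<subseteq> {..<k}" "DOM k w1 = A" "IMG k w1 = {1..card A}"
    using initial_words(1)[OF k A] by blast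
  obtain w2 where w2: "set w2 \<subseteq> {..<k}" "DOM k w2 = {1..card A}" "IMG k w2 = f ` A"
    using initial_words(2)[OF k fA] unfolding card by blast
  define w where "w = w1 @ w2"
  have D: "DOM k w = A" and I: "IMG k w = f ` A"
    using DOM_IMG_append[of w1 k w2] w1 w2 by (simp_all add: w_def IMG_def)
  have wset: "set w \<subseteq> {..<k}" using w1 w2 by (simp add: w_def)
  have wmono: "strict_mono_on A (\<lambda>p. the (xact k w p))"
    unfolding strict_mono_on_def
  proof (intro allI impI, elim conjE)
    fix p p' assume p: "p \<in> A" "p' \<in> A" "p < p'"
    then obtain q q' where "xact k w p = Some q" "xact k w p' = Some q'"
      using D unfolding DOM_def by blast
    then show "the (xact k w p) < the (xact k w p')"
      using bact_mono[OF k p(3), of "map gx w"] by (simp add: bact_gx)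
  qed
  have "xact k w p = \<beta> p" if p: "p \<in> {1..k}" for p
  proof (cases "p \<in> A")
    case True
    have "the (xact k w p) = f p"
      using strict_mono_on_determined[OF fin wmono fmono _ True] I D by (simp add: IMG_def)
    moreover have "xact k w p \<noteq> None" using True D by (auto simp: DOM_def)
    ultimately show ?thesis using f[OF True] by auto
  next
    case False
    then have "p \<notin> DOM k w" using D by simp
    then show ?thesis using False p by (simp add: A_def DOM_def)
  qed
  then show ?thesis using wset by blast
qed

lemma unit_word_exists:
  assumes "distinct js" "set js \<subseteq> {1..k}"
  shows "\<exists>g \<in> words k. (\<forall>p. bact k g p = Some p) \<and>
    (\<forall>p c. cact k m g p c = (if p \<in> set js then boolact m (wd p) c else c))"
  using assms
proof (induction js)
  case Nil
  then show ?case by (intro bexI[of _ "[]"]) auto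
next
  case (Cons j js)
  then obtain g where g: "g \<in> words k" "\<forall>p. bact k g p = Some p"
    "\<forall>p c. cact k m g p c = (if p \<in> set js then boolact m (wd p) c else c)" by auto
  let ?g = "map (coord_letter j) (wd j) @ g"
  have "?g \<in> words k"
    using g(1) Cons.prems by (auto simp: coord_letter_def generators_def)
  moreover have "\<forall>p. bact k ?g p = Some p"
    using g(2) by (simp add: bact_append bact_coord_letter)
  moreover have "\<forall>p c. cact k m ?g p c = (if p \<in> set (j # js) then boolact m (wd p) c else c)"
    using g(3) Cons.prems(1) by (auto simp: cact_append[OF bact_coord_letter] cact_coord_letter)
  ultimately show ?case by blast
qed

text \<open>The unit word stands before the x-part, so its strands belong to the blocks of the
  source, as the components of \<open>\<sigma>\<close> do.\<close>

lemma pmap_surj: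
  assumes k: "2 \<le> k" and m: "2 \<le> m" and \<alpha>: "\<alpha> \<in> POI_carrier k m"
  shows "\<exists>w \<in> words k. pmap k m w = \<alpha>"
proof -
  obtain \<beta> \<sigma> where g: "wreath_data k m \<beta> \<sigma>" and \<alpha>_eq: "\<alpha> = wreath k m \<beta> \<sigma>"
    using carrier_is_wreath[OF _ \<alpha>] m by auto
  have "\<exists>w. \<beta> p \<noteq> None \<longrightarrow> (\<forall>c<m. boolact m w c = \<sigma> p c)" if "p \<in> {1..k}" for p
    using wreath_dataD(2)[OF g that] permutation_bool_word[OF m] by blast
  then obtain wd where wd: "\<And>p. p \<in> {1..k} \<Longrightarrow> \<beta> p \<noteq> None \<Longrightarrow> \<forall>c<m. boolact m (wd p) c = \<sigma> p c"
    by metis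
  obtain u where u: "u \<in> words k" "\<forall>p. bact k u p = Some p"
    "\<forall>p c. cact k m u p c = (if p \<in> set [1..<k + 1] then boolact m (wd p) c else c)"
  proof -
    have "set [1..<k + 1] \<subseteq> {1..k}" by auto
    from unit_word_exists[OF distinct_upt this, of m wd] that show ?thesis by blast
  qed
  obtain w where w: "set w \<subseteq> {..<k}" "\<forall>p\<in>{1..k}. xact k w p = \<beta> p"
    using partial_order_word[OF k, of \<beta>] wreath_dataD(1)[OF g] wreath_data_mono[OF g] by blast
  have below_k: "{..<k} = {0..k - 1}" using k by auto
  have "gx ` set w \<subseteq> generators k"
    using image_mono[OF w(1), of gx] unfolding generators_def below_k by blast
  then have gw: "map gx w \<in> words k" by auto
  then have lists: "u @ map gx w \<in> words k" using u(1) by simp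
  have "pmap k m (u @ map gx w) = wreath k m \<beta> \<sigma>"
    unfolding pmap_def
  proof (subst wreath_eq_iff[OF _ wreath_data_word[OF k m lists] g])
    show "1 \<le> m" using m by simp
    show "\<forall>p\<in>{1..k}. bact k (u @ map gx w) p = \<beta> p \<and> (bact k (u @ map gx w) p \<noteq> None \<longrightarrow>
      (\<forall>c<m. cact k m (u @ map gx w) p c = \<sigma> p c))"
    proof
      fix p assume p: "p \<in> {1..k}"
      have "bact k (u @ map gx w) p = \<beta> p"
        using u(2) w(2) p by (simp add: bact_append bact_gx)
      moreover have "cact k m (u @ map gx w) p c = boolact m (wd p) c" for c
      proof -
        have "p \<in> set [1..<k + 1]" using p by auto
        then show ?thesis
          using u(2,3) by (simp only: cact_append cact_gx if_True)
      qed
      ultimately show "bact k (u @ map gx w) p = \<beta> p \<and> (bact k (u @ map gx w) p \<noteq> None \<longrightarrow>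
          (\<forall>c<m. cact k m (u @ map gx w) p c = \<sigma> p c))"
        using wd[OF p] by simp
    qed
  qed
  then show ?thesis using lists \<alpha>_eq by blast
qed

section \<open>The regular representation\<close>

typedef 'q endo = "UNIV :: ('q \<Rightarrow> 'q) set" by simp

instantiation endo :: (type) monoid_mult
begin

definition one_endo where "1 = Abs_endo id"

text \<open>The left factor acts first, so the value of a word under \<open>reg\<close> is
  multiplication by that word on the right.\<close>

definition times_endo where "f * g = Abs_endo (Rep_endo g \<circ> Rep_endo f)"

instance
  by standard (simp_all add: one_endo_def times_endo_def Abs_endo_inverse Rep_endo_inverse comp_assoc)

end

lemma Rep_endo_mult: "Rep_endo (f * g) x = Rep_endo g (Rep_endo f x)"
  by (simp add: times_endo_def Abs_endo_inverse)

lemma Rep_endo_one: "Rep_endo 1 x = x"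
  by (simp add: one_endo_def Abs_endo_inverse)

text \<open>Sets that are no congruence classes are left alone, so that congruent words act as the same map.\<close>

definition reg :: "'a set \<Rightarrow> ('a list \<times> 'a list) set \<Rightarrow> 'a \<Rightarrow> 'a list set endo" where
  "reg S \<rho> g = Abs_endo (\<lambda>C. if C \<in> lists S // \<rho> then \<Union>w\<in>C. \<rho> `` {w @ [g]} else C)"

context
  fixes S :: "'a set" and \<rho> :: "('a list \<times> 'a list) set"
  assumes cong: "monoid_congruence S \<rho>"
begin

lemma equiv_cong: "equiv (lists S) \<rho>"
  using cong by (simp add: monoid_congruence_def)

lemma cong_append: "(u, v) \<in> \<rho> \<Longrightarrow> (u', v') \<in> \<rho> \<Longrightarrow> (u @ u', v @ v') \<in> \<rho>"
  using cong unfolding monoid_congruence_def by blast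

lemma cong_refl: "u \<in> lists S \<Longrightarrow> (u, u) \<in> \<rho>"
  using equiv_cong by (simp add: equiv_def refl_on_def)

lemma class_mult:
  assumes "u \<in> lists S" "v \<in> lists S"
  shows "(\<Union>u'\<in>\<rho> `` {u}. \<Union>v'\<in>\<rho> `` {v}. \<rho> `` {u' @ v'}) = \<rho> `` {u @ v}"
proof -
  have "\<rho> `` {u' @ v'} = \<rho> `` {u @ v}" if "(u, u') \<in> \<rho>" "(v, v') \<in> \<rho>" for u' v'
    using equiv_class_eq[OF equiv_cong cong_append[OF that]] by simp
  then show ?thesis using cong_refl assms by blast
qed

lemma reg_letter:
  assumes "w \<in> lists S" "g \<in> S"
  shows "Rep_endo (reg S \<rho> g) (\<rho> `` {w}) = \<rho> `` {w @ [g]}"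
proof -
  have "\<rho> `` {w' @ [g]} = \<rho> `` {w @ [g]}" if "(w, w') \<in> \<rho>" for w'
    using equiv_class_eq[OF equiv_cong cong_append[OF that cong_refl[of "[g]"]]] assms by simp
  then have "(\<Union>w'\<in>\<rho> `` {w}. \<rho> `` {w' @ [g]}) = \<rho> `` {w @ [g]}"
    using cong_refl assms by blast
  then show ?thesis
    using assms(1) by (simp add: reg_def Abs_endo_inverse quotientI)
qed

lemma reg_word:
  "u \<in> lists S \<Longrightarrow> w \<in> lists S \<Longrightarrow>
   Rep_endo (prod_list (map (reg S \<rho>) u)) (\<rho> `` {w}) = \<rho> `` {w @ u}"
proof (induction u arbitrary: w)
  case (Cons g u)
  then show ?case using Cons.IH[of "w @ [g]"] by (simp add: Rep_endo_mult reg_letter)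
qed (simp add: Rep_endo_one)

lemma reg_other: "C \<notin> lists S // \<rho> \<Longrightarrow> Rep_endo (prod_list (map (reg S \<rho>) u)) C = C"
  by (induction u) (simp_all add: Rep_endo_one Rep_endo_mult reg_def Abs_endo_inverse)

text \<open>Applied to the class of the empty word, the value of a word returns the class of that
  word, so the representation is faithful.\<close>

lemma reg_eq_iff:
  assumes "u \<in> lists S" "v \<in> lists S"
  shows "prod_list (map (reg S \<rho>) u) = prod_list (map (reg S \<rho>) v) \<longleftrightarrow> (u, v) \<in> \<rho>"
proof
  assume eq: "prod_list (map (reg S \<rho>) u) = prod_list (map (reg S \<rho>) v)"
  have "\<rho> `` {u} = \<rho> `` {v}"
    using reg_word[OF assms(1), of "[]"] reg_word[OF assms(2), of "[]"] eq by simp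
  then show "(u, v) \<in> \<rho>"
    using eq_equiv_class[OF _ equiv_cong assms(2)] by blast
next
  assume uv: "(u, v) \<in> \<rho>"
  have "Rep_endo (prod_list (map (reg S \<rho>) u)) C = Rep_endo (prod_list (map (reg S \<rho>) v)) C" for C
  proof (cases "C \<in> lists S // \<rho>")
    case True
    then obtain w where w: "w \<in> lists S" "C = \<rho> `` {w}" by (rule quotientE)
    have "\<rho> `` {w @ u} = \<rho> `` {w @ v}"
      using equiv_class_eq[OF equiv_cong cong_append[OF cong_refl[OF w(1)] uv]] .
    then show ?thesis using reg_word assms w by simp
  qed (simp add: reg_other)
  then show "prod_list (map (reg S \<rho>) u) = prod_list (map (reg S \<rho>) v)"
    by (metis Rep_endo_inject ext)
qed

end

text \<open>Equality of induced maps is a congruence \<open>\<tau>\<close> containing the relations,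
  so it contains \<open>\<rho>\<close>. This inclusion also supplies \<open>sep\<close> for the
  regular representation, and \<open>complete\<close> then gives the converse.\<close>

lemma generated_congruence_sem:
  assumes k: "2 \<le> k" and m: "2 \<le> m"
  defines "\<rho> \<equiv> generated_congruence (generators k) (relations k m)"
  shows "monoid_congruence (generators k) \<rho>"
    and "(u, v) \<in> \<rho> \<longleftrightarrow> u \<in> words k \<and> v \<in> words k \<and> sem_eq k m u v"
proof -
  let ?S = "generators k"
  have rels: "relations k m \<subseteq> lists ?S \<times> lists ?S"
    by (rule subrelI) (intro SigmaI relations_are_words[OF k])
  then show cong: "monoid_congruence ?S \<rho>"
    unfolding \<rho>_def by (rule monoid_congruence_generated)
  define \<tau> where "\<tau> = {(u, v). u \<in> lists ?S \<and> v \<in> lists ?S \<and> sem_eq k m u v}"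
  have "equiv (lists ?S) \<tau>"
    unfolding equiv_def \<tau>_def
    by (auto simp: refl_on_def sym_def trans_def sem_eq_refl intro: sem_eq_sym sem_eq_trans)
  moreover have "(u @ u', v @ v') \<in> \<tau>" if "(u, v) \<in> \<tau>" "(u', v') \<in> \<tau>" for u v u' v'
    using that sem_eq_append[OF k m] by (auto simp: \<tau>_def)
  ultimately have "monoid_congruence ?S \<tau>"
    unfolding monoid_congruence_def by blast
  moreover have "relations k m \<subseteq> \<tau>"
    using rels sem_relations[OF k m] by (auto simp: \<tau>_def)
  ultimately have sub: "\<rho> \<subseteq> \<tau>"
    unfolding \<rho>_def generated_congruence_def by blast
  interpret poi_model k m "reg ?S \<rho>"
  proof
    show "2 \<le> k" "2 \<le> m" by (rule k m)+
    fix u v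
    show "prod_list (map (reg ?S \<rho>) u) = prod_list (map (reg ?S \<rho>) v)" if "(u, v) \<in> relations k m"
    proof (subst reg_eq_iff[OF cong])
      show "u \<in> lists ?S" "v \<in> lists ?S" using relations_are_words[OF k that] by blast+
      show "(u, v) \<in> \<rho>" using that unfolding \<rho>_def generated_congruence_def by blast
    qed
    show "sem_eq k m u v" if "u \<in> lists ?S" "v \<in> lists ?S"
      "prod_list (map (reg ?S \<rho>) u) = prod_list (map (reg ?S \<rho>) v)"
      using reg_eq_iff[OF cong that(1,2)] that(3) sub by (auto simp: \<tau>_def)
  qed
  show "(u, v) \<in> \<rho> \<longleftrightarrow> u \<in> lists ?S \<and> v \<in> lists ?S \<and> sem_eq k m u v"
  proof
    assume "(u, v) \<in> \<rho>"
    then show "u \<in> lists ?S \<and> v \<in> lists ?S \<and> sem_eq k m u v" using sub by (auto simp: \<tau>_def)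
  next
    assume *: "u \<in> lists ?S \<and> v \<in> lists ?S \<and> sem_eq k m u v"
    then have "prod_list (map (reg ?S \<rho>) u) = prod_list (map (reg ?S \<rho>) v)"
      by (intro complete) auto
    then show "(u, v) \<in> \<rho>" using reg_eq_iff[OF cong] * by blast
  qed
qed

section \<open>The number of relations\<close>

lemma wpow_Suc: "w \<up> Suc n = w @ w \<up> n"
  by (simp add: wpow_def)

lemma length_wpow: "length (w \<up> n) = n * length w"
  by (induction n) (simp_all add: wpow_def)


text \<open>Finiteness is carried along because \<open>card\<close> is 0 on infinite sets.\<close>

definition card_is :: "'a set \<Rightarrow> nat \<Rightarrow> bool" where
  "card_is A n \<longleftrightarrow> finite A \<and> card A = n"

lemma card_is_Un: "card_is A a \<Longrightarrow> card_is B b \<Longrightarrow> A \<inter> B = {} \<Longrightarrow> card_is (A \<union> B) (a + b)"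
  by (simp add: card_is_def card_Un_disjoint)

lemma card_is_image: "card_is I n \<Longrightarrow> inj_on h I \<Longrightarrow> A = h ` I \<Longrightarrow> card_is A n"
  by (simp add: card_is_def card_image)

lemma card_is_image2:
  assumes "card_is (Sigma J B) n" "\<And>j i j' i'. h j i = h j' i' \<Longrightarrow> j = j' \<and> i = i'"
    and "A = {h j i | j i. j \<in> J \<and> i \<in> B j}"
  shows "card_is A n"
proof (rule card_is_image[OF assms(1), of "\<lambda>(j, i). h j i"])
  show "inj_on (\<lambda>(j, i). h j i) (Sigma J B)"
    using assms(2) by (auto simp: inj_on_def)
  show "A = (\<lambda>(j, i). h j i) ` Sigma J B"
    unfolding assms(3) by force
qed

lemma card_is_Sigma:
  "card_is (Sigma {1..n} B) (\<Sum>i = 1..n. c i)" if "\<And>i. i \<in> {1..n::nat} \<Longrightarrow> card_is (B i) (c i)"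
  using that by (auto simp: card_is_def)

lemma sum_gap1: "2 * (\<Sum>j = 1..n. j - 1) = n * (n - 1)" for n :: nat
proof (induction n)
  case (Suc n)
  then show ?case by (cases n) simp_all
qed simp

lemma sum_gap2: "2 * (\<Sum>j = 1..n. j - 2) = (n - 1) * (n - 2)" for n :: nat
proof (induction n)
  case (Suc n)
  show ?case
  proof (cases "n < 2")
    case True
    then have "n = 0 \<or> n = 1" by auto
    then show ?thesis by auto
  next
    case False
    define l where "l = n - 2"
    have "n = Suc (Suc l)" using False by (simp add: l_def)
    then show ?thesis using Suc by simp
  qed
qed simp

lemma card_is_pairs1: "card_is (SIGMA j:{1..n}. {1..j - 1}) (n * (n - 1) div 2)" for n :: nat
proof -
  have "card_is (SIGMA j:{1..n}. {1..j - 1}) (\<Sum>j = 1..n. j - 1)"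
    by (rule card_is_Sigma) (simp add: card_is_def)
  moreover have "(\<Sum>j = 1..n. j - 1) = n * (n - 1) div 2"
    using sum_gap1[of n] by linarith
  ultimately show ?thesis by metis
qed

lemma card_is_pairs2: "card_is (SIGMA j:{1..n}. {1..j - 2}) ((n - 1) * (n - 2) div 2)" for n :: nat
proof -
  have "card_is (SIGMA j:{1..n}. {1..j - 2}) (\<Sum>j = 1..n. j - 2)"
    by (rule card_is_Sigma) (simp add: card_is_def)
  moreover have "(\<Sum>j = 1..n. j - 2) = (n - 1) * (n - 2) div 2"
    using sum_gap2[of n] by linarith
  ultimately show ?thesis by metis
qed

text \<open>Each family is an injective image of its index set, and the families are told apart by
  the first letters or the lengths of their words. With truncated subtraction \<open>m - 3\<close>
  is the size of \<open>{2..m - 2}\<close> for \<open>m = 2\<close> too.\<close>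

lemma card_rels_R:
  assumes m: "2 \<le> m"
  shows "card_is (rels_R k m) (4 * k + k * (m - 3) + 2 * (k * (k - 1) div 2) + k * (k - 1))"
proof -
  define w4 where "w4 i = ([ga i] @ [gb i] \<up> (m - 1) @ [ga i] @ [gb i]) \<up> 3" for i
  define w5 where "w5 = (\<lambda>(i, j). ([ga i] @ [gb i] \<up> (m - j) @ [ga i] @ [gb i] \<up> j) \<up> 2)"
  define I5 where "I5 = {1..k} \<times> {2..m - 2}"
  define R1 where "R1 = {([ga i] \<up> 2, [] :: gen list) | i. 1 \<le> i \<and> i \<le> k}"
  define R2 where "R2 = {([gb i] \<up> m, [] :: gen list) | i. 1 \<le> i \<and> i \<le> k}"
  define R3 where "R3 = {([gb i, ga i] \<up> (m - 1), [] :: gen list) | i. 1 \<le> i \<and> i \<le> k}"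
  define R4 where "R4 = {(w4 i, [] :: gen list) | i. 1 \<le> i \<and> i \<le> k}"
  define R5 where "R5 = {(w5 (i, j), [] :: gen list) | i j. 2 \<le> j \<and> j \<le> m - 2 \<and> 1 \<le> i \<and> i \<le> k}"
  define R6 where "R6 = {([ga i, ga j], [ga j, ga i]) | i j. 1 \<le> i \<and> i < j \<and> j \<le> k}"
  define R7 where "R7 = {([gb i, gb j], [gb j, gb i]) | i j. 1 \<le> i \<and> i < j \<and> j \<le> k}"
  define R8 where "R8 = {([ga i, gb j], [gb j, ga i]) | i j. 1 \<le> i \<and> i \<le> k \<and> 1 \<le> j \<and> j \<le> k \<and> i \<noteq> j}"
  note defs = R1_def R2_def R3_def R4_def R5_def R6_def R7_def R8_def
  have R: "rels_R k m = R1 \<union> R2 \<union> R3 \<union> R4 \<union> R5 \<union> R6 \<union> R7 \<union> R8"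
    by (simp only: rels_R_def defs w4_def w5_def prod.case)
  define m1 where "m1 = m - 2"
  have m1: "m = Suc (Suc m1)" using m by (simp add: m1_def)
  have e2: "[gb i] \<up> m = gb i # replicate (m1 + 1) (gb i)" for i
    by (simp add: wpow_single m1)
  have e3: "[gb i, ga i] \<up> (m - Suc 0) = gb i # ga i # [gb i, ga i] \<up> m1" for i
    by (simp add: wpow_Suc m1)
  have "\<exists>r. w4 i = ga i # gb i # r" for i
    by (simp add: w4_def wpow_Suc numeral_3_eq_3 wpow_single m1)
  then obtain r4 where e4: "\<And>i. w4 i = ga i # gb i # r4 i"
    by metis
  have ex5: "\<exists>r. w5 (i, j) = ga i # gb i # replicate (m - j - 1) (gb i) @ ga i # r" if "j < m" for i j
  proof -
    have "m - j = Suc (m - j - 1)" using that by simp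
    then have "[gb i] \<up> (m - j) = gb i # replicate (m - j - 1) (gb i)"
      unfolding wpow_single by (metis replicate_Suc)
    then show ?thesis by (simp add: w5_def wpow_Suc numeral_2_eq_2)
  qed
  \<comment> \<open>Only the displayed beginning of the word matters; the rest is left
    unspecified.\<close>
  define r5 where
    "r5 i j = (SOME r. w5 (i, j) = ga i # gb i # replicate (m - j - 1) (gb i) @ ga i # r)" for i j
  have e5: "w5 (i, j) = ga i # gb i # replicate (m - j - 1) (gb i) @ ga i # r5 i j" if "j < m" for i j
    unfolding r5_def by (rule someI_ex[OF ex5[OF that]])
  have l4: "length (w4 i) = 3 * (m + 2)" for i
    using m by (simp add: w4_def length_wpow wpow_single)
  have l5: "length (w5 (i, j)) = 2 * (m + 2)" if "j \<le> m" for i j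
    using that by (simp add: w5_def length_wpow wpow_single)
  have k: "card_is {1..k} k" by (simp add: card_is_def)
  have c1: "card_is R1 k"
    by (rule card_is_image[OF k, of "\<lambda>i. ([ga i] \<up> 2, [])"]) (auto simp: R1_def inj_on_def wpow_Suc numeral_2_eq_2)
  have c2: "card_is R2 k"
    by (rule card_is_image[OF k, of "\<lambda>i. ([gb i] \<up> m, [])"]) (auto simp: R2_def inj_on_def e2)
  have c3: "card_is R3 k"
    by (rule card_is_image[OF k, of "\<lambda>i. ([gb i, ga i] \<up> (m - 1), [])"]) (auto simp: R3_def inj_on_def e3)
  have c4: "card_is R4 k"
    by (rule card_is_image[OF k, of "\<lambda>i. (w4 i, [])"]) (auto simp: R4_def inj_on_def e4)
  have I5: "card_is I5 (k * (m - 3))"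
    by (simp add: card_is_def I5_def)
  \<comment> \<open>The first run of \<open>gb i\<close> has length \<open>m - j\<close>, so the
    word determines \<open>j\<close>.\<close>
  have tw: "length (takeWhile (\<lambda>l. l = gb i) (tl (w5 (i, j)))) = m - j" if "j < m" for i j
    using that unfolding e5[OF that] by (simp add: takeWhile_append)
  have c5: "card_is R5 (k * (m - 3))"
  proof (rule card_is_image[OF I5, of "\<lambda>p. (w5 p, [])"])
    show "inj_on (\<lambda>p. (w5 p, [])) I5"
    proof (rule inj_onI, clarsimp)
      fix i j i' j' assume *: "(i, j) \<in> I5" "(i', j') \<in> I5" and eq: "w5 (i, j) = w5 (i', j')"
      then have j: "j < m" "j' < m" by (auto simp: I5_def)
      have "i = i'" using eq unfolding e5[OF j(1)] e5[OF j(2)] by simp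
      moreover from this have "m - j = m - j'" using tw[OF j(1), of i] tw[OF j(2), of i'] eq by simp
      ultimately show "i = i' \<and> j = j'" using j by simp
    qed
    show "R5 = (\<lambda>p. (w5 p, [])) ` I5"
      by (auto simp: R5_def I5_def) blast
  qed
  have c6: "card_is R6 (k * (k - 1) div 2)"
    by (rule card_is_image2[OF card_is_pairs1[of k], of "\<lambda>j i. ([ga i, ga j], [ga j, ga i])"])
      (auto simp: R6_def)
  have c7: "card_is R7 (k * (k - 1) div 2)"
    by (rule card_is_image2[OF card_is_pairs1[of k], of "\<lambda>j i. ([gb i, gb j], [gb j, gb i])"])
      (auto simp: R7_def)
  have I8: "card_is (SIGMA i:{1..k}. {1..k} - {i}) (k * (k - 1))"
    using card_is_Sigma[of k "\<lambda>i. {1..k} - {i}" "\<lambda>_. k - 1"] by (simp add: card_is_def)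
  have c8: "card_is R8 (k * (k - 1))"
    by (rule card_is_image2[OF I8, of "\<lambda>i j. ([ga i, gb j], [gb j, ga i])"])
      (auto simp: R8_def)
  have d2: "R1 \<inter> R2 = {}"
    by (auto simp: defs e2 wpow_Suc numeral_2_eq_2)
  have d3: "(R1 \<union> R2) \<inter> R3 = {}"
    by (auto simp: defs e2 e3 wpow_Suc numeral_2_eq_2)
  have d4: "(R1 \<union> R2 \<union> R3) \<inter> R4 = {}"
    by (auto simp: defs e2 e3 e4 wpow_Suc numeral_2_eq_2)
  have d5: "(R1 \<union> R2 \<union> R3 \<union> R4) \<inter> R5 = {}"
  proof -
    \<comment> \<open>The lengths \<open>3 * (m + 2)\<close> and \<open>2 * (m + 2)\<close>
      differ.\<close>
    have ne: "w4 i \<noteq> w5 (i', j)" if "j < m" for i i' j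
      using arg_cong[of "w4 i" "w5 (i', j)" length] l4[of i] l5[of j i'] that by auto
    have lt: "j < m" if "2 \<le> j" "j \<le> m - 2" for j
      using that by simp
    have "R4 \<inter> R5 = {}"
      using ne ne[symmetric] lt by (auto simp: R4_def R5_def)
    moreover have "(R1 \<union> R2 \<union> R3) \<inter> R5 = {}"
      using lt by (auto simp: defs R5_def e2 e3 e5 wpow_Suc numeral_2_eq_2)
    ultimately show ?thesis by blast
  qed
  have d6: "(R1 \<union> R2 \<union> R3 \<union> R4 \<union> R5) \<inter> R6 = {}"
    by (auto simp: defs)
  have d7: "(R1 \<union> R2 \<union> R3 \<union> R4 \<union> R5 \<union> R6) \<inter> R7 = {}"
    by (auto simp: defs)
  have d8: "(R1 \<union> R2 \<union> R3 \<union> R4 \<union> R5 \<union> R6 \<union> R7) \<inter> R8 = {}"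
    by (auto simp: defs)
  note c12 = card_is_Un[OF c1 c2 d2]
  note c13 = card_is_Un[OF c12 c3 d3]
  note c14 = card_is_Un[OF c13 c4 d4]
  note c15 = card_is_Un[OF c14 c5 d5]
  note c16 = card_is_Un[OF c15 c6 d6]
  note c17 = card_is_Un[OF c16 c7 d7]
  have "k + k + k + k + a + b + b + c = 4 * k + a + 2 * b + c" for a b c :: nat
    by simp
  then show ?thesis
    using card_is_Un[OF c17 c8 d8] unfolding R by (simp only:)
qed

lemma card_rels_W:
  assumes k: "2 \<le> k"
  shows "card_is (rels_W k) (3 * (k - 2) + (k - 2) * (k - 3) div 2 + 2 + k + (k - 1))"
proof -
  define W1 where "W1 = {([gx i, gx 0], [gx 0, gx (i + 1)]) | i. 1 \<le> i \<and> i \<le> k - 2}"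
  define W2 where "W2 = {([gx j, gx i], [gx i, gx j]) | i j. 2 \<le> i + 1 \<and> i + 1 < j \<and> j \<le> k - 1}"
  define W3 where "W3 = {([gx 0, gx 0, gx 1], [gx 0, gx 0])}"
  define W4 where "W4 = {([gx 0, gx 0], [gx (k - 1), gx 0, gx 0])}"
  define W5 where "W5 = {([gx (i + 1), gx i, gx (i + 1)], [gx (i + 1), gx i]) | i. 1 \<le> i \<and> i \<le> k - 2}"
  define W6 where "W6 = {([gx (i + 1), gx i], [gx i, gx (i + 1), gx i]) | i. 1 \<le> i \<and> i \<le> k - 2}"
  define W7 where "W7 = {(cyc k i @ [gx i], [gx i]) | i. 0 \<le> i \<and> i \<le> k - 1}"
  define W8 where "W8 = {(cyc' k i @ [gx i, gx i], [gx i, gx i]) | i. 1 \<le> i \<and> i \<le> k - 1}"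
  note defs = W1_def W2_def W3_def W4_def W5_def W6_def W7_def W8_def
  have W: "rels_W k = W1 \<union> W2 \<union> W3 \<union> W4 \<union> W5 \<union> W6 \<union> W7 \<union> W8"
    by (simp only: rels_W_def defs)
  have I: "card_is {1..k - 2} (k - 2)" "card_is {0..k - 1} k" "card_is {1..k - 1} (k - 1)"
    using k by (simp_all add: card_is_def)
  have c1: "card_is W1 (k - 2)"
    by (rule card_is_image[OF I(1), of "\<lambda>i. ([gx i, gx 0], [gx 0, gx (i + 1)])"]) (auto simp: W1_def inj_on_def)
  have "card_is (SIGMA j:{1..k - 1}. {1..j - 2}) ((k - 2) * (k - 3) div 2)"
    using card_is_pairs2[of "k - 1"] by (simp add: numeral_eq_Suc)
  then have c2: "card_is W2 ((k - 2) * (k - 3) div 2)"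
    by (rule card_is_image2[where h = "\<lambda>j i. ([gx j, gx i], [gx i, gx j])"])
      (auto simp: W2_def)
  have c3: "card_is W3 1" and c4: "card_is W4 1"
    by (simp_all add: W3_def W4_def card_is_def)
  have c5: "card_is W5 (k - 2)"
    by (rule card_is_image[OF I(1), of "\<lambda>i. ([gx (i + 1), gx i, gx (i + 1)], [gx (i + 1), gx i])"])
      (auto simp: W5_def inj_on_def)
  have c6: "card_is W6 (k - 2)"
    by (rule card_is_image[OF I(1), of "\<lambda>i. ([gx (i + 1), gx i], [gx i, gx (i + 1), gx i])"])
      (auto simp: W6_def inj_on_def)
  have c7: "card_is W7 k"
    by (rule card_is_image[OF I(2), of "\<lambda>i. (cyc k i @ [gx i], [gx i])"]) (auto simp: W7_def inj_on_def)
  have c8: "card_is W8 (k - 1)"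
    by (rule card_is_image[OF I(3), of "\<lambda>i. (cyc' k i @ [gx i, gx i], [gx i, gx i])"])
      (auto simp: W8_def inj_on_def)
  have d2: "W1 \<inter> W2 = {}"
    by (auto simp: defs)
  have d3: "(W1 \<union> W2) \<inter> W3 = {}"
    by (auto simp: defs)
  have d4: "(W1 \<union> W2 \<union> W3) \<inter> W4 = {}"
    by (auto simp: defs)
  have d5: "(W1 \<union> W2 \<union> W3 \<union> W4) \<inter> W5 = {}"
    by (auto simp: defs)
  have d6: "(W1 \<union> W2 \<union> W3 \<union> W4 \<union> W5) \<inter> W6 = {}"
    by (auto simp: defs)
  have d7: "(W1 \<union> W2 \<union> W3 \<union> W4 \<union> W5 \<union> W6) \<inter> W7 = {}"
    by (auto simp: defs)
  have d8: "(W1 \<union> W2 \<union> W3 \<union> W4 \<union> W5 \<union> W6 \<union> W7) \<inter> W8 = {}"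
    by (auto simp: defs)
  note c12 = card_is_Un[OF c1 c2 d2]
  note c13 = card_is_Un[OF c12 c3 d3]
  note c14 = card_is_Un[OF c13 c4 d4]
  note c15 = card_is_Un[OF c14 c5 d5]
  note c16 = card_is_Un[OF c15 c6 d6]
  note c17 = card_is_Un[OF c16 c7 d7]
  have "a + b + 1 + 1 + a + a + k + c = 3 * a + b + 2 + k + c" for a b c :: nat
    by simp
  then show ?thesis
    using card_is_Un[OF c17 c8 d8] unfolding W by (simp only:)
qed

text \<open>The half of R' that belongs to one of the letters a and b, so that both halves are
  counted by one lemma.\<close>

definition rels_g :: "nat \<Rightarrow> (nat \<Rightarrow> gen) \<Rightarrow> (gen list \<times> gen list) set" where
  "rels_g k g = {([g 1, gx 0], [gx 0])} \<union>
     {([gx 0, g i], [g (i + 1), gx 0]) | i. 1 \<le> i \<and> i \<le> k - 1} \<union>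
     {([gx i, g (k - i)], [gx i]) | i. 0 \<le> i \<and> i \<le> k - 1} \<union>
     {([g i, gx (k - i + 1)], [gx (k - i + 1)]) | i. 2 \<le> i \<and> i \<le> k} \<union>
     {([gx i, g (k - i + 1)], [g (k - i), gx i]) | i. 1 \<le> i \<and> i \<le> k - 1} \<union>
     {([gx i, g j], [g j, gx i]) | i j.
        1 \<le> i \<and> i \<le> k - 1 \<and> 1 \<le> j \<and> j \<le> k \<and> j \<notin> {k - i, k - i + 1}}"

lemma rels_R'_eq: "rels_R' k = rels_g k ga \<union> rels_g k gb"
  by (simp add: rels_R'_def rels_g_def)

lemma card_rels_g:
  assumes k: "2 \<le> k" and inj: "\<And>i j. g i = g j \<Longrightarrow> i = j" and x: "\<And>i j. g i \<noteq> gx j"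
  shows "card_is (rels_g k g) (1 + (k - 1) + k + (k - 1) + (k - 1) + (k - 1) * (k - 2))"
proof -
  define F1 where "F1 = {([g 1, gx 0], [gx 0])}"
  define F2 where "F2 = {([gx 0, g i], [g (i + 1), gx 0]) | i. 1 \<le> i \<and> i \<le> k - 1}"
  define F3 where "F3 = {([gx i, g (k - i)], [gx i]) | i. 0 \<le> i \<and> i \<le> k - 1}"
  define F4 where "F4 = {([g i, gx (k - i + 1)], [gx (k - i + 1)]) | i. 2 \<le> i \<and> i \<le> k}"
  define F5 where "F5 = {([gx i, g (k - i + 1)], [g (k - i), gx i]) | i. 1 \<le> i \<and> i \<le> k - 1}"
  define F6 where "F6 = {([gx i, g j], [g j, gx i]) | i j.
        1 \<le> i \<and> i \<le> k - 1 \<and> 1 \<le> j \<and> j \<le> k \<and> j \<notin> {k - i, k - i + 1}}"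
  note defs = F1_def F2_def F3_def F4_def F5_def F6_def
  have F: "rels_g k g = F1 \<union> F2 \<union> F3 \<union> F4 \<union> F5 \<union> F6"
    by (simp only: rels_g_def defs)
  have I: "card_is {1..k - 1} (k - 1)" "card_is {0..k - 1} k" "card_is {2..k} (k - 1)"
    using k by (simp_all add: card_is_def)
  have c1: "card_is F1 1" by (simp add: F1_def card_is_def)
  have c2: "card_is F2 (k - 1)"
    by (rule card_is_image[OF I(1), of "\<lambda>i. ([gx 0, g i], [g (i + 1), gx 0])"])
      (auto simp: F2_def inj_on_def dest: inj)
  have c3: "card_is F3 k"
    by (rule card_is_image[OF I(2), of "\<lambda>i. ([gx i, g (k - i)], [gx i])"]) (auto simp: F3_def inj_on_def)
  have c4: "card_is F4 (k - 1)"
    by (rule card_is_image[OF I(3), of "\<lambda>i. ([g i, gx (k - i + 1)], [gx (k - i + 1)])"])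
      (auto simp: F4_def inj_on_def dest: inj)
  have c5: "card_is F5 (k - 1)"
    by (rule card_is_image[OF I(1), of "\<lambda>i. ([gx i, g (k - i + 1)], [g (k - i), gx i])"])
      (auto simp: F5_def inj_on_def)
  have I6: "card_is (SIGMA i:{1..k - 1}. {1..k} - {k - i, k - i + 1}) ((k - 1) * (k - 2))"
  proof -
    have "card_is ({1..k} - {k - i, k - i + 1}) (k - 2)" if "i \<in> {1..k - 1}" for i
    proof -
      have "{k - i, k - i + 1} \<subseteq> {1..k}" using that by auto
      then show ?thesis by (simp add: card_is_def card_Diff_subset)
    qed
    then have "card_is (SIGMA i:{1..k - 1}. {1..k} - {k - i, k - i + 1}) (\<Sum>i = 1..k - 1. k - 2)"
      by (rule card_is_Sigma)
    then show ?thesis by simp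
  qed
  have c6: "card_is F6 ((k - 1) * (k - 2))"
    by (rule card_is_image2[OF I6, of "\<lambda>i j. ([gx i, g j], [g j, gx i])"])
      (auto simp: F6_def dest: inj)
  have d2: "F1 \<inter> F2 = {}" using x by (auto simp: defs)
  have d3: "(F1 \<union> F2) \<inter> F3 = {}" using x by (auto simp: defs)
  have d4: "(F1 \<union> F2 \<union> F3) \<inter> F4 = {}"
    using x x[symmetric] by (auto simp: defs)
  have d5: "(F1 \<union> F2 \<union> F3 \<union> F4) \<inter> F5 = {}"
    using x x[symmetric] by (auto simp: defs)
  have d6: "(F1 \<union> F2 \<union> F3 \<union> F4 \<union> F5) \<inter> F6 = {}"
    using x x[symmetric] by (auto simp: defs dest: inj)
  note c12 = card_is_Un[OF c1 c2 d2]
  note c13 = card_is_Un[OF c12 c3 d3]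
  note c14 = card_is_Un[OF c13 c4 d4]
  note c15 = card_is_Un[OF c14 c5 d5]
  show ?thesis
    using card_is_Un[OF c15 c6 d6] unfolding F .
qed

lemma card_rels_R':
  assumes "2 \<le> k"
  shows "card_is (rels_R' k) (2 * (1 + (k - 1) + k + (k - 1) + (k - 1) + (k - 1) * (k - 2)))"
proof -
  have "rels_g k ga \<inter> rels_g k gb = {}"
    by (auto simp: rels_g_def)
  moreover have "card_is (rels_g k ga) (1 + (k - 1) + k + (k - 1) + (k - 1) + (k - 1) * (k - 2))"
    "card_is (rels_g k gb) (1 + (k - 1) + k + (k - 1) + (k - 1) + (k - 1) * (k - 2))"
    by (rule card_rels_g[OF assms]; simp)+
  ultimately show ?thesis
    unfolding rels_R'_eq mult_2 by (intro card_is_Un)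
qed

text \<open>Separates the cyclic relations of W from the absorption of a unit letter by an x-letter
  in R': both have a single x-letter on the right and the same last letter on the left.\<close>

lemma cyc_neq: "cyc k i \<noteq> [ga j]" "cyc k i \<noteq> [gb j]"
  by (auto dest!: arg_cong[of _ _ set] simp: cyc_def)

text \<open>For \<open>m = 2\<close> the family with the exponents
  \<open>2 \<le> j \<le> m - 2\<close> is empty, whereas the polynomial counts it as k(m - 3) = -k.
  This is the correction, doubled here like the whole count.\<close>

lemma card_relations:
  assumes k: "2 \<le> k" and m: "2 \<le> m"
  shows "finite (relations k m)"
    and "2 * real (card (relations k m)) =
      9 * real k ^ 2 + (2 * real m + 7) * real k - 4 + (if m = 2 then 2 * real k else 0)"
proof -
  have d1: "rels_R k m \<inter> rels_W k = {}"
    unfolding rels_R_def rels_W_def by auto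
  have d2: "(rels_R k m \<union> rels_W k) \<inter> rels_R' k = {}"
    unfolding rels_R_def rels_W_def rels_R'_eq rels_g_def
    by (auto simp: cyc_neq cyc_neq[symmetric])
  note c = card_is_Un[OF card_is_Un[OF card_rels_R[OF m] card_rels_W[OF k] d1] card_rels_R'[OF k] d2]
  then show "finite (relations k m)" by (simp add: card_is_def relations_def)
  have e1: "2 * (k * (k - 1) div 2) = k * (k - 1)"
    unfolding sum_gap1[of k, symmetric] by simp
  have "k - 2 = k - 1 - 1" "k - 3 = k - 1 - 2" by simp_all
  then have e2: "2 * ((k - 2) * (k - 3) div 2) = (k - 2) * (k - 3)"
    using sum_gap2[of "k - 1"] by (metis dvd_triv_left dvd_mult_div_cancel)
  have card: "card (relations k m) = 4 * k + k * (m - 3) + 2 * (k * (k - 1) div 2) + k * (k - 1) +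
      (3 * (k - 2) + (k - 2) * (k - 3) div 2 + 2 + k + (k - 1)) +
      2 * (1 + (k - 1) + k + (k - 1) + (k - 1) + (k - 1) * (k - 2))"
    using c by (simp only: card_is_def relations_def)
  \<comment> \<open>The truncated differences become variables, so that the halves can be cleared
    without evaluating them.\<close>
  have "2 * C = 2 * (4 * k + M + P + P) + (2 * (3 * K2 + 2 + k + K1) + Q) + 4 * (1 + K1 + k + K1 + K1 + S)"
    if "C = 4 * k + M + 2 * P' + P + (3 * K2 + Q' + 2 + k + K1) + 2 * (1 + K1 + k + K1 + K1 + S)"
      "2 * P' = P" "2 * Q' = Q" for C M P P' Q Q' K1 K2 S :: nat
    using that by simp
  note card2 = this[OF card e1 e2]
  have r: "real (k - 1) = real k - 1" "real (k - 2) = real k - 2" "(real k - 2) * real (k - 3) = (real k - 2) * (real k - 3)"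
    using k by (cases "k = 2"; simp add: of_nat_diff)+
  have "2 * real (card (relations k m)) = real (2 * card (relations k m))" by simp
  also have "\<dots> = 2 * (4 * real k + real k * real (m - 3) + real k * (real k - 1) + real k * (real k - 1))
    + (2 * (3 * (real k - 2) + 2 + real k + (real k - 1)) + (real k - 2) * (real k - 3))
    + 4 * (1 + (real k - 1) + real k + (real k - 1) + (real k - 1) + (real k - 1) * (real k - 2))"
    unfolding card2 by (simp only: of_nat_add of_nat_mult r of_nat_numeral of_nat_1)
  finally have eq: "2 * real (card (relations k m)) = \<dots>" .
  show "2 * real (card (relations k m)) =
      9 * real k ^ 2 + (2 * real m + 7) * real k - 4 + (if m = 2 then 2 * real k else 0)"
  proof (cases "m = 2")
    case True
    then show ?thesis unfolding eq by (simp add: algebra_simps power2_eq_square)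
  next
    case False
    then have "real (m - 3) = real m - 3" using m by (simp add: of_nat_diff)
    then show ?thesis unfolding eq using False by (simp add: algebra_simps power2_eq_square)
  qed
qed

lemma card_generators: "2 \<le> k \<Longrightarrow> card (generators k) = 3 * k"
proof -
  assume k: "2 \<le> k"
  have "card_is (ga ` {1..k}) k" "card_is (gb ` {1..k}) k" "card_is (gx ` {0..k - 1}) k"
    using k by (simp_all add: card_is_def card_image inj_on_def)
  note c = card_is_Un[OF card_is_Un[OF this(1,2)] this(3)]
  have "card_is (generators k) (k + k + k)"
    unfolding generators_def by (rule c) auto
  then show ?thesis by (simp add: card_is_def)
qed

section \<open>The isomorphism\<close>

lemma pmap_in_carrier:
  "2 \<le> k \<Longrightarrow> 2 \<le> m \<Longrightarrow> w \<in> words k \<Longrightarrow> pmap k m w \<in> POI_carrier k m"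
  unfolding pmap_def by (intro wreath_in_carrier wreath_data_word)

text \<open>The isomorphism sends a partial map to the set of all words inducing it. This set is a
  congruence class because \<open>\<rho>\<close> is equality of induced maps, so no representative
  has to be chosen.\<close>

lemma POI_iso_presented:
  assumes k: "2 \<le> k" and m: "2 \<le> m"
  shows "POI k m \<cong> presented_monoid (generators k) (relations k m)"
proof -
  let ?S = "generators k" and ?P = "presented_monoid (generators k) (relations k m)"
  define \<rho> where "\<rho> = generated_congruence ?S (relations k m)"
  note cong = generated_congruence_sem(1)[OF k m, folded \<rho>_def]
  define h where "h \<alpha> = {w \<in> lists ?S. pmap k m w = \<alpha>}" for \<alpha>
  have h: "h (pmap k m u) = \<rho> `` {u}" if "u \<in> lists ?S" for u
  proof -
    have "w \<in> lists ?S \<and> pmap k m w = pmap k m u \<longleftrightarrow> (u, w) \<in> \<rho>" for w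
      using pmap_eq_iff[OF k m that, of w] generated_congruence_sem(2)[OF k m, folded \<rho>_def, of u w] that
      by metis
    then show ?thesis unfolding h_def by auto
  qed
  have carr: "carrier ?P = lists ?S // \<rho>"
    and mult: "U \<otimes>\<^bsub>?P\<^esub> V = (\<Union>u\<in>U. \<Union>v\<in>V. \<rho> `` {u @ v})" for U V
    by (simp_all add: presented_monoid_def Let_def \<rho>_def)
  have POI: "carrier (POI k m) = POI_carrier k m" "\<alpha> \<otimes>\<^bsub>POI k m\<^esub> \<beta> = \<beta> \<circ>\<^sub>m \<alpha>" for \<alpha> \<beta>
    by (simp_all add: POI_def)
  have "h \<in> hom (POI k m) ?P"
  proof (rule homI)
    fix \<alpha> assume "\<alpha> \<in> carrier (POI k m)"
    then obtain u where "u \<in> lists ?S" "pmap k m u = \<alpha>" using pmap_surj[OF k m] POI by blast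
    then show "h \<alpha> \<in> carrier ?P"
      using h carr quotientI by metis
  next
    fix \<alpha> \<beta> assume "\<alpha> \<in> carrier (POI k m)" "\<beta> \<in> carrier (POI k m)"
    then obtain u v where uv: "u \<in> lists ?S" "pmap k m u = \<alpha>" "v \<in> lists ?S" "pmap k m v = \<beta>"
      using pmap_surj[OF k m] POI by metis
    have "h (\<alpha> \<otimes>\<^bsub>POI k m\<^esub> \<beta>) = h (pmap k m (u @ v))"
      using pmap_append[OF k m uv(1), of v] uv POI by simp
    also have "\<dots> = \<rho> `` {u @ v}"
      using uv by (intro h) simp
    also have "\<dots> = h \<alpha> \<otimes>\<^bsub>?P\<^esub> h \<beta>"
      using class_mult[OF cong uv(1,3)] h[OF uv(1)] h[OF uv(3)] uv(2,4) mult by simp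
    finally show "h (\<alpha> \<otimes>\<^bsub>POI k m\<^esub> \<beta>) = h \<alpha> \<otimes>\<^bsub>?P\<^esub> h \<beta>" .
  qed
  moreover have "bij_betw h (carrier (POI k m)) (carrier ?P)"
    unfolding bij_betw_def
  proof
    show "inj_on h (carrier (POI k m))"
    proof (rule inj_onI)
      fix \<alpha> \<beta> assume "\<alpha> \<in> carrier (POI k m)" "h \<alpha> = h \<beta>"
      then obtain u where "u \<in> lists ?S" "pmap k m u = \<alpha>" using pmap_surj[OF k m] POI by blast
      then have "u \<in> h \<beta>" using \<open>h \<alpha> = h \<beta>\<close> unfolding h_def by blast
      then show "\<alpha> = \<beta>" using \<open>pmap k m u = \<alpha>\<close> by (simp add: h_def)
    qed
    show "h ` carrier (POI k m) = carrier ?P"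
    proof
      show "h ` carrier (POI k m) \<subseteq> carrier ?P"
        using \<open>h \<in> hom _ _\<close> by (auto simp: hom_def)
      show "carrier ?P \<subseteq> h ` carrier (POI k m)"
      proof
        fix C assume "C \<in> carrier ?P"
        then obtain u where u: "u \<in> lists ?S" "C = \<rho> `` {u}"
          unfolding carr by (rule quotientE)
        then show "C \<in> h ` carrier (POI k m)"
          using h[OF u(1)] pmap_in_carrier[OF k m u(1)] POI(1) by blast
      qed
    qed
  qed
  ultimately show ?thesis
    unfolding is_iso_def iso_def by blast
qed

theorem theorem3p10:
  fixes k m :: nat
  assumes "k \<ge> 2" and "m \<ge> 2"
  shows "POI k m \<cong> presented_monoid (generators k) (relations k m) \<and>
    card (generators k) = 3 * k \<and>
    finite (relations k m) \<and>
    (m \<ge> 3 \<longrightarrow> real (card (relations k m)) =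
       1 / 2 * (9 * real k ^ 2 + (2 * real m + 7) * real k - 4)) \<and>
    (m = 2 \<longrightarrow> real (card (relations k m)) =
       1 / 2 * (9 * real k ^ 2 + (2 * real m + 7) * real k - 4) + real k)"
  using POI_iso_presented[OF assms] card_generators[OF assms(1)] card_relations[OF assms]
  by (auto simp: field_simps)

end
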